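(* Let $M$ be an $n\times n$ matrix over a field $\mathbb F$ of characteristic different from $2$. The following conditions are equivalent (condition (iv) being considered only when $M$ is nonsingular): (i) $M\notin\Xi_n(\mathbb F)$; (ii) $M$ has a direct summand for congruence that is either - a nonsingular matrix $Q$ such that $Q^{-T}Q$ is similar to $J_r(1)$ with odd $r$ (if $\mathbb F$ is algebraically closed, then one can take $Q$ to be $\Gamma_r$, since any such $Q$ is congruent to $\Gamma_r$), or - $J_s(0)$ with odd $s$; (iii) $(M^T,M)$ has a direct summand for equivalence that is either $(I_r,J_r(1))$ with odd $r$, or $(F_t,G_t)$ with any positive integer $t$; (iv) (in the case of nonsingular $M$) $M^{-T}M$ has a direct summand for similarity that is $J_r(1)$ with odd $r$.
   Context: $\Xi_n(\mathbb F)$ is the set of all $n\times n$ matrices $M$ over $\mathbb F$ such that every nonsingular $n\times n$ matrix $S$ over $\mathbb F$ with $S^TMS=M$ satisfies $\det S=1$. All matrices are over $\mathbb F$, and $M^{-T}:=(M^{-1})^T$. Two $n\times n$ matrices $A,B$ are congruent if $S^TAS=B$ for some nonsingular $S$, and similar if $S^{-1}AS=B$ for some nonsingular $S$. A square matrix $A$ is a direct summand of $M$ for congruence (respectively, similarity) if $M$ is congruent (respectively, similar) to $A\oplus B$ for some square matrix $B$, which may be empty. In a matrix pair both matrices have the same size. Pairs $(A,B)$ and $(C,D)$ are equivalent if there are nonsingular matrices $R,S$ with $(RAS,RBS)=(C,D)$. The direct sum of pairs is $(A,B)\oplus(C,D):=(A\oplus C,B\oplus D)$. The pair $(A,B)$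 is a direct summand of $(M,N)$ for equivalence if $(M,N)$ is equivalent to $(A,B)\oplus(C,D)$ for some pair $(C,D)$. Summands in pairs need not be square; matrices with zero rows or zero columns are allowed (a direct sum with a $0\times k$ matrix adjoins $k$ zero columns, and with a $k\times 0$ matrix adjoins $k$ zero rows), and the complementary summand may be empty. For a positive integer $r$: $J_r(\lambda)$ is the $r\times r$ Jordan block with $\lambda$ on the main diagonal, $1$ on the first subdiagonal and $0$ elsewhere. $F_r$ and $G_r$ are the $(r-1)\times r$ matrices $F_r=[\,I_{r-1}\ \ 0\,]$ and $G_r=[\,0\ \ I_{r-1}\,]$, where $0$ is a zero column. $\Gamma_r$ is the $r\times r$ matrix whose entry in position $(r+1-i,i)$ is $(-1)^{i-1}$ for $1\le i\le r$, whose entry in position $(r+1-i,i+1)$ is $(-1)^{i-1}$ for $1\le i\le r-1$, and all of whose other entries are $0$ (so the last row is $(1,1,0,\dots,0)$, the row above it is $(0,-1,-1,0,\dots,0)$, and so on). *)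

theory Defs
  imports
    "Jordan_Normal_Form.Jordan_Normal_Form"
    "Jordan_Normal_Form.Gauss_Jordan_Elimination"
    "Jordan_Normal_Form.Determinant"
begin

definition Xi :: "nat \<Rightarrow> 'a::field mat set" where
  "Xi n = {M \<in> carrier_mat n n.
     \<forall>S \<in> carrier_mat n n. invertible_mat S \<longrightarrow> S\<^sup>T * M * S = M \<longrightarrow> det S = 1}"

text \<open>Sums with \<open>0 \<times> k\<close> and \<open>k \<times> 0\<close> matrices are covered: they adjoin
  zero columns, respectively zero rows.\<close>

definition mat_sum :: "'a::zero mat \<Rightarrow> 'a mat \<Rightarrow> 'a mat" where
  "mat_sum A B =
     four_block_mat A (0\<^sub>m (dim_row A) (dim_col B)) (0\<^sub>m (dim_row B) (dim_col A)) B"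

definition congruent_mat :: "'a::field mat \<Rightarrow> 'a mat \<Rightarrow> bool" where
  "congruent_mat A B \<longleftrightarrow> (\<exists>n. A \<in> carrier_mat n n \<and> B \<in> carrier_mat n n \<and>
     (\<exists>S \<in> carrier_mat n n. invertible_mat S \<and> S\<^sup>T * A * S = B))"

definition congruence_summand :: "'a::field mat \<Rightarrow> 'a mat \<Rightarrow> bool" where
  "congruence_summand A M \<longleftrightarrow>
     square_mat A \<and> (\<exists>B. square_mat B \<and> congruent_mat M (mat_sum A B))"

definition similarity_summand :: "'a::field mat \<Rightarrow> 'a mat \<Rightarrow> bool" where
  "similarity_summand A M \<longleftrightarrow>
     square_mat A \<and> (\<exists>B. square_mat B \<and> similar_mat M (mat_sum A B))"

definition equivalent_pair :: "'a::field mat \<times> 'a mat \<Rightarrow> 'a mat \<times> 'a mat \<Rightarrow> bool" where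
  "equivalent_pair P Q \<longleftrightarrow>
     (\<exists>m n. {fst P, snd P, fst Q, snd Q} \<subseteq> carrier_mat m n \<and>
       (\<exists>R \<in> carrier_mat m m. \<exists>S \<in> carrier_mat n n. invertible_mat R \<and> invertible_mat S \<and>
          (R * fst P * S, R * snd P * S) = Q))"

definition same_size :: "'a mat \<times> 'a mat \<Rightarrow> bool" where
  "same_size P \<longleftrightarrow>
     dim_row (fst P) = dim_row (snd P) \<and> dim_col (fst P) = dim_col (snd P)"

definition pair_sum :: "'a::zero mat \<times> 'a mat \<Rightarrow> 'a mat \<times> 'a mat \<Rightarrow> 'a mat \<times> 'a mat" where
  "pair_sum P Q = (mat_sum (fst P) (fst Q), mat_sum (snd P) (snd Q))"

definition equivalence_summand :: "'a::field mat \<times> 'a mat \<Rightarrow> 'a mat \<times> 'a mat \<Rightarrow> bool" where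
  "equivalence_summand P N \<longleftrightarrow>
     same_size P \<and> (\<exists>Q. same_size Q \<and> equivalent_pair N (pair_sum P Q))"

text \<open>The ones are on the first subdiagonal, whereas \<^const>\<open>jordan_block\<close> has them on the
  superdiagonal.\<close>

definition lower_jordan_block :: "nat \<Rightarrow> 'a::{zero,one} \<Rightarrow> 'a mat" where
  "lower_jordan_block r a = (jordan_block r a)\<^sup>T"

definition F_mat :: "nat \<Rightarrow> 'a::{zero,one} mat" where
  "F_mat r = mat (r - 1) r (\<lambda>(i, j). if j = i then 1 else 0)"

definition G_mat :: "nat \<Rightarrow> 'a::{zero,one} mat" where
  "G_mat r = mat (r - 1) r (\<lambda>(i, j). if j = Suc i then 1 else 0)"

text \<open>With indices starting at \<open>0\<close>, the entries \<open>(r + 1 - i, i)\<close> and \<open>(r + 1 - i, i + 1)\<close> of the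
  usual one-based description lie on the lines \<open>i + j = r - 1\<close> and \<open>i + j = r\<close>; in the latter,
  \<open>j\<close> is positive.\<close>

definition Gamma_mat :: "nat \<Rightarrow> 'a::ring_1 mat" where
  "Gamma_mat r = mat r r (\<lambda>(i, j).
     if i + j + 1 = r then (-1) ^ j else if i + j = r then (-1) ^ (j - 1) else 0)"

text \<open>\<open>M\<^sup>-\<^sup>T M\<close>; meaningful only for nonsingular \<open>M\<close>, as \<^const>\<open>mat_inverse\<close> is
  \<^const>\<open>None\<close> otherwise.\<close>

definition cosquare :: "'a::field mat \<Rightarrow> 'a mat" where
  "cosquare M = (the (mat_inverse M))\<^sup>T * M"

definition has_jordan_cosquare :: "nat \<Rightarrow> 'a::field mat \<Rightarrow> bool" where
  "has_jordan_cosquare r Q \<longleftrightarrow>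
     invertible_mat Q \<and> similar_mat (cosquare Q) (lower_jordan_block r 1)"

text \<open>A predicate rather than the class \<^class>\<open>alg_closed_field\<close>, so that it can be a hypothesis
  on part of a statement about an arbitrary field.\<close>

definition algebraically_closed :: "'a::field itself \<Rightarrow> bool" where
  "algebraically_closed _ \<longleftrightarrow> (\<forall>p :: 'a poly. degree p > 0 \<longrightarrow> (\<exists>x. poly p x = 0))"

end

theory Submission
  imports
    Defs
    "Jordan_Normal_Form.Jordan_Normal_Form_Existence"
begin

text \<open>
  A square matrix \<open>M\<close> is regarded as a bilinear form; the matrices \<open>S\<close> with \<open>S\<^sup>T * M * S = M\<close> are its
  isometries, and congruence summands are orthogonal summands. The theorem says that an
  isometry of determinant different from \<open>1\<close> exists exactly if one of two kinds of indecomposable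
  summands of odd size occurs: a nonsingular one with cosquare \<open>J\<^sub>r(1)\<close>, or \<open>J\<^sub>s(0)\<close>. In one
  direction, \<open>-1\<close> on an odd summand and \<open>1\<close> on its complement is an isometry of determinant \<open>-1\<close>
  (\<open>odd_summand_imp_not_Xi\<close>). The other direction distinguishes whether the pencil
  \<open>M - \<lambda> * M\<^sup>T\<close>, a matrix of polynomials, has determinant zero.

  If the determinant is zero, the coefficients of a polynomial vector in the kernel form a chain
  \<open>M * x 0 = 0\<close>, \<open>M * x (j + 1) = M\<^sup>T * x j\<close>. A chain is a morphism from \<open>(F\<^sub>t, G\<^sub>t)\<close> to \<open>(M\<^sup>T, M)\<close>.
  A chain of minimal length admits a retraction (\<open>minimal_chain_functional\<close>), because the
  obstruction that the Fredholm alternative yields is a shorter chain. The retraction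
  splits the chain off in two ways: from the pencil, which gives the equivalence summand
  \<open>(F\<^sub>t, G\<^sub>t)\<close>, and from the form, which gives the congruence summand \<open>J\<close> of size \<open>2 * t - 1\<close>
  with eigenvalue \<open>0\<close>. Conversely, both kinds of summands contain a chain. So these two conditions
  are equivalent to each other, and to the vanishing of the determinant.

  If the determinant is not zero, let \<open>S\<close> be an isometry. The generalised eigenspace of \<open>S\<close> for
  \<open>-1\<close> is an orthogonal summand \<open>K\<close>, and on its complement \<open>W\<close> the isometry has determinant \<open>1\<close>: with
  \<open>P\<close> the pencil of \<open>W\<close>, the identity \<open>S\<^sup>T * P * (S + 1) = (1 + S\<^sup>T) * P\<close> gives \<open>det S = 1\<close> after
  cancelling \<open>det P\<close> and \<open>det (S + 1)\<close>. Hence \<open>det S \<noteq> 1\<close> forces \<open>K\<close> to have odd size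
  (\<open>isometry_splits_off_odd_summand\<close>). Next, \<open>K\<close> is the orthogonal sum of a part with unipotent
  cosquare and a part whose skew-symmetric part is nonsingular and whose size is therefore even
  (\<open>regular_splits_unipotent\<close>). The unipotent cosquare has odd size, hence a Jordan block of odd
  size \<open>r\<close>. Both splittings rest on the decomposition of a regular pencil at the eigenvalue \<open>1\<close>
  (\<open>regular_pencil_splits_at_one\<close>).

  It remains to pass from a Jordan block \<open>J\<^sub>r(1)\<close> of the pencil, with \<open>r\<close> odd, to a summand of the
  form (\<open>jordan_one_equivalence_summand_imp_congruence_summand\<close>). The forms preserved by
  \<open>J\<^sub>r(1)\<close> are antitriangular and are nonsingular exactly if their corner entry is not zero.
  The Jordan chain and its dual chain, the latter transported by \<open>\<Gamma>\<^sub>r\<close>, pair with a nonzero corner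
  entry symmetrically, and polarisation provides a chain that spans a nonsingular summand.

  For algebraically closed fields, the quotient of two forms with cosquare \<open>J\<^sub>r(1)\<close> is selfadjoint
  and triangular with constant diagonal; its selfadjoint square root is a congruence between the
  two forms (\<open>same_jordan_cosquare_congruent\<close>).
\<close>

section \<open>Matrix arithmetic\<close>

text \<open>The ring laws of matrices with equations between dimensions as side conditions, so that
  they can be used as rewrite rules. Products are normalised to be nested to the right.\<close>

lemma assoc_mult_dim:
  fixes A B C :: "'a::semiring_0 mat"
  assumes "dim_col A = dim_row B" "dim_col B = dim_row C"
  shows "A * B * C = A * (B * C)"
  by (rule assoc_mult_mat[of A "dim_row A" "dim_row B" B "dim_row C" C "dim_col C"]) (use assms in \<open>auto intro: carrier_matI\<close>)

text \<open>Applies a known equation for \<open>A * B\<close> inside a product that is nested to the right.\<close>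

lemma mult_eq_assoc:
  fixes A B C D :: "'a::semiring_0 mat"
  assumes "A * B = C" "dim_col A = dim_row B" "dim_col B = dim_row D"
  shows "A * (B * D) = C * D"
  using assoc_mult_dim[OF assms(2,3)] assms(1) by simp

lemma transpose_mult_dim:
  fixes A B :: "'a::comm_semiring_0 mat"
  assumes "dim_col A = dim_row B"
  shows "(A * B)\<^sup>T = B\<^sup>T * A\<^sup>T"
  by (rule transpose_mult[of A "dim_row A" "dim_row B" B "dim_col B"]) (use assms in \<open>auto intro: carrier_matI\<close>)

lemma mult_add_dim:
  fixes A B C :: "'a::semiring_0 mat"
  assumes "dim_col A = dim_row B" "dim_row C = dim_row B" "dim_col C = dim_col B"
  shows "A * (B + C) = A * B + A * C"
  by (rule mult_add_distrib_mat[of A "dim_row A" "dim_row B" B "dim_col B" C]) (use assms in \<open>auto intro: carrier_matI\<close>)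

lemma add_mult_dim:
  fixes A B C :: "'a::semiring_0 mat"
  assumes "dim_col A = dim_row C" "dim_row B = dim_row A" "dim_col B = dim_col A"
  shows "(A + B) * C = A * C + B * C"
  by (rule add_mult_distrib_mat[of A "dim_row A" "dim_row C" B C "dim_col C"]) (use assms in \<open>auto intro: carrier_matI\<close>)

lemma mult_minus_dim:
  fixes A B C :: "'a::ring mat"
  assumes "dim_col A = dim_row B" "dim_row C = dim_row B" "dim_col C = dim_col B"
  shows "A * (B - C) = A * B - A * C"
  by (rule mult_minus_distrib_mat[of A "dim_row A" "dim_row B" B "dim_col B" C]) (use assms in \<open>auto intro: carrier_matI\<close>)

lemma minus_mult_dim:
  fixes A B C :: "'a::ring mat"
  assumes "dim_col A = dim_row C" "dim_row B = dim_row A" "dim_col B = dim_col A"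
  shows "(A - B) * C = A * C - B * C"
  by (rule minus_mult_distrib_mat[of A "dim_row A" "dim_row C" B C "dim_col C"]) (use assms in \<open>auto intro: carrier_matI\<close>)

lemma transpose_add_dim: "dim_row A = dim_row B \<Longrightarrow> dim_col A = dim_col B \<Longrightarrow> (A + B)\<^sup>T = A\<^sup>T + B\<^sup>T"
  by (rule eq_matI) auto

lemma transpose_minus_dim: "dim_row A = dim_row B \<Longrightarrow> dim_col A = dim_col B \<Longrightarrow> (A - B)\<^sup>T = A\<^sup>T - B\<^sup>T"
  by (rule eq_matI) auto

lemma mult_mat_index_sum:
  assumes "A \<in> carrier_mat n r" "B \<in> carrier_mat r m" "i < n" "j < m"
  shows "(A * B) $$ (i, j) = (\<Sum>l<r. A $$ (i, l) * B $$ (l, j))"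
  using assms by (simp add: scalar_prod_def atLeast0LessThan)

lemma obtain_inverse:
  fixes A :: "'a::field mat"
  assumes "A \<in> carrier_mat n n" "det A \<noteq> 0"
  obtains B where "B \<in> carrier_mat n n" "A * B = 1\<^sub>m n" "B * A = 1\<^sub>m n" "det B \<noteq> 0"
proof -
  from det_non_zero_imp_unit[OF assms, unfolded Units_def ring_mat_simps]
  obtain B where B: "B \<in> carrier_mat n n" "B * A = 1\<^sub>m n" "A * B = 1\<^sub>m n" by auto
  have "det A * det B = 1" using det_mult[OF assms(1) B(1)] B(3) by simp
  hence "det B \<noteq> 0" by auto
  from that[OF B(1,3,2) this] show ?thesis .
qed

lemma det_nonzero_if_right_inverse:
  fixes A :: "'a::field mat"
  assumes "A \<in> carrier_mat n n" "B \<in> carrier_mat n n" "A * B = 1\<^sub>m n"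
  shows "det A \<noteq> 0"
  using det_mult[OF assms(1,2)] assms(3) by auto

lemma invertible_mat_iff_det:
  fixes A :: "'a::field mat"
  assumes A: "A \<in> carrier_mat n n"
  shows "invertible_mat A \<longleftrightarrow> det A \<noteq> 0"
proof
  assume "invertible_mat A"
  then obtain B where B: "A * B = 1\<^sub>m (dim_row A)" "B * A = 1\<^sub>m (dim_row B)"
    unfolding invertible_mat_def inverts_mat_def by auto
  have "dim_col B = dim_col (A * B)" "dim_col A = dim_col (B * A)" by simp_all
  hence "B \<in> carrier_mat n n" using A B by (auto intro: carrier_matI)
  from det_nonzero_if_right_inverse[OF A this] show "det A \<noteq> 0" using B A by simp
next
  assume "det A \<noteq> 0"
  from obtain_inverse[OF A this] obtain B where "B \<in> carrier_mat n n" "A * B = 1\<^sub>m n" "B * A = 1\<^sub>m n" .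
  thus "invertible_mat A" using A unfolding invertible_mat_def inverts_mat_def by auto
qed

lemma mult_left_cancel_invertible:
  fixes A :: "'a::field mat"
  assumes A: "A \<in> carrier_mat n n" "det A \<noteq> 0"
    and X: "X \<in> carrier_mat n m" "Y \<in> carrier_mat n m" and eq: "A * X = A * Y"
  shows "X = Y"
proof -
  obtain B where B: "B \<in> carrier_mat n n" "B * A = 1\<^sub>m n" using obtain_inverse[OF A] by metis
  have "X = B * A * X" using B X by simp
  also have "\<dots> = B * (A * X)" using A X B(1) by (simp add: assoc_mult_dim)
  also have "\<dots> = B * A * Y" unfolding eq using A X B(1) by (simp add: assoc_mult_dim)
  finally show ?thesis using B X by simp
qed

lemma mult_right_cancel_invertible:
  fixes A :: "'a::field mat"
  assumes A: "A \<in> carrier_mat n n" "det A \<noteq> 0"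
    and X: "X \<in> carrier_mat m n" "Y \<in> carrier_mat m n" and eq: "X * A = Y * A"
  shows "X = Y"
proof -
  obtain B where B: "B \<in> carrier_mat n n" "A * B = 1\<^sub>m n" using obtain_inverse[OF A] by metis
  have "X * A * B = Y * A * B" using eq by simp
  hence "X * (A * B) = Y * (A * B)" using A X B by (simp add: assoc_mult_dim)
  thus ?thesis using B X by simp
qed

section \<open>Direct sums, congruence and its summands\<close>

lemma mat_sum_carrier [simp]:
  "A \<in> carrier_mat a b \<Longrightarrow> B \<in> carrier_mat c d \<Longrightarrow> mat_sum A B \<in> carrier_mat (a + c) (b + d)"
  unfolding mat_sum_def by simp

lemma mat_sum_dim [simp]:
  "dim_row (mat_sum A B) = dim_row A + dim_row B" "dim_col (mat_sum A B) = dim_col A + dim_col B"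
  unfolding mat_sum_def by simp_all

lemma mat_sum_index:
  "i < dim_row A + dim_row B \<Longrightarrow> j < dim_col A + dim_col B \<Longrightarrow> mat_sum A B $$ (i, j) =
    (if i < dim_row A then if j < dim_col A then A $$ (i, j) else 0
     else if j < dim_col A then 0 else B $$ (i - dim_row A, j - dim_col A))"
  unfolding mat_sum_def by auto

lemma mat_sum_mult:
  fixes A B C D :: "'a::semiring_0 mat"
  assumes "dim_col A = dim_row C" "dim_col B = dim_row D"
  shows "mat_sum A B * mat_sum C D = mat_sum (A * C) (B * D)"
proof -
  let ?c = "carrier_mat_triv"
  have "mat_sum A B * mat_sum C D = four_block_mat (A * C + 0\<^sub>m (dim_row A) (dim_col B) * 0\<^sub>m (dim_row D) (dim_col C))
     (A * 0\<^sub>m (dim_row C) (dim_col D) + 0\<^sub>m (dim_row A) (dim_col B) * D)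
     (0\<^sub>m (dim_row B) (dim_col A) * C + B * 0\<^sub>m (dim_row D) (dim_col C))
     (0\<^sub>m (dim_row B) (dim_col A) * 0\<^sub>m (dim_row C) (dim_col D) + B * D)"
    unfolding mat_sum_def
    by (rule mult_four_block_mat) (use assms in \<open>auto intro: carrier_matI\<close>)
  also have "\<dots> = mat_sum (A * C) (B * D)"
    unfolding mat_sum_def using assms by (intro cong_four_block_mat) (auto intro!: eq_matI)
  finally show ?thesis .
qed

lemma mat_sum_transpose: "(mat_sum A B)\<^sup>T = mat_sum (A\<^sup>T) (B\<^sup>T)"
  by (rule eq_matI) (auto simp: mat_sum_index)

lemma mat_sum_one: "mat_sum (1\<^sub>m a) (1\<^sub>m b) = 1\<^sub>m (a + b)"
  by (rule eq_matI) (auto simp: mat_sum_index)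

lemma mat_sum_assoc: "mat_sum A (mat_sum B C) = mat_sum (mat_sum A B) C"
  unfolding mat_sum_def using assoc_four_block_mat[of A B C] by simp

lemma mat_sum_empty_left: "A \<in> carrier_mat 0 0 \<Longrightarrow> mat_sum A B = B"
  by (rule eq_matI) (auto simp: mat_sum_index)

lemma det_mat_sum:
  fixes A B :: "'a::idom mat"
  assumes "A \<in> carrier_mat a a" "B \<in> carrier_mat b b"
  shows "det (mat_sum A B) = det A * det B"
  unfolding mat_sum_def
  by (rule det_four_block_mat_lower_left_zero[of _ a _ b]) (use assms in auto)

lemma congruent_matI:
  assumes "A \<in> carrier_mat n n" "S \<in> carrier_mat n n" "det S \<noteq> 0" "S\<^sup>T * A * S = B"
  shows "congruent_mat A B"
  using assms invertible_mat_iff_det[OF assms(2)] unfolding congruent_mat_def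
  by (intro exI[of _ n]) auto

lemma congruent_matE:
  assumes "congruent_mat A B" "A \<in> carrier_mat n n"
  obtains S where "S \<in> carrier_mat n n" "det S \<noteq> 0" "S\<^sup>T * A * S = B" "B \<in> carrier_mat n n"
proof -
  from assms(1) obtain m S where S: "A \<in> carrier_mat m m" "B \<in> carrier_mat m m" "S \<in> carrier_mat m m"
    "invertible_mat S" "S\<^sup>T * A * S = B" unfolding congruent_mat_def by blast
  have "m = n" using S(1) assms(2) by auto
  thus ?thesis using S invertible_mat_iff_det[OF S(3)] by (intro that[of S]) auto
qed

lemma congruent_mat_refl: "A \<in> carrier_mat n n \<Longrightarrow> congruent_mat A A"
  by (rule congruent_matI[of A n "1\<^sub>m n"]) auto

lemma congruent_mat_trans:
  assumes "congruent_mat A B" "congruent_mat B C"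
  shows "congruent_mat A C"
proof -
  from assms(1) obtain n where A: "A \<in> carrier_mat n n" unfolding congruent_mat_def by auto
  obtain S where S: "S \<in> carrier_mat n n" "det S \<noteq> 0" "S\<^sup>T * A * S = B" "B \<in> carrier_mat n n"
    using congruent_matE[OF assms(1) A] .
  obtain R where R: "R \<in> carrier_mat n n" "det R \<noteq> 0" "R\<^sup>T * B * R = C"
    using congruent_matE[OF assms(2) S(4)] .
  have "(S * R)\<^sup>T * A * (S * R) = R\<^sup>T * (S\<^sup>T * A * S) * R"
    using A S(1) R(1) by (simp add: assoc_mult_dim transpose_mult_dim)
  thus ?thesis using A S R
    by (intro congruent_matI[of A n "S * R"]) (auto simp: det_mult[of _ n])
qed

lemma congruent_mat_sym:
  assumes "congruent_mat A B"
  shows "congruent_mat B A"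
proof -
  from assms(1) obtain n where A: "A \<in> carrier_mat n n" unfolding congruent_mat_def by auto
  obtain S where S: "S \<in> carrier_mat n n" "det S \<noteq> 0" "S\<^sup>T * A * S = B" "B \<in> carrier_mat n n"
    using congruent_matE[OF assms(1) A] .
  obtain R where R: "R \<in> carrier_mat n n" "S * R = 1\<^sub>m n" "R * S = 1\<^sub>m n" "det R \<noteq> 0"
    using obtain_inverse[OF S(1,2)] .
  have RS: "R\<^sup>T * S\<^sup>T = 1\<^sub>m n" using R S transpose_mult_dim[of S R] by simp
  have "R\<^sup>T * B * R = R\<^sup>T * S\<^sup>T * A * (S * R)"
    unfolding S(3)[symmetric] using A R(1) S(1) by (simp add: assoc_mult_dim)
  also have "\<dots> = A" using A RS R by simp
  finally show ?thesis using R S by (intro congruent_matI[of B n R]) auto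
qed

lemma congruent_mat_sum:
  assumes "congruent_mat A B" "congruent_mat C D"
  shows "congruent_mat (mat_sum A C) (mat_sum B D)"
proof -
  from assms obtain n m where A: "A \<in> carrier_mat n n" and C: "C \<in> carrier_mat m m"
    unfolding congruent_mat_def by auto
  obtain S where S: "S \<in> carrier_mat n n" "det S \<noteq> 0" "S\<^sup>T * A * S = B" "B \<in> carrier_mat n n"
    using congruent_matE[OF assms(1) A] .
  obtain R where R: "R \<in> carrier_mat m m" "det R \<noteq> 0" "R\<^sup>T * C * R = D"
    using congruent_matE[OF assms(2) C] .
  show ?thesis
    by (rule congruent_matI[of _ "n + m" "mat_sum S R"])
      (use A S R C in \<open>auto simp: det_mat_sum[of _ n _ m] mat_sum_mult mat_sum_transpose\<close>)
qed

lemma congruence_summandI: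
  assumes "congruent_mat M (mat_sum A B)" "A \<in> carrier_mat a a" "B \<in> carrier_mat b b"
  shows "congruence_summand A M"
  using assms unfolding congruence_summand_def by auto

lemma congruence_summandE:
  assumes "congruence_summand A M" "M \<in> carrier_mat n n"
  obtains S B a b where "S \<in> carrier_mat n n" "det S \<noteq> 0" "S\<^sup>T * M * S = mat_sum A B"
    "A \<in> carrier_mat a a" "B \<in> carrier_mat b b" "n = a + b"
proof -
  from assms(1) obtain B where B: "square_mat A" "square_mat B" "congruent_mat M (mat_sum A B)"
    unfolding congruence_summand_def by auto
  obtain S where S: "S \<in> carrier_mat n n" "det S \<noteq> 0" "S\<^sup>T * M * S = mat_sum A B"
    "mat_sum A B \<in> carrier_mat n n"
    using congruent_matE[OF B(3) assms(2)] .
  show ?thesis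
    by (rule that[OF S(1-3), of "dim_row A" "dim_row B"]) (use B S(4) in \<open>auto intro: carrier_matI\<close>)
qed

lemma congruence_summand_trans:
  assumes "congruence_summand A K" "congruent_mat M (mat_sum K W)" "square_mat W"
  shows "congruence_summand A M"
proof -
  from assms(1) obtain B where B: "square_mat A" "square_mat B" "congruent_mat K (mat_sum A B)"
    unfolding congruence_summand_def by auto
  have "congruent_mat (mat_sum K W) (mat_sum (mat_sum A B) W)"
    by (rule congruent_mat_sum[OF B(3) congruent_mat_refl[of _ "dim_row W"]])
       (use assms(3) in \<open>auto intro: carrier_matI\<close>)
  hence "congruent_mat M (mat_sum A (mat_sum B W))"
    using congruent_mat_trans[OF assms(2)] by (simp add: mat_sum_assoc)
  thus ?thesis using B assms(3) unfolding congruence_summand_def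
    by (intro conjI exI[of _ "mat_sum B W"]) auto
qed

lemma congruence_summand_congruent:
  assumes "congruent_mat A A'" "congruence_summand A M"
  shows "congruence_summand A' M"
proof -
  from assms(2) obtain B where B: "square_mat A" "square_mat B" "congruent_mat M (mat_sum A B)"
    unfolding congruence_summand_def by auto
  have "congruent_mat (mat_sum A B) (mat_sum A' B)"
    by (rule congruent_mat_sum[OF assms(1) congruent_mat_refl[of _ "dim_row B"]])
       (use B(2) in \<open>auto intro: carrier_matI\<close>)
  moreover have "square_mat A'" using assms(1) unfolding congruent_mat_def by auto
  ultimately show ?thesis using congruent_mat_trans[OF B(3)] B unfolding congruence_summand_def by blast
qed

section \<open>The Fredholm alternative\<close>

text \<open>Elimination by one column at a time: if \<open>v\<close> is not in the span of the old columns, a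
  functional \<open>k\<close> separates it from them; should \<open>k\<close> not vanish on the new column, then \<open>v\<close> and
  every further functional can be corrected by multiples of that column and of \<open>k\<close>. The index
  sets are arbitrary so that the unknown may be a finite sequence of vectors.\<close>

lemma finite_fredholm_alternative:
  fixes a :: "'i \<Rightarrow> 'j \<Rightarrow> 'a::field"
  assumes I: "finite I" and J: "finite J"
  shows "(\<exists>u. \<forall>i\<in>I. v i = (\<Sum>j\<in>J. a i j * u j)) \<or>
    (\<exists>k. (\<forall>j\<in>J. (\<Sum>i\<in>I. k i * a i j) = 0) \<and> (\<Sum>i\<in>I. k i * v i) \<noteq> 0)"
  using J
proof (induction J arbitrary: v rule: finite_induct)
  case empty
  show ?case
  proof (cases "\<forall>i\<in>I. v i = 0")
    case False
    then obtain i where i: "i \<in> I" "v i \<noteq> 0" by auto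
    have "(\<Sum>j\<in>I. (if j = i then 1 else 0) * v j) = v i"
      using I i by (simp add: if_distrib[of "\<lambda>x. x * _"] cong: if_cong)
    thus ?thesis using i by (intro disjI2 exI[of _ "\<lambda>j. if j = i then 1 else 0"]) auto
  qed auto
next
  case (insert p J)
  from insert.IH[of v] show ?case
  proof
    assume "\<exists>u. \<forall>i\<in>I. v i = (\<Sum>j\<in>J. a i j * u j)"
    then obtain u where u: "\<forall>i\<in>I. v i = (\<Sum>j\<in>J. a i j * u j)" by auto
    have "(\<Sum>j\<in>insert p J. a i j * (u(p := 0)) j) = (\<Sum>j\<in>J. a i j * u j)" for i
      using insert.hyps by (auto intro!: sum.cong)
    thus ?thesis using u by (intro disjI1 exI[of _ "u(p := 0)"]) auto
  next
    assume "\<exists>k. (\<forall>j\<in>J. (\<Sum>i\<in>I. k i * a i j) = 0) \<and> (\<Sum>i\<in>I. k i * v i) \<noteq> 0"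
    then obtain k where k: "\<forall>j\<in>J. (\<Sum>i\<in>I. k i * a i j) = 0" "(\<Sum>i\<in>I. k i * v i) \<noteq> 0" by auto
    define c where "c = (\<Sum>i\<in>I. k i * a i p)"
    show ?thesis
    proof (cases "c = 0")
      case True
      thus ?thesis using k unfolding c_def by auto
    next
      case c: False
      define d where "d = (\<Sum>i\<in>I. k i * v i) / c"
      from insert.IH[of "\<lambda>i. v i - d * a i p"] show ?thesis
      proof
        assume "\<exists>u. \<forall>i\<in>I. v i - d * a i p = (\<Sum>j\<in>J. a i j * u j)"
        then obtain u where u: "\<forall>i\<in>I. v i - d * a i p = (\<Sum>j\<in>J. a i j * u j)" by auto
        have "(\<Sum>j\<in>insert p J. a i j * (u(p := d)) j) = a i p * d + (\<Sum>j\<in>J. a i j * u j)" for i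
          using insert.hyps by (auto intro!: sum.cong)
        moreover have "v i = a i p * d + (\<Sum>j\<in>J. a i j * u j)" if "i \<in> I" for i
          using bspec[OF u that] by (simp add: diff_eq_eq mult.commute add.commute)
        ultimately show ?thesis by (intro disjI1 exI[of _ "u(p := d)"]) auto
      next
        assume "\<exists>k'. (\<forall>j\<in>J. (\<Sum>i\<in>I. k' i * a i j) = 0) \<and> (\<Sum>i\<in>I. k' i * (v i - d * a i p)) \<noteq> 0"
        then obtain k' where k': "\<forall>j\<in>J. (\<Sum>i\<in>I. k' i * a i j) = 0"
            "(\<Sum>i\<in>I. k' i * (v i - d * a i p)) \<noteq> 0" by auto
        define e where "e = (\<Sum>i\<in>I. k' i * a i p) / c"
        have lin: "(\<Sum>i\<in>I. (k' i - e * k i) * w i) = (\<Sum>i\<in>I. k' i * w i) - e * (\<Sum>i\<in>I. k i * w i)" for w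
          by (simp add: left_diff_distrib sum_subtractf sum_distrib_left mult.assoc)
        have "\<forall>j\<in>insert p J. (\<Sum>i\<in>I. (k' i - e * k i) * a i j) = 0"
          unfolding lin using k k' c by (auto simp: e_def c_def)
        moreover have "(\<Sum>i\<in>I. (k' i - e * k i) * v i) = (\<Sum>i\<in>I. k' i * (v i - d * a i p))"
        proof -
          have "(\<Sum>i\<in>I. k' i * (v i - d * a i p)) = (\<Sum>i\<in>I. k' i * v i) - d * (\<Sum>i\<in>I. k' i * a i p)"
            by (simp add: right_diff_distrib sum_subtractf sum_distrib_left mult_ac)
          also have "d * (\<Sum>i\<in>I. k' i * a i p) = e * (\<Sum>i\<in>I. k i * v i)"
            unfolding d_def e_def by simp
          finally show ?thesis unfolding lin by simp
        qed
        ultimately show ?thesis using k' by (intro disjI2 exI[of _ "\<lambda>i. k' i - e * k i"]) auto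
      qed
    qed
  qed
qed

section \<open>Block rows, block columns and complements\<close>

definition hcat :: "'a mat \<Rightarrow> 'a mat \<Rightarrow> 'a mat" where
  "hcat A B = mat (dim_row A) (dim_col A + dim_col B)
     (\<lambda>(i, j). if j < dim_col A then A $$ (i, j) else B $$ (i, j - dim_col A))"

definition vcat :: "'a mat \<Rightarrow> 'a mat \<Rightarrow> 'a mat" where
  "vcat A B = mat (dim_row A + dim_row B) (dim_col A)
     (\<lambda>(i, j). if i < dim_row A then A $$ (i, j) else B $$ (i - dim_row A, j))"

lemma hcat_carrier [simp]:
  "A \<in> carrier_mat n a \<Longrightarrow> B \<in> carrier_mat n b \<Longrightarrow> hcat A B \<in> carrier_mat n (a + b)"
  unfolding hcat_def by auto

lemma vcat_carrier [simp]:
  "A \<in> carrier_mat a n \<Longrightarrow> B \<in> carrier_mat b n \<Longrightarrow> vcat A B \<in> carrier_mat (a + b) n"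
  unfolding vcat_def by auto

lemma transpose_hcat:
  "dim_row A = dim_row B \<Longrightarrow> (hcat A B)\<^sup>T = vcat (A\<^sup>T) (B\<^sup>T)"
  by (rule eq_matI) (auto simp: hcat_def vcat_def)

lemma mult_hcat:
  fixes M A B :: "'a::semiring_0 mat"
  assumes "dim_col M = dim_row A" "dim_row B = dim_row A"
  shows "M * hcat A B = hcat (M * A) (M * B)"
  by (rule eq_matI) (use assms in \<open>auto simp: hcat_def scalar_prod_def\<close>)

lemma vcat_mult:
  fixes M A B :: "'a::semiring_0 mat"
  assumes "dim_col A = dim_row M" "dim_col B = dim_col A"
  shows "vcat A B * M = vcat (A * M) (B * M)"
  by (rule eq_matI) (use assms in \<open>auto simp: vcat_def scalar_prod_def\<close>)

lemma hcat_mult_vcat: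
  fixes A B C D :: "'a::semiring_0 mat"
  assumes "A \<in> carrier_mat n a" "B \<in> carrier_mat n b" "C \<in> carrier_mat a m" "D \<in> carrier_mat b m"
  shows "hcat A B * vcat C D = A * C + B * D"
proof (rule eq_matI)
  fix i j assume "i < dim_row (A * C + B * D)" "j < dim_col (A * C + B * D)"
  hence ij: "i < n" "j < m" using assms by auto
  have r: "row (hcat A B) i = row A i @\<^sub>v row B i"
    using assms ij by (intro eq_vecI) (auto simp: hcat_def append_vec_def)
  have c: "col (vcat C D) j = col C j @\<^sub>v col D j"
    using assms ij by (intro eq_vecI) (auto simp: vcat_def append_vec_def)
  have "(hcat A B * vcat C D) $$ (i, j) = row (hcat A B) i \<bullet> col (vcat C D) j"
    using assms ij by (simp add: hcat_def vcat_def)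
  also have "\<dots> = row A i \<bullet> col C j + row B i \<bullet> col D j"
    unfolding r c by (rule scalar_prod_append[of _ a _ b]) (use assms ij in auto)
  finally show "(hcat A B * vcat C D) $$ (i, j) = (A * C + B * D) $$ (i, j)" using assms ij by simp
qed (use assms in \<open>auto simp: hcat_def vcat_def\<close>)

lemma vcat_mult_hcat:
  fixes A B C D :: "'a::semiring_0 mat"
  assumes "A \<in> carrier_mat a n" "B \<in> carrier_mat b n" "C \<in> carrier_mat n c" "D \<in> carrier_mat n d"
  shows "vcat A B * hcat C D = four_block_mat (A * C) (A * D) (B * C) (B * D)"
  by (rule eq_matI) (use assms in \<open>auto simp: hcat_def vcat_def scalar_prod_def\<close>)

lemma four_block_mult_vcat:
  fixes A B C D X Y :: "'a::semiring_0 mat"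
  assumes "A \<in> carrier_mat a c" "B \<in> carrier_mat a d" "C \<in> carrier_mat b c" "D \<in> carrier_mat b d"
    "X \<in> carrier_mat c n" "Y \<in> carrier_mat d n"
  shows "four_block_mat A B C D * vcat X Y = vcat (A * X + B * Y) (C * X + D * Y)"
proof -
  have "four_block_mat A B C D = vcat (hcat A B) (hcat C D)"
    by (rule eq_matI) (use assms in \<open>auto simp: hcat_def vcat_def\<close>)
  moreover have "vcat (hcat A B) (hcat C D) * vcat X Y = vcat (hcat A B * vcat X Y) (hcat C D * vcat X Y)"
    by (rule vcat_mult) (use assms in \<open>auto simp: hcat_def vcat_def\<close>)
  ultimately show ?thesis
    using hcat_mult_vcat[OF assms(1,2,5,6)] hcat_mult_vcat[OF assms(3,4,5,6)] by simp
qed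

lemma hcat_eq_zero:
  assumes "hcat A B = 0\<^sub>m n (a + b)" "A \<in> carrier_mat n a" "B \<in> carrier_mat n b"
  shows "A = 0\<^sub>m n a" "B = 0\<^sub>m n b"
proof -
  have *: "hcat A B $$ (i, j) = 0" if "i < n" "j < a + b" for i j using assms(1) that by simp
  show "A = 0\<^sub>m n a"
  proof (rule eq_matI)
    fix i j assume "i < dim_row (0\<^sub>m n a :: 'a mat)" "j < dim_col (0\<^sub>m n a :: 'a mat)"
    thus "A $$ (i, j) = 0\<^sub>m n a $$ (i, j)" using *[of i j] assms(2,3) by (simp add: hcat_def)
  qed (use assms in auto)
  show "B = 0\<^sub>m n b"
  proof (rule eq_matI)
    fix i j assume "i < dim_row (0\<^sub>m n b :: 'a mat)" "j < dim_col (0\<^sub>m n b :: 'a mat)"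
    thus "B $$ (i, j) = 0\<^sub>m n b $$ (i, j)" using *[of i "a + j"] assms(2,3) by (simp add: hcat_def)
  qed (use assms in auto)
qed

lemma vcat_eq_zero:
  assumes "vcat A B = 0\<^sub>m (a + b) n" "A \<in> carrier_mat a n" "B \<in> carrier_mat b n"
  shows "A = 0\<^sub>m a n" "B = 0\<^sub>m b n"
proof -
  have "hcat (A\<^sup>T) (B\<^sup>T) = (vcat A B)\<^sup>T"
    by (rule eq_matI) (use assms(2,3) in \<open>auto simp: hcat_def vcat_def\<close>)
  hence "hcat (A\<^sup>T) (B\<^sup>T) = 0\<^sub>m n (a + b)" unfolding assms(1) by simp
  from hcat_eq_zero[OF this] assms(2,3) have "A\<^sup>T = 0\<^sub>m n a" "B\<^sup>T = 0\<^sub>m n b" by simp_all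
  from arg_cong[OF this(1), of transpose_mat] arg_cong[OF this(2), of transpose_mat]
  show "A = 0\<^sub>m a n" "B = 0\<^sub>m b n" by simp_all
qed

lemma four_block_eq_mat_sum:
  "A \<in> carrier_mat a c \<Longrightarrow> D \<in> carrier_mat b d \<Longrightarrow> B = 0\<^sub>m a d \<Longrightarrow> C = 0\<^sub>m b c \<Longrightarrow>
    four_block_mat A B C D = mat_sum A D"
  unfolding mat_sum_def by simp

text \<open>Otherwise, padding with zeros would give mutually inverse square matrices one of which has a
  zero column.\<close>

lemma left_inverse_dim_le:
  fixes A U :: "'a::field mat"
  assumes A: "A \<in> carrier_mat k n" and U: "U \<in> carrier_mat n k" and AU: "A * U = 1\<^sub>m k"
  shows "k \<le> n"
proof (rule ccontr)
  assume "\<not> k \<le> n"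
  then obtain d where k: "k = n + d" and d: "d > 0" by (metis less_imp_add_positive not_le)
  let ?A = "hcat A (0\<^sub>m k d)" and ?U = "vcat U (0\<^sub>m d k)"
  have c: "?A \<in> carrier_mat k k" "?U \<in> carrier_mat k k"
    using hcat_carrier[OF A, of "0\<^sub>m k d" d] vcat_carrier[OF U, of "0\<^sub>m d k" d] k by auto
  have "?A * ?U = 1\<^sub>m k"
    using hcat_mult_vcat[OF A, of "0\<^sub>m k d" d U k "0\<^sub>m d k"] U AU by simp
  from det_nonzero_if_right_inverse[OF c this] have nz: "det ?A \<noteq> 0" .
  have "?A *\<^sub>v unit_vec k n = 0\<^sub>v k"
    by (rule eq_vecI) (use A k d in \<open>auto simp: hcat_def\<close>)
  moreover have "unit_vec k n \<noteq> (0\<^sub>v k :: 'a vec)" using k d by simp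
  ultimately have "det ?A = 0" unfolding det_0_iff_vec_prod_zero_field[OF c(1)]
    by (intro exI[of _ "unit_vec k n"]) simp
  with nz show False by simp
qed

text \<open>As long as the idempotent \<open>E = 1 - U * A\<close> is not zero, a column of \<open>E\<close> and a row of \<open>E\<close> that
  meet in a nonzero entry can, after scaling, be adjoined to \<open>U\<close> and \<open>A\<close>, because \<open>A * E = 0\<close> and
  \<open>E * U = 0\<close>. In the end the columns of \<open>U\<close> and \<open>V\<close> form a basis, with the rows of \<open>A\<close> and \<open>B\<close> as
  dual basis.\<close>

lemma complete_left_inverse:
  fixes A U :: "'a::field mat"
  assumes A: "A \<in> carrier_mat k n" and U: "U \<in> carrier_mat n k" and AU: "A * U = 1\<^sub>m k"
  obtains V B m where "n = k + m" "V \<in> carrier_mat n m" "B \<in> carrier_mat m n"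
    "B * V = 1\<^sub>m m" "B * U = 0\<^sub>m m k" "A * V = 0\<^sub>m k m" "U * A + V * B = 1\<^sub>m n"
proof -
  define m where "m = n - k"
  have n: "n = k + m" using left_inverse_dim_le[OF assms] m_def by simp
  have "\<exists>V B. V \<in> carrier_mat n m \<and> B \<in> carrier_mat m n \<and>
    B * V = 1\<^sub>m m \<and> B * U = 0\<^sub>m m k \<and> A * V = 0\<^sub>m k m \<and> U * A + V * B = 1\<^sub>m n"
    using n assms
  proof (induction m arbitrary: k A U)
    case 0
    have "U * A = 1\<^sub>m n" using mat_mult_left_right_inverse[of A n U] 0 by simp
    thus ?case using 0 by (intro exI[of _ "0\<^sub>m n 0"] exI[of _ "0\<^sub>m 0 n"]) (auto intro: eq_matI)
  next
    case (Suc m)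
    note A = Suc.prems(2) and U = Suc.prems(3) and AU = Suc.prems(4)
    define E where "E = 1\<^sub>m n - U * A"
    have E: "E \<in> carrier_mat n n" unfolding E_def using A U by (auto intro: minus_carrier_mat)
    have EU: "E * U = 0\<^sub>m n k" unfolding E_def using A U AU by (simp add: minus_mult_dim assoc_mult_dim)
    have AE: "A * E = 0\<^sub>m k n" unfolding E_def using A U AU
      by (simp add: mult_minus_dim mult_eq_assoc[OF AU])
    have "E \<noteq> 0\<^sub>m n n"
    proof
      assume "E = 0\<^sub>m n n"
      have UA: "U * A = 1\<^sub>m n"
      proof (rule eq_matI)
        fix i j assume "i < dim_row (1\<^sub>m n :: 'a mat)" "j < dim_col (1\<^sub>m n :: 'a mat)"
        hence ij: "i < n" "j < n" by auto
        hence "E $$ (i, j) = 0" using \<open>E = 0\<^sub>m n n\<close> by simp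
        thus "(U * A) $$ (i, j) = (1\<^sub>m n) $$ (i, j)" using ij U A unfolding E_def by simp
      qed (use U A in auto)
      from left_inverse_dim_le[OF U A this] Suc.prems(1) show False by simp
    qed
    then obtain p q where pq: "p < n" "q < n" "E $$ (p, q) \<noteq> 0"
      using E eq_matI[of "0\<^sub>m n n" E] by auto
    define e where "e = E $$ (p, q)"
    define u where "u = mat n 1 (\<lambda>(i, j). E $$ (i, q) / e)"
    define a where "a = mat 1 n (\<lambda>(i, j). E $$ (p, j))"
    have uE: "u = E * mat n 1 (\<lambda>(i, j). if i = q then 1 / e else 0)"
      by (rule eq_matI) (use E pq in \<open>auto simp: u_def scalar_prod_def if_distrib cong: if_cong\<close>)
    have aE: "a = mat 1 n (\<lambda>(i, j). if j = p then 1 else 0) * E"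
      by (rule eq_matI) (use E pq in \<open>auto simp: a_def scalar_prod_def if_distrib[of "\<lambda>x. x * _"] cong: if_cong\<close>)
    have c: "u \<in> carrier_mat n 1" "a \<in> carrier_mat 1 n" unfolding u_def a_def by auto
    have Au: "A * u = 0\<^sub>m k 1" unfolding uE using A E mult_eq_assoc[OF AE] by simp
    have aU: "a * U = 0\<^sub>m 1 k" unfolding aE using U E EU by (simp add: assoc_mult_dim)
    have "E * E = E - U * (A * E)"
      using E A U by (subst (1) E_def) (simp add: minus_mult_dim assoc_mult_dim)
    hence EE: "E * E = E" unfolding AE using E U by (auto intro!: eq_matI)
    have "a * E = a" unfolding aE using E EE by (simp add: assoc_mult_dim)
    have au: "a * u = 1\<^sub>m 1"
    proof (rule eq_matI)
      fix i j assume "i < dim_row (1\<^sub>m 1 :: 'a mat)" "j < dim_col (1\<^sub>m 1 :: 'a mat)"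
      hence ij: "i = 0" "j = 0" by auto
      have "a * u = a * E * mat n 1 (\<lambda>(i, j). if i = q then 1 / e else 0)"
        unfolding uE using c E by (simp add: assoc_mult_dim)
      also have "\<dots> = a * mat n 1 (\<lambda>(i, j). if i = q then 1 / e else 0)" unfolding \<open>a * E = a\<close> ..
      finally show "(a * u) $$ (i, j) = 1\<^sub>m 1 $$ (i, j)"
        using ij pq by (simp add: scalar_prod_def a_def if_distrib e_def cong: if_cong)
    qed (use c in auto)
    have c1: "vcat A a \<in> carrier_mat (k + 1) n" "hcat U u \<in> carrier_mat n (k + 1)"
      using vcat_carrier[OF A c(2)] hcat_carrier[OF U c(1)] by auto
    have "vcat A a * hcat U u = 1\<^sub>m (k + 1)"
      by (simp add: vcat_mult_hcat[OF A c(2) U c(1)] AU Au aU au)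
    from Suc.IH[OF _ c1 this] Suc.prems(1) obtain V B where
      VB: "V \<in> carrier_mat n m" "B \<in> carrier_mat m n" "B * V = 1\<^sub>m m"
        "B * hcat U u = 0\<^sub>m m (k + 1)" "vcat A a * V = 0\<^sub>m (k + 1) m"
        "hcat U u * vcat A a + V * B = 1\<^sub>m n" by auto
    have BU: "B * U = 0\<^sub>m m k" "B * u = 0\<^sub>m m 1"
      using hcat_eq_zero[of "B * U" "B * u" m k 1] VB(4) mult_hcat[of B U u] VB(1,2) U c by auto
    have AV: "A * V = 0\<^sub>m k m" "a * V = 0\<^sub>m 1 m"
      using vcat_eq_zero[of "A * V" "a * V" k 1 m] VB(5) vcat_mult[of A V a] VB(1,2) A c by auto
    show ?case
    proof (intro exI conjI)
      show "hcat u V \<in> carrier_mat n (Suc m)" using hcat_carrier[OF c(1) VB(1)] by simp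
      show "vcat a B \<in> carrier_mat (Suc m) n" using vcat_carrier[OF c(2) VB(2)] by simp
      show "vcat a B * hcat u V = 1\<^sub>m (Suc m)"
        by (simp add: vcat_mult_hcat[OF c(2) VB(2) c(1) VB(1)] au AV BU VB)
      have z: "vcat (0\<^sub>m 1 k) (0\<^sub>m m k) = 0\<^sub>m (Suc m) k" "hcat (0\<^sub>m k 1) (0\<^sub>m k m) = 0\<^sub>m k (Suc m)"
        by (auto simp: vcat_def hcat_def intro!: eq_matI)
      show "vcat a B * U = 0\<^sub>m (Suc m) k" using vcat_mult[of a U B] c VB(2) U aU BU z by simp
      show "A * hcat u V = 0\<^sub>m k (Suc m)" using mult_hcat[of A u V] c VB(1) A Au AV z by simp
      have "U * A + hcat u V * vcat a B = U * A + (u * a + V * B)"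
        by (simp add: hcat_mult_vcat[OF c(1) VB(1) c(2) VB(2)])
      also have "\<dots> = U * A + u * a + V * B"
        using U A c VB(1,2) by (intro assoc_add_mat[of _ n n, symmetric]) auto
      also have "\<dots> = 1\<^sub>m n" using VB(6) by (simp add: hcat_mult_vcat[OF U c(1) A c(2)])
      finally show "U * A + hcat u V * vcat a B = 1\<^sub>m n" .
    qed
  qed
  thus ?thesis using that[OF n] by auto
qed

lemma det_hcat_complement:
  fixes A U V B :: "'a::field mat"
  assumes A: "A \<in> carrier_mat k n" and U: "U \<in> carrier_mat n k"
    and V: "V \<in> carrier_mat n m" "B \<in> carrier_mat m n" and n: "n = k + m"
    and "U * A + V * B = 1\<^sub>m n"
  shows "det (hcat U V) \<noteq> 0" "det (vcat A B) \<noteq> 0"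
proof -
  have c: "hcat U V \<in> carrier_mat n n" "vcat A B \<in> carrier_mat n n"
    using hcat_carrier[OF U V(1)] vcat_carrier[OF A V(2)] n by auto
  have 1: "hcat U V * vcat A B = 1\<^sub>m n" using hcat_mult_vcat[OF U V(1) A V(2)] assms(6) by simp
  show "det (hcat U V) \<noteq> 0" by (rule det_nonzero_if_right_inverse[OF c 1])
  show "det (vcat A B) \<noteq> 0"
    by (rule det_nonzero_if_right_inverse[OF c(2,1) mat_mult_left_right_inverse[OF c 1]])
qed

section \<open>Splitting off a congruence summand\<close>

lemma congruent_split:
  fixes M U V A B :: "'a::field mat"
  assumes M: "M \<in> carrier_mat n n" and A: "A \<in> carrier_mat k n" and U: "U \<in> carrier_mat n k"
    and V: "V \<in> carrier_mat n m" "B \<in> carrier_mat m n" and n: "n = k + m"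
    and 1: "U * A + V * B = 1\<^sub>m n"
    and z: "U\<^sup>T * M * V = 0\<^sub>m k m" "V\<^sup>T * M * U = 0\<^sub>m m k"
  shows "congruence_summand (U\<^sup>T * M * U) M"
proof -
  have c: "hcat U V \<in> carrier_mat n n" using hcat_carrier[OF U V(1)] n by auto
  have cc: "U\<^sup>T * M \<in> carrier_mat k n" "V\<^sup>T * M \<in> carrier_mat m n" using U V M by auto
  have "(hcat U V)\<^sup>T * M * hcat U V = vcat (U\<^sup>T * M) (V\<^sup>T * M) * hcat U V"
    using U V M by (simp add: transpose_hcat vcat_mult)
  also have "\<dots> = four_block_mat (U\<^sup>T * M * U) (U\<^sup>T * M * V) (V\<^sup>T * M * U) (V\<^sup>T * M * V)"
    by (rule vcat_mult_hcat[OF cc U V(1)])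
  also have "\<dots> = mat_sum (U\<^sup>T * M * U) (V\<^sup>T * M * V)"
    by (rule four_block_eq_mat_sum[OF _ _ z]) (use cc U V in auto)
  finally have "congruent_mat M (mat_sum (U\<^sup>T * M * U) (V\<^sup>T * M * V))"
    by (intro congruent_matI[OF M c]) (use det_hcat_complement[OF A U V n 1] in auto)
  moreover have "U\<^sup>T * M * U \<in> carrier_mat k k" "V\<^sup>T * M * V \<in> carrier_mat m m" using cc U V by simp_all
  ultimately show ?thesis by (rule congruence_summandI)
qed

text \<open>On a subspace on which the form is nonsingular, an orthogonal complement exists, but it may
  depend on the side. Here \<open>M * U = M\<^sup>T * U * L\<close> says that the column space of \<open>U\<close> is invariant
  under the asymmetry of the form, which makes the left and the right complement coincide.\<close>

lemma congruent_split_invariant: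
  fixes M U L :: "'a::field mat"
  assumes M: "M \<in> carrier_mat n n" and U: "U \<in> carrier_mat n r" and L: "L \<in> carrier_mat r r"
    and inv: "M * U = M\<^sup>T * U * L" and nz: "det (U\<^sup>T * M * U) \<noteq> 0"
  shows "congruence_summand (U\<^sup>T * M * U) M"
proof -
  let ?Q = "U\<^sup>T * M * U"
  have Q: "?Q \<in> carrier_mat r r" using M U by auto
  obtain P where P: "P \<in> carrier_mat r r" "P * ?Q = 1\<^sub>m r" "?Q * P = 1\<^sub>m r" using obtain_inverse[OF Q nz] .
  have A: "P * (U\<^sup>T * M) \<in> carrier_mat r n" using P M U by auto
  have AU: "P * (U\<^sup>T * M) * U = 1\<^sub>m r" using P(1,2) M U by (simp add: assoc_mult_dim)
  obtain V B m where V: "n = r + m" "V \<in> carrier_mat n m" "B \<in> carrier_mat m n"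
    "P * (U\<^sup>T * M) * V = 0\<^sub>m r m" "U * (P * (U\<^sup>T * M)) + V * B = 1\<^sub>m n"
    using complete_left_inverse[OF A U AU] by metis
  have "?Q * (P * (U\<^sup>T * M) * V) = 0\<^sub>m r m" unfolding V(4) using M U by simp
  moreover have "?Q * (P * (U\<^sup>T * M) * V) = ?Q * P * (U\<^sup>T * M * V)"
    using P(1) M U V(2) by (simp add: assoc_mult_dim)
  ultimately have z: "U\<^sup>T * M * V = 0\<^sub>m r m" unfolding P(3) using M U V(2) by simp
  have "U\<^sup>T * M\<^sup>T = L\<^sup>T * (U\<^sup>T * M)"
    using arg_cong[OF inv, of transpose_mat] M U L by (simp add: transpose_mult_dim)
  hence "U\<^sup>T * M\<^sup>T * V = L\<^sup>T * (U\<^sup>T * M * V)" using M U L V(2) by (simp add: assoc_mult_dim)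
  hence "U\<^sup>T * M\<^sup>T * V = 0\<^sub>m r m" unfolding z using L by simp
  from arg_cong[OF this, of transpose_mat] have "V\<^sup>T * M * U = 0\<^sub>m m r"
    using M U V(2) by (simp add: transpose_mult_dim assoc_mult_dim)
  from congruent_split[OF M A U V(2,3,1,5) z this] show ?thesis .
qed

section \<open>Regular matrix pencils\<close>

interpretation const_poly: comm_ring_hom "\<lambda>a::'a::comm_ring_1. [:a:]"
  by unfold_locales (auto simp: one_pCons)

abbreviation const_mat :: "'a::comm_ring_1 mat \<Rightarrow> 'a poly mat" where
  "const_mat \<equiv> map_mat (\<lambda>a. [:a:])"

text \<open>The pencil \<open>B - \<lambda> * A\<close> as a matrix of polynomials in \<open>\<lambda>\<close>.\<close>

definition pencil :: "'a::comm_ring_1 mat \<Rightarrow> 'a mat \<Rightarrow> 'a poly mat" where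
  "pencil A B = const_mat B - [:0, 1:] \<cdot>\<^sub>m const_mat A"

lemma pencil_carrier [simp]:
  "A \<in> carrier_mat m n \<Longrightarrow> B \<in> carrier_mat m n \<Longrightarrow> pencil A B \<in> carrier_mat m n"
  unfolding pencil_def by (auto intro: minus_carrier_mat)

lemma pencil_dim [simp]:
  "dim_row (pencil A B) = dim_row A" "dim_col (pencil A B) = dim_col A"
  unfolding pencil_def by simp_all

lemma pencil_index:
  assumes "A \<in> carrier_mat m n" "B \<in> carrier_mat m n" "i < m" "j < n"
  shows "pencil A B $$ (i, j) = [:B $$ (i, j), - A $$ (i, j):]"
  using assms unfolding pencil_def by simp

lemma const_mat_mult:
  fixes A B :: "'a::comm_ring_1 mat"
  assumes "A \<in> carrier_mat m n" "B \<in> carrier_mat n k"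
  shows "const_mat (A * B) = const_mat A * const_mat B"
  by (rule const_poly.mat_hom_mult[OF assms])

lemma const_mat_mult_pencil:
  fixes A B R :: "'a::comm_ring_1 mat"
  assumes "R \<in> carrier_mat k m" "A \<in> carrier_mat m n" "B \<in> carrier_mat m n"
  shows "const_mat R * pencil A B = pencil (R * A) (R * B)"
proof -
  have "const_mat R * pencil A B = const_mat R * const_mat B - const_mat R * ([:0,1:] \<cdot>\<^sub>m const_mat A)"
    unfolding pencil_def by (rule mult_minus_distrib_mat[of _ k m _ n]) (use assms in auto)
  also have "const_mat R * ([:0,1:] \<cdot>\<^sub>m const_mat A) = [:0,1:] \<cdot>\<^sub>m (const_mat R * const_mat A)"
    by (rule mult_smult_distrib[of _ k m _ n]) (use assms in auto)
  finally show ?thesis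
    unfolding pencil_def using const_mat_mult[OF assms(1,2)] const_mat_mult[OF assms(1,3)] by simp
qed

lemma pencil_mult_const_mat:
  fixes A B S :: "'a::comm_ring_1 mat"
  assumes "S \<in> carrier_mat n k" "A \<in> carrier_mat m n" "B \<in> carrier_mat m n"
  shows "pencil A B * const_mat S = pencil (A * S) (B * S)"
proof -
  have "pencil A B * const_mat S = const_mat B * const_mat S - ([:0,1:] \<cdot>\<^sub>m const_mat A) * const_mat S"
    unfolding pencil_def by (rule minus_mult_distrib_mat[of _ m n _ _ k]) (use assms in auto)
  also have "([:0,1:] \<cdot>\<^sub>m const_mat A) * const_mat S = [:0,1:] \<cdot>\<^sub>m (const_mat A * const_mat S)"
    by (rule mult_smult_assoc_mat[of _ m n _ k]) (use assms in auto)
  finally show ?thesis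
    unfolding pencil_def using const_mat_mult[OF assms(2,1)] const_mat_mult[OF assms(3,1)] by simp
qed

text \<open>Regularity of a pencil (its determinant is not the zero polynomial) is invariant under
  equivalence. It is a statement about polynomials, not about values, and so makes sense over
  small finite fields, where every value of a nonzero determinant may vanish.\<close>

lemma det_pencil_equivalent:
  fixes A B R S :: "'a::field mat"
  assumes R: "R \<in> carrier_mat n n" "det R \<noteq> 0" and S: "S \<in> carrier_mat n n" "det S \<noteq> 0"
    and A: "A \<in> carrier_mat n n" and B: "B \<in> carrier_mat n n"
  shows "det (pencil (R * A * S) (R * B * S)) = 0 \<longleftrightarrow> det (pencil A B) = 0"
proof -
  have "pencil (R * A * S) (R * B * S) = const_mat R * pencil A B * const_mat S"
    using R S A B by (simp add: const_mat_mult_pencil pencil_mult_const_mat[of _ n n _ n])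
  hence "det (pencil (R * A * S) (R * B * S)) = [:det R:] * det (pencil A B) * [:det S:]"
    using R S A B by (simp add: det_mult[of _ n] const_poly.hom_det)
  thus ?thesis using R S by simp
qed

lemma pencil_four_block:
  fixes A1 :: "'a::comm_ring_1 mat"
  assumes "A1 \<in> carrier_mat a c" "A2 \<in> carrier_mat a d" "A3 \<in> carrier_mat b c" "A4 \<in> carrier_mat b d"
    "B1 \<in> carrier_mat a c" "B2 \<in> carrier_mat a d" "B3 \<in> carrier_mat b c" "B4 \<in> carrier_mat b d"
  shows "pencil (four_block_mat A1 A2 A3 A4) (four_block_mat B1 B2 B3 B4) =
    four_block_mat (pencil A1 B1) (pencil A2 B2) (pencil A3 B3) (pencil A4 B4)"
  by (rule eq_matI) (use assms in \<open>auto simp: pencil_def\<close>)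

lemma pencil_zero: "pencil (0\<^sub>m a b) (0\<^sub>m a b) = 0\<^sub>m a b"
  by (rule eq_matI) (auto simp: pencil_def)

lemma pencil_mat_sum:
  fixes A B :: "'a::comm_ring_1 mat"
  assumes "A \<in> carrier_mat a a" "B \<in> carrier_mat a a" "C \<in> carrier_mat b b" "D \<in> carrier_mat b b"
  shows "pencil (mat_sum A C) (mat_sum B D) = mat_sum (pencil A B) (pencil C D)"
  unfolding mat_sum_def using assms
  by (simp add: pencil_four_block[of _ a a _ b _ b] pencil_zero)

text \<open>This is the Fitting decomposition at the eigenvalue \<open>1\<close>, for a pair of matrices neither of which
  need be invertible. An eigenvector for \<open>1\<close> becomes the first basis vector, the rest is decomposed
  by induction, and finally the coupling between the eigenvector and the part without the
  eigenvalue \<open>1\<close> is cleared, which is possible because \<open>B2 - A2\<close> is invertible.\<close>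

lemma regular_pencil_splits_at_one:
  fixes A B :: "'a::field mat"
  assumes "A \<in> carrier_mat n n" "B \<in> carrier_mat n n" "det (pencil A B) \<noteq> 0"
  shows "\<exists>k m R S L A2 B2. n = k + m \<and> R \<in> carrier_mat n n \<and> det R \<noteq> 0 \<and>
    S \<in> carrier_mat n n \<and> det S \<noteq> 0 \<and>
    L \<in> carrier_mat k k \<and> upper_triangular L \<and> (\<forall>i<k. L $$ (i, i) = 1) \<and>
    A2 \<in> carrier_mat m m \<and> B2 \<in> carrier_mat m m \<and> det (B2 - A2) \<noteq> 0 \<and>
    R * A * S = mat_sum (1\<^sub>m k) A2 \<and> R * B * S = mat_sum L B2"
  using assms
proof (induction n arbitrary: A B)
  case (0 A B)
  have d: "det (B - A) = 1" using minus_carrier_mat[OF 0(1), of B] by (rule det_dim_zero)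
  show ?case
    by (rule exI[of _ 0], rule exI[of _ 0], rule exI[of _ "1\<^sub>m 0"], rule exI[of _ "1\<^sub>m 0"],
      rule exI[of _ "1\<^sub>m 0"], rule exI[of _ A], rule exI[of _ B])
      (use 0 d in \<open>auto simp: mat_sum_empty_left\<close>)
next
  case (Suc n A B)
  note A = Suc.prems(1) and B = Suc.prems(2)
  show ?case
  proof (cases "det (B - A) = 0")
    case False
    show ?thesis
      by (rule exI[of _ 0], rule exI[of _ "Suc n"], rule exI[of _ "1\<^sub>m (Suc n)"], rule exI[of _ "1\<^sub>m (Suc n)"],
        rule exI[of _ "1\<^sub>m 0"], rule exI[of _ A], rule exI[of _ B])
        (use False A B in \<open>auto simp: mat_sum_empty_left\<close>)
  next
    case True
    have "B - A \<in> carrier_mat (Suc n) (Suc n)" using A by (rule minus_carrier_mat)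
    from True[unfolded det_0_iff_vec_prod_zero_field[OF this]]
    obtain v where v: "v \<in> carrier_vec (Suc n)" "v \<noteq> 0\<^sub>v (Suc n)" "(B - A) *\<^sub>v v = 0\<^sub>v (Suc n)" by auto
    define x where "x = mat (Suc n) 1 (\<lambda>(i, j). v $ i)"
    have x: "x \<in> carrier_mat (Suc n) 1" unfolding x_def by simp
    have colx: "col x 0 = v" using v(1) unfolding x_def by (auto intro: eq_vecI)
    \<comment> \<open>regularity gives \<open>w \<noteq> 0\<close>, so \<open>w\<close> can serve as first basis vector of the codomain\<close>
    define w where "w = A * x"
    have w: "w \<in> carrier_mat (Suc n) 1" unfolding w_def using A x by auto
    have Bx: "B * x = w"
    proof (rule eq_matI)
      fix i j assume "i < dim_row w" "j < dim_col w"
      hence ij: "i < Suc n" "j = 0" using w by auto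
      have "((B - A) *\<^sub>v v) $ i = 0" using v(3) ij by simp
      moreover have "row (B - A) i = row B i - row A i" using A B ij by (intro eq_vecI) auto
      ultimately have "(row B i - row A i) \<bullet> v = 0" using A B ij by simp
      hence "row B i \<bullet> v = row A i \<bullet> v"
        using A B ij v(1) minus_scalar_prod_distrib[of "row B i" "Suc n" "row A i" v] by simp
      thus "(B * x) $$ (i, j) = w $$ (i, j)" using ij A B x unfolding w_def by (simp add: colx)
    qed (use B x w in auto)
    have "w \<noteq> 0\<^sub>m (Suc n) 1"
    proof
      assume w0: "w = 0\<^sub>m (Suc n) 1"
      let ?v = "map_vec (\<lambda>a. [:a:]) v"
      have "const_mat x \<in> carrier_mat (Suc n) 1" using x by simp
      have "pencil A B * const_mat x = 0\<^sub>m (Suc n) 1"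
        using pencil_mult_const_mat[OF x A B] Bx w0 pencil_zero unfolding w_def by simp
      moreover have "col (const_mat x) 0 = ?v" using colx x by auto
      moreover have "col (pencil A B * const_mat x) 0 = pencil A B *\<^sub>v col (const_mat x) 0"
        using A B x by (intro col_mult2[of _ "Suc n" "Suc n" _ 1]) auto
      ultimately have "pencil A B *\<^sub>v ?v = 0\<^sub>v (Suc n)" by simp
      moreover have "?v \<noteq> 0\<^sub>v (Suc n)"
      proof
        assume z: "?v = 0\<^sub>v (Suc n)"
        have "v = 0\<^sub>v (Suc n)"
        proof (rule eq_vecI)
          fix i assume "i < dim_vec (0\<^sub>v (Suc n) :: 'a vec)"
          hence i: "i < Suc n" by simp
          hence "?v $ i = 0" unfolding z by simp
          thus "v $ i = 0\<^sub>v (Suc n) $ i" using i v(1) by simp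
        qed (use v in auto)
        thus False using v(2) by simp
      qed
      ultimately have "det (pencil A B) = 0"
        unfolding det_0_iff_vec_prod_zero[OF pencil_carrier[OF A B]] using v(1)
        by (intro exI[of _ ?v]) simp
      thus False using Suc.prems(3) by simp
    qed
    then obtain p where p: "p < Suc n" "w $$ (p, 0) \<noteq> 0"
      using w eq_matI[of "0\<^sub>m (Suc n) 1" w] by auto
    define c where "c = mat 1 (Suc n) (\<lambda>(i, j). if j = p then 1 / w $$ (p, 0) else 0)"
    have c: "c \<in> carrier_mat 1 (Suc n)" unfolding c_def by simp
    have cw: "c * w = 1\<^sub>m 1"
      by (rule eq_matI) (use w p in \<open>auto simp: c_def scalar_prod_def if_distrib[of "\<lambda>x. x * _"] cong: if_cong\<close>)
    have cA: "c * A \<in> carrier_mat 1 (Suc n)" using c A by simp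
    have cAx: "c * A * x = 1\<^sub>m 1" using cw c A x unfolding w_def by (simp add: assoc_mult_dim)
    obtain W D m where D: "Suc n = 1 + m" "W \<in> carrier_mat (Suc n) m" "D \<in> carrier_mat m (Suc n)"
      "D * w = 0\<^sub>m m 1" "w * c + W * D = 1\<^sub>m (Suc n)"
      using complete_left_inverse[OF c w cw] by metis
    \<comment> \<open>completing \<open>x\<close> against the row \<open>c * A\<close> makes the first row of the first matrix \<open>(1, 0)\<close> at once\<close>
    obtain V Y m' where V: "Suc n = 1 + m'" "V \<in> carrier_mat (Suc n) m'" "Y \<in> carrier_mat m' (Suc n)"
      "c * A * V = 0\<^sub>m 1 m'" "x * (c * A) + V * Y = 1\<^sub>m (Suc n)"
      using complete_left_inverse[OF cA x cAx] by metis
    have m: "m = n" "m' = n" using D(1) V(1) by auto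
    note D = D(2-)[unfolded m] note V = V(2-)[unfolded m]
    define R0 where "R0 = vcat c D"
    define S0 where "S0 = hcat x V"
    have R0: "R0 \<in> carrier_mat (Suc n) (Suc n)" "det R0 \<noteq> 0"
      using vcat_carrier[OF c D(2)] det_hcat_complement(2)[OF c w D(1,2) _ D(4)] unfolding R0_def by auto
    have S0: "S0 \<in> carrier_mat (Suc n) (Suc n)" "det S0 \<noteq> 0"
      using hcat_carrier[OF x V(1)] det_hcat_complement(1)[OF cA x V(1,2) _ V(4)] unfolding S0_def by auto
    define A' where "A' = D * A * V"
    define B' where "B' = D * B * V"
    define b where "b = c * B * V"
    have AB': "A' \<in> carrier_mat n n" "B' \<in> carrier_mat n n" "b \<in> carrier_mat 1 n"
      unfolding A'_def B'_def b_def using c D A B V by auto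
    have RA: "R0 * A * S0 = mat_sum (1\<^sub>m 1) A'"
    proof -
      have "R0 * A = vcat (c * A) (D * A)" unfolding R0_def by (rule vcat_mult) (use c D A in auto)
      hence "R0 * A * S0 = four_block_mat (c * A * x) (c * A * V) (D * A * x) (D * A * V)"
        unfolding S0_def using c D A x V by (simp add: vcat_mult_hcat[of _ 1 "Suc n" _ n _ 1 _ n])
      also have "D * A * x = 0\<^sub>m n 1" using D(3) D(2) A x unfolding w_def by (simp add: assoc_mult_dim)
      finally show ?thesis unfolding cAx V(3) A'_def[symmetric]
        by (simp add: four_block_eq_mat_sum[of _ 1 1 _ n n] AB')
    qed
    have RB: "R0 * B * S0 = four_block_mat (1\<^sub>m 1) b (0\<^sub>m n 1) B'"
    proof -
      have "R0 * B = vcat (c * B) (D * B)" unfolding R0_def by (rule vcat_mult) (use c D B in auto)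
      hence "R0 * B * S0 = four_block_mat (c * B * x) (c * B * V) (D * B * x) (D * B * V)"
        unfolding S0_def using c D B x V by (simp add: vcat_mult_hcat[of _ 1 "Suc n" _ n _ 1 _ n])
      also have "D * B * x = 0\<^sub>m n 1" using D(3) D(2) B x Bx by (simp add: assoc_mult_dim)
      also have "c * B * x = 1\<^sub>m 1" using cw c B x Bx by (simp add: assoc_mult_dim)
      finally show ?thesis unfolding b_def B'_def .
    qed
    have "det (pencil A' B') \<noteq> 0"
    proof
      assume "det (pencil A' B') = 0"
      moreover have "pencil (mat_sum (1\<^sub>m 1) A') (four_block_mat (1\<^sub>m 1) b (0\<^sub>m n 1) B')
        = four_block_mat (pencil (1\<^sub>m 1) (1\<^sub>m 1)) (pencil (0\<^sub>m 1 n) b) (0\<^sub>m n 1) (pencil A' B')"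
        unfolding mat_sum_def using AB' by (simp add: pencil_four_block[of _ 1 1 _ n _ n] pencil_zero)
      moreover have "det \<dots> = det (pencil (1\<^sub>m 1 :: 'a mat) (1\<^sub>m 1)) * det (pencil A' B')"
        by (rule det_four_block_mat_lower_left_zero[of _ 1 _ n]) (use AB' in auto)
      ultimately have "det (pencil (R0 * A * S0) (R0 * B * S0)) = 0" unfolding RA RB by simp
      thus False using det_pencil_equivalent[OF R0 S0 A B] Suc.prems(3) by simp
    qed
    from Suc.IH[OF AB'(1,2) this] obtain k m R S L A2 B2 where
      n: "n = k + m" and R: "R \<in> carrier_mat n n" "det R \<noteq> 0" and S: "S \<in> carrier_mat n n" "det S \<noteq> 0"
      and L: "L \<in> carrier_mat k k" "upper_triangular L" "\<forall>i<k. L $$ (i, i) = 1"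
      and 2: "A2 \<in> carrier_mat m m" "B2 \<in> carrier_mat m m" "det (B2 - A2) \<noteq> 0"
      and eq: "R * A' * S = mat_sum (1\<^sub>m k) A2" "R * B' * S = mat_sum L B2" by blast
    define R1 where "R1 = mat_sum (1\<^sub>m 1) R * R0"
    define S1 where "S1 = S0 * mat_sum (1\<^sub>m 1) S"
    have mc: "mat_sum (1\<^sub>m 1) R \<in> carrier_mat (Suc n) (Suc n)" "mat_sum (1\<^sub>m 1) S \<in> carrier_mat (Suc n) (Suc n)"
      using mat_sum_carrier[OF one_carrier_mat R(1), of 1] mat_sum_carrier[OF one_carrier_mat S(1), of 1] by simp_all
    have R1: "R1 \<in> carrier_mat (Suc n) (Suc n)" "det R1 \<noteq> 0"
      unfolding R1_def using mc R0 det_mult[OF mc(1) R0(1)] det_mat_sum[OF one_carrier_mat R(1), of 1] R by auto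
    have S1: "S1 \<in> carrier_mat (Suc n) (Suc n)" "det S1 \<noteq> 0"
      unfolding S1_def using mc S0 det_mult[OF S0(1) mc(2)] det_mat_sum[OF one_carrier_mat S(1), of 1] S by auto
    define b1 where "b1 = mat 1 k (\<lambda>(i, j). (b * S) $$ (i, j))"
    define b2 where "b2 = mat 1 m (\<lambda>(i, j). (b * S) $$ (i, k + j))"
    have bS: "b * S = hcat b1 b2"
      by (rule eq_matI) (use AB' S n in \<open>auto simp: b1_def b2_def hcat_def\<close>)
    define L1 where "L1 = four_block_mat (1\<^sub>m 1) b1 (0\<^sub>m k 1) L"
    have b12: "b1 \<in> carrier_mat 1 k" "b2 \<in> carrier_mat 1 m" unfolding b1_def b2_def by auto
    have L1: "L1 \<in> carrier_mat (Suc k) (Suc k)" unfolding L1_def using four_block_carrier_mat[OF one_carrier_mat L(1), of 1] by simp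
    have A1: "R1 * A * S1 = mat_sum (1\<^sub>m (Suc k)) A2"
    proof -
      have "R1 * A * S1 = mat_sum (1\<^sub>m 1) R * (R0 * A * S0) * mat_sum (1\<^sub>m 1) S"
        unfolding R1_def S1_def using R(1) S(1) R0 S0 A by (simp add: assoc_mult_dim)
      also have "\<dots> = mat_sum (1\<^sub>m 1) (R * A' * S)"
        unfolding RA using R S AB' by (simp add: mat_sum_mult)
      also have "\<dots> = mat_sum (1\<^sub>m (Suc k)) A2" unfolding eq mat_sum_assoc mat_sum_one by simp
      finally show ?thesis .
    qed
    have B1: "R1 * B * S1 = four_block_mat L1 (vcat b2 (0\<^sub>m k m)) (0\<^sub>m m (Suc k)) B2"
    proof -
      have "R1 * B * S1 = mat_sum (1\<^sub>m 1) R * (R0 * B * S0) * mat_sum (1\<^sub>m 1) S"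
        unfolding R1_def S1_def using R(1) S(1) R0 S0 B by (simp add: assoc_mult_dim)
      also have "\<dots> = four_block_mat (1\<^sub>m 1) (b * S) (0\<^sub>m n 1) (R * B' * S)"
        unfolding RB mat_sum_def using R S AB'
        by (simp add: mult_four_block_mat[of _ 1 1 _ n _ n _ _ 1 _ n])
      also have "\<dots> = four_block_mat L1 (vcat b2 (0\<^sub>m k m)) (0\<^sub>m m (Suc k)) B2"
        unfolding eq bS L1_def
        by (rule eq_matI) (use L 2 b12 n in \<open>auto simp: mat_sum_index hcat_def vcat_def\<close>)
      finally show ?thesis .
    qed
    have E: "B2 - A2 \<in> carrier_mat m m" using 2 by (intro minus_carrier_mat)
    obtain P where P: "P \<in> carrier_mat m m" "P * (B2 - A2) = 1\<^sub>m m" using obtain_inverse[OF E 2(3)] by metis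
    define z where "z = - (b2 * P)"
    define y where "y = - (z * A2)"
    have zy: "z \<in> carrier_mat 1 m" "y \<in> carrier_mat 1 m" unfolding z_def y_def using b12 P 2 by auto
    \<comment> \<open>the row and column operations \<open>Z\<close> and \<open>Y\<close> that clear the coupling \<open>b2\<close> concern the first row
      only; \<open>Y\<close> compensates the entry that \<open>Z\<close> produces in the first matrix\<close>
    define Z where "Z = vcat z (0\<^sub>m k m)"
    define Y where "Y = vcat y (0\<^sub>m k m)"
    have ZY: "Z \<in> carrier_mat (Suc k) m" "Y \<in> carrier_mat (Suc k) m"
      unfolding Z_def Y_def using vcat_carrier[OF zy(1), of "0\<^sub>m k m"] vcat_carrier[OF zy(2), of "0\<^sub>m k m"] by auto
    have LY: "L1 * Y = Y" unfolding L1_def Y_def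
      using four_block_mult_vcat[OF one_carrier_mat b12(1) _ L(1) zy(2), of "0\<^sub>m k 1" "0\<^sub>m k m"] zy L b12 by simp
    have ZA: "Z * A2 + Y = 0\<^sub>m (Suc k) m"
      by (rule eq_matI) (use zy 2 vcat_mult[of z A2 "0\<^sub>m k m"] in \<open>auto simp: Z_def Y_def y_def vcat_def\<close>)
    have "z * (B2 - A2) = - b2"
      unfolding z_def using b12 P 2(1,2) by (simp add: assoc_mult_dim)
    hence z': "z * B2 - z * A2 = - b2" using zy 2 by (simp add: mult_minus_dim)
    have ZB: "Y + (vcat b2 (0\<^sub>m k m) + Z * B2) = 0\<^sub>m (Suc k) m"
    proof (rule eq_matI)
      fix i j assume "i < dim_row (0\<^sub>m (Suc k) m :: 'a mat)" "j < dim_col (0\<^sub>m (Suc k) m :: 'a mat)"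
      hence ij: "i < Suc k" "j < m" by auto
      have "(z * B2 - z * A2) $$ (0, j) = (- b2) $$ (0, j)" unfolding z' ..
      hence "(z * B2) $$ (0, j) - (z * A2) $$ (0, j) = - b2 $$ (0, j)" using ij zy 2 b12 by simp
      hence "y $$ (0, j) + (b2 $$ (0, j) + (z * B2) $$ (0, j)) = 0"
        unfolding y_def using ij zy 2 by (simp add: algebra_simps)
      moreover have "Z * B2 = vcat (z * B2) (0\<^sub>m k m)"
        unfolding Z_def using vcat_mult[of z B2 "0\<^sub>m k m"] zy 2 by simp
      ultimately show "(Y + (vcat b2 (0\<^sub>m k m) + Z * B2)) $$ (i, j) = 0\<^sub>m (Suc k) m $$ (i, j)"
        using ij zy b12 2 by (auto simp: Y_def vcat_def)
    qed (use ZY 2 in auto)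
    define RR where "RR = four_block_mat (1\<^sub>m (Suc k)) Z (0\<^sub>m m (Suc k)) (1\<^sub>m m)"
    define SS where "SS = four_block_mat (1\<^sub>m (Suc k)) Y (0\<^sub>m m (Suc k)) (1\<^sub>m m)"
    have RRc: "RR \<in> carrier_mat (Suc n) (Suc n)" "SS \<in> carrier_mat (Suc n) (Suc n)"
      unfolding RR_def SS_def n using four_block_carrier_mat[of "1\<^sub>m (Suc k)" "Suc k" "Suc k" "1\<^sub>m m" m m] by simp_all
    have RRd: "det RR = 1" "det SS = 1"
      unfolding RR_def SS_def using ZY
      by (simp_all add: det_four_block_mat_lower_left_zero[of _ "Suc k" _ m])
    have vc: "vcat b2 (0\<^sub>m k m) \<in> carrier_mat (Suc k) m" using vcat_carrier[OF b12(2), of "0\<^sub>m k m" k] by simp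
    have FA: "RR * mat_sum (1\<^sub>m (Suc k)) A2 * SS = mat_sum (1\<^sub>m (Suc k)) A2"
    proof -
      have "RR * mat_sum (1\<^sub>m (Suc k)) A2 = four_block_mat (1\<^sub>m (Suc k)) (Z * A2) (0\<^sub>m m (Suc k)) A2"
        unfolding RR_def mat_sum_def using ZY 2
        by (simp add: mult_four_block_mat[of _ "Suc k" "Suc k" _ m _ m _ _ "Suc k" _ m])
      also have "\<dots> * SS = four_block_mat (1\<^sub>m (Suc k)) (Y + Z * A2) (0\<^sub>m m (Suc k)) A2"
        unfolding SS_def using ZY 2
        by (simp add: mult_four_block_mat[of _ "Suc k" "Suc k" _ m _ m _ _ "Suc k" _ m])
      also have "Y + Z * A2 = 0\<^sub>m (Suc k) m" unfolding ZA[symmetric] using ZY 2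
        by (intro comm_add_mat[of _ "Suc k" m]) auto
      finally show ?thesis using 2 by (simp add: four_block_eq_mat_sum[of _ "Suc k" "Suc k" _ m m])
    qed
    have FB: "RR * four_block_mat L1 (vcat b2 (0\<^sub>m k m)) (0\<^sub>m m (Suc k)) B2 * SS = mat_sum L1 B2"
    proof -
      have "RR * four_block_mat L1 (vcat b2 (0\<^sub>m k m)) (0\<^sub>m m (Suc k)) B2
        = four_block_mat L1 (vcat b2 (0\<^sub>m k m) + Z * B2) (0\<^sub>m m (Suc k)) B2"
        unfolding RR_def using ZY 2 L1 vc
        by (simp add: mult_four_block_mat[of _ "Suc k" "Suc k" _ m _ m _ _ "Suc k" _ m])
      also have "\<dots> * SS = four_block_mat L1 (L1 * Y + (vcat b2 (0\<^sub>m k m) + Z * B2)) (0\<^sub>m m (Suc k)) B2"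
        unfolding SS_def using ZY 2 L1 vc
        by (simp add: mult_four_block_mat[of _ "Suc k" "Suc k" _ m _ m _ _ "Suc k" _ m])
      finally show ?thesis unfolding LY ZB using 2 L1
        by (simp add: four_block_eq_mat_sum[of _ "Suc k" "Suc k" _ m m])
    qed
    have up: "upper_triangular L1" unfolding L1_def
      using L by (intro upper_triangularI) (auto elim!: upper_triangularD)
    have dg: "\<forall>i<Suc k. L1 $$ (i, i) = 1" unfolding L1_def using L by auto
    have r: "RR * R1 * X * (S1 * SS) = RR * (R1 * X * S1) * SS" if "X \<in> carrier_mat (Suc n) (Suc n)" for X
      using RRc R1 S1 that by (simp add: assoc_mult_dim)
    show ?thesis
    proof (intro exI conjI)
      show "Suc n = Suc k + m" using n by simp
      show "RR * R1 \<in> carrier_mat (Suc n) (Suc n)" "S1 * SS \<in> carrier_mat (Suc n) (Suc n)"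
        using RRc R1 S1 by auto
      show "det (RR * R1) \<noteq> 0" "det (S1 * SS) \<noteq> 0"
        using det_mult[OF RRc(1) R1(1)] det_mult[OF S1(1) RRc(2)] RRd R1 S1 by auto
      show "RR * R1 * A * (S1 * SS) = mat_sum (1\<^sub>m (Suc k)) A2" unfolding r[OF A] A1 FA ..
      show "RR * R1 * B * (S1 * SS) = mat_sum L1 B2" unfolding r[OF B] B1 FB ..
    qed (use L1 up dg 2 in auto)
  qed
qed

section \<open>Isometries of a regular form\<close>

definition upper_unitriangular :: "'a::{zero,one} mat \<Rightarrow> bool" where
  "upper_unitriangular L \<longleftrightarrow> square_mat L \<and> upper_triangular L \<and> (\<forall>i<dim_row L. L $$ (i, i) = 1)"

text \<open>Row \<open>i\<close> of \<open>T * (X * H)\<close> only involves the rows of \<open>X\<close> before row \<open>i\<close>.\<close>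

lemma strictly_lower_fixpoint_zero:
  fixes X T H :: "'a::field mat"
  assumes X: "X \<in> carrier_mat k m" and T: "T \<in> carrier_mat k k" and H: "H \<in> carrier_mat m m"
    and low: "\<And>i j. i \<le> j \<Longrightarrow> j < k \<Longrightarrow> T $$ (i, j) = 0"
    and eq: "X = T * (X * H)"
  shows "X = 0\<^sub>m k m"
proof -
  have "\<forall>j<m. X $$ (i, j) = 0" if "i < k" for i
    using that
  proof (induction i rule: less_induct)
    case (less i)
    have row0: "(X * H) $$ (l, j) = 0" if "l < i" "j < m" for l j
      using less that X H by (auto simp: scalar_prod_def)
    show ?case
    proof (intro allI impI)
      fix j assume j: "j < m"
      have "X $$ (i, j) = (T * (X * H)) $$ (i, j)" using eq by simp
      also have "\<dots> = (\<Sum>l<k. T $$ (i, l) * (X * H) $$ (l, j))"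
        using X T H less.prems j by (simp add: scalar_prod_def atLeast0LessThan)
      also have "\<dots> = 0"
      proof (rule sum.neutral, rule ballI)
        fix l assume "l \<in> {..<k}"
        thus "T $$ (i, l) * (X * H) $$ (l, j) = 0"
          using row0[of l j] low[of i l] j by (cases "l < i") auto
      qed
      finally show "X $$ (i, j) = 0" .
    qed
  qed
  thus ?thesis using X by (intro eq_matI) auto
qed

text \<open>Since \<open>1 - L\<^sup>T\<close> is strictly lower triangular, the equation makes \<open>X\<close> a fixed point of the kind
  just excluded. In the applications \<open>X\<close> is the block of a form that pairs the part with the only
  eigenvalue \<open>1\<close> with the part without it, and the lemma says that the two are orthogonal.\<close>

lemma spectrally_disjoint_zero:
  fixes X L A B :: "'a::field mat"
  assumes X: "X \<in> carrier_mat k m" and L: "L \<in> carrier_mat k k" "upper_unitriangular L"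
    and A: "A \<in> carrier_mat m m" and B: "B \<in> carrier_mat m m" and nz: "det (B - A) \<noteq> 0"
    and eq: "X * A = L\<^sup>T * X * B"
  shows "X = 0\<^sub>m k m"
proof -
  have E: "B - A \<in> carrier_mat m m" using A by (rule minus_carrier_mat)
  obtain P where P: "P \<in> carrier_mat m m" "(B - A) * P = 1\<^sub>m m" using obtain_inverse[OF E nz] by metis
  define T where "T = 1\<^sub>m k - L\<^sup>T"
  have T: "T \<in> carrier_mat k k" unfolding T_def using L by (intro minus_carrier_mat) auto
  have "T * (X * B) = X * B - L\<^sup>T * X * B"
    unfolding T_def using L X B by (simp add: minus_mult_dim assoc_mult_dim)
  also have "\<dots> = X * (B - A)" unfolding eq[symmetric] using X A B by (simp add: mult_minus_dim)
  finally have e: "T * (X * B) = X * (B - A)" .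
  have "T * (X * (B * P)) = T * (X * B) * P" using T X B P(1) by (simp add: assoc_mult_dim)
  also have "\<dots> = X" unfolding e using X A B P by (simp add: assoc_mult_dim)
  finally show ?thesis
    by (intro strictly_lower_fixpoint_zero[OF X T mult_carrier_mat[OF B P(1)]])
       (use L in \<open>auto simp: T_def upper_unitriangular_def\<close>)
qed

lemma det_upper_unitriangular:
  assumes "L \<in> carrier_mat k k" "upper_unitriangular L"
  shows "det L = (1::'a::field)"
proof -
  have "det L = prod_list (diag_mat L)"
    using assms by (intro det_upper_triangular[of _ k]) (auto simp: upper_unitriangular_def)
  also have "diag_mat L = map (\<lambda>i. 1) [0..<k]"
    unfolding diag_mat_def using assms by (auto simp: upper_unitriangular_def)
  finally show ?thesis by (simp add: map_replicate_const)
qed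

lemma regular_congruent:
  fixes M :: "'a::field mat"
  assumes M: "M \<in> carrier_mat n n" and S: "S \<in> carrier_mat n n" "det S \<noteq> 0"
  shows "det (pencil ((S\<^sup>T * M * S)\<^sup>T) (S\<^sup>T * M * S)) = 0 \<longleftrightarrow> det (pencil (M\<^sup>T) M) = 0"
proof -
  have "(S\<^sup>T * M * S)\<^sup>T = S\<^sup>T * M\<^sup>T * S" using M S by (simp add: transpose_mult_dim assoc_mult_dim)
  thus ?thesis using det_pencil_equivalent[of "S\<^sup>T" n S "M\<^sup>T" M] M S det_transpose[OF S(1)] by simp
qed

lemma regular_mat_sum:
  fixes K W :: "'a::field mat"
  assumes "K \<in> carrier_mat k k" "W \<in> carrier_mat m m"
  shows "det (pencil ((mat_sum K W)\<^sup>T) (mat_sum K W)) = det (pencil (K\<^sup>T) K) * det (pencil (W\<^sup>T) W)"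
proof -
  have "pencil ((mat_sum K W)\<^sup>T) (mat_sum K W) = mat_sum (pencil (K\<^sup>T) K) (pencil (W\<^sup>T) W)"
    unfolding mat_sum_transpose using assms by (simp add: pencil_mat_sum[of _ k _ _ m])
  thus ?thesis using assms by (simp add: det_mat_sum[of _ k _ m])
qed

lemma square_blocks:
  fixes G :: "'a mat"
  assumes "G \<in> carrier_mat (k + m) (k + m)"
  obtains G1 G2 G3 G4 where "G = four_block_mat G1 G2 G3 G4" "G1 \<in> carrier_mat k k"
    "G2 \<in> carrier_mat k m" "G3 \<in> carrier_mat m k" "G4 \<in> carrier_mat m m"
proof -
  obtain G1 G2 G3 G4 where s: "split_block G k k = (G1, G2, G3, G4)" by (cases "split_block G k k") auto
  have d: "dim_row G = k + m" "dim_col G = k + m" using assms by auto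
  show ?thesis using split_block[OF s d] by (intro that) auto
qed

lemma four_block_mat_inject:
  assumes eq: "four_block_mat A B C D = four_block_mat A' B' C' D'"
    and "A \<in> carrier_mat k k" "B \<in> carrier_mat k m" "C \<in> carrier_mat m k" "D \<in> carrier_mat m m"
    and "A' \<in> carrier_mat k k" "B' \<in> carrier_mat k m" "C' \<in> carrier_mat m k" "D' \<in> carrier_mat m m"
  shows "A = A'" "B = B'" "C = C'" "D = D'"
proof -
  note c = assms(2-)
  have e: "four_block_mat A B C D $$ (i, j) = four_block_mat A' B' C' D' $$ (i, j)" for i j
    unfolding eq ..
  have "A $$ (i, j) = A' $$ (i, j)" if "i < k" "j < k" for i j using e[of i j] that c by simp
  thus "A = A'" using c by (intro eq_matI) auto
  have "B $$ (i, j) = B' $$ (i, j)" if "i < k" "j < m" for i j using e[of i "k + j"] that c by simp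
  thus "B = B'" using c by (intro eq_matI) auto
  have "C $$ (i, j) = C' $$ (i, j)" if "i < m" "j < k" for i j using e[of "k + i" j] that c by simp
  thus "C = C'" using c by (intro eq_matI) auto
  have "D $$ (i, j) = D' $$ (i, j)" if "i < m" "j < m" for i j using e[of "k + i" "k + j"] that c by simp
  thus "D = D'" using c by (intro eq_matI) auto
qed

text \<open>The splitting of a regular pencil, applied to \<open>(1, S)\<close>. At \<open>\<lambda> = 0\<close> the determinant of the pencil
  is \<open>det S\<close>, so the pencil is regular.\<close>

lemma fitting_at_one:
  fixes S :: "'a::field mat"
  assumes S: "S \<in> carrier_mat n n" "det S \<noteq> 0"
  obtains k m P P' L C where "n = k + m" "P \<in> carrier_mat n n" "P' \<in> carrier_mat n n" "det P \<noteq> 0"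
    "P' * P = 1\<^sub>m n" "P * P' = 1\<^sub>m n" "L \<in> carrier_mat k k" "upper_unitriangular L" "C \<in> carrier_mat m m"
    "det (C - 1\<^sub>m m) \<noteq> 0" "P' * S * P = mat_sum L C"
proof -
  have ev: "comm_ring_hom (\<lambda>p. poly p (0::'a))" by unfold_locales auto
  have "map_mat (\<lambda>p. poly p 0) (pencil (1\<^sub>m n) S) = S"
    by (rule eq_matI) (use S in \<open>auto simp: pencil_index[of _ n n]\<close>)
  hence "poly (det (pencil (1\<^sub>m n) S)) 0 = det S" using comm_ring_hom.hom_det[OF ev, of "pencil (1\<^sub>m n) S"] by simp
  hence "det (pencil (1\<^sub>m n) S) \<noteq> 0" using S(2) by auto
  from regular_pencil_splits_at_one[OF one_carrier_mat S(1) this]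
  obtain k m R P L A2 B2 where n: "n = k + m" and R: "R \<in> carrier_mat n n" "det R \<noteq> 0"
    and P: "P \<in> carrier_mat n n" "det P \<noteq> 0"
    and L: "L \<in> carrier_mat k k" "upper_triangular L" "\<forall>i<k. L $$ (i, i) = 1"
    and 2: "A2 \<in> carrier_mat m m" "B2 \<in> carrier_mat m m" "det (B2 - A2) \<noteq> 0"
    and eq: "R * 1\<^sub>m n * P = mat_sum (1\<^sub>m k) A2" "R * S * P = mat_sum L B2" by blast
  have RP: "R * P = mat_sum (1\<^sub>m k) A2" using eq(1) R by simp
  hence "det (mat_sum (1\<^sub>m k) A2) \<noteq> 0" using det_mult[OF R(1) P(1)] R P by simp
  hence "det A2 \<noteq> 0" using 2 by (simp add: det_mat_sum[of _ k _ m])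
  from obtain_inverse[OF 2(1) this] obtain I where
    I: "I \<in> carrier_mat m m" "I * A2 = 1\<^sub>m m" "det I \<noteq> 0" by metis
  define P' where "P' = mat_sum (1\<^sub>m k) I * R"
  have P': "P' \<in> carrier_mat n n" unfolding P'_def n
    by (rule mult_carrier_mat[of _ _ "k + m"]) (use R n I in auto)
  have PP: "P' * P = 1\<^sub>m n" unfolding P'_def using R P I n 2
    by (simp add: assoc_mult_dim RP mat_sum_mult mat_sum_one)
  have "P' * S * P = mat_sum (1\<^sub>m k) I * (R * S * P)" unfolding P'_def using R P I n S by (simp add: assoc_mult_dim)
  also have "\<dots> = mat_sum L (I * B2)" unfolding eq using I L 2 by (simp add: mat_sum_mult)
  finally have PSP: "P' * S * P = mat_sum L (I * B2)" .
  have "I * B2 - 1\<^sub>m m = I * (B2 - A2)" using I 2 by (simp add: mult_minus_dim)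
  hence "det (I * B2 - 1\<^sub>m m) \<noteq> 0"
    using det_mult[OF I(1) minus_carrier_mat[OF 2(1), of B2]] I 2 by simp
  thus ?thesis
    using that[OF n P(1) P' P(2) PP mat_mult_left_right_inverse[OF P' P(1) PP] L(1) _ _ _ PSP] L I 2
    by (auto simp: upper_unitriangular_def)
qed

text \<open>For the pencil \<open>P\<close> of the form one has \<open>C\<^sup>T * P * (C - 1) = (1 - C\<^sup>T) * P\<close>, and the factor
  \<open>det P\<close> can be cancelled because the pencil is regular. This takes the place of the
  factorisation of the characteristic polynomial of an isometry into reciprocal factors.\<close>

lemma det_isometry_no_fixed_vector:
  fixes W C :: "'a::field mat"
  assumes W: "W \<in> carrier_mat m m" and C: "C \<in> carrier_mat m m" and iso: "C\<^sup>T * W * C = W"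
    and reg: "det (pencil (W\<^sup>T) W) \<noteq> 0" and nz: "det (C - 1\<^sub>m m) \<noteq> 0"
  shows "det C = (-1) ^ m"
proof -
  let ?P = "pencil (W\<^sup>T) W" and ?c = "const_mat :: 'a mat \<Rightarrow> _"
  have iso': "C\<^sup>T * W\<^sup>T * C = W\<^sup>T"
    using arg_cong[OF iso, of transpose_mat] W C by (simp add: transpose_mult_dim assoc_mult_dim)
  have C1: "C - 1\<^sub>m m \<in> carrier_mat m m" "1\<^sub>m m - C\<^sup>T \<in> carrier_mat m m"
    using C by (auto intro!: minus_carrier_mat)
  have CT: "C\<^sup>T \<in> carrier_mat m m" using C by simp
  have "?c (C\<^sup>T) * ?P * ?c (C - 1\<^sub>m m) = pencil (C\<^sup>T * W\<^sup>T * (C - 1\<^sub>m m)) (C\<^sup>T * W * (C - 1\<^sub>m m))"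
    using W C CT C1 by (simp add: const_mat_mult_pencil[of _ m m _ m] pencil_mult_const_mat[of _ m m _ m])
  also have "C\<^sup>T * W\<^sup>T * (C - 1\<^sub>m m) = (1\<^sub>m m - C\<^sup>T) * W\<^sup>T"
    using W C iso' by (simp add: mult_minus_dim minus_mult_dim)
  also have "C\<^sup>T * W * (C - 1\<^sub>m m) = (1\<^sub>m m - C\<^sup>T) * W"
    using W C iso by (simp add: mult_minus_dim minus_mult_dim)
  also have "pencil ((1\<^sub>m m - C\<^sup>T) * W\<^sup>T) ((1\<^sub>m m - C\<^sup>T) * W) = ?c (1\<^sub>m m - C\<^sup>T) * ?P"
    using W C1 by (simp add: const_mat_mult_pencil[of _ m m _ m])
  finally have "det (?c (C\<^sup>T) * ?P * ?c (C - 1\<^sub>m m)) = det (?c (1\<^sub>m m - C\<^sup>T) * ?P)" by simp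
  hence "[:det (C\<^sup>T):] * det ?P * [:det (C - 1\<^sub>m m):] = [:det (1\<^sub>m m - C\<^sup>T):] * det ?P"
    using W CT C1 by (simp add: det_mult[of _ m] const_poly.hom_det)
  hence "[:det (C\<^sup>T) * det (C - 1\<^sub>m m):] * det ?P = [:det (1\<^sub>m m - C\<^sup>T):] * det ?P"
    by (simp add: mult_ac)
  hence "[:det (C\<^sup>T) * det (C - 1\<^sub>m m):] = [:det (1\<^sub>m m - C\<^sup>T):]"
    using reg by (subst (asm) mult_right_cancel) auto
  hence "det (C\<^sup>T) * det (C - 1\<^sub>m m) = det (1\<^sub>m m - C\<^sup>T)" by simp
  moreover have "det (1\<^sub>m m - C\<^sup>T) = (-1) ^ m * det (C - 1\<^sub>m m)"
  proof -
    have "(1\<^sub>m m - C\<^sup>T) = (-1) \<cdot>\<^sub>m (C - 1\<^sub>m m)\<^sup>T"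
      by (rule eq_matI) (use C in auto)
    thus ?thesis using C1 C det_transpose[OF C1(1)] by simp
  qed
  ultimately show ?thesis using nz det_transpose[OF C] by simp
qed

text \<open>The form is the orthogonal sum of the generalised eigenspace of \<open>S\<close> for \<open>-1\<close>, on which \<open>S\<close> has
  determinant \<open>(-1) ^ k\<close>, and of a part on which \<open>S\<close> has determinant \<open>1\<close>. The splitting of
  \<open>- S\<close> at the eigenvalue \<open>1\<close> gives the two parts.\<close>

lemma isometry_splits_off_odd_summand:
  fixes M S :: "'a::field mat"
  assumes M: "M \<in> carrier_mat n n" and reg: "det (pencil (M\<^sup>T) M) \<noteq> 0"
    and S: "S \<in> carrier_mat n n" "det S \<noteq> 0" and iso: "S\<^sup>T * M * S = M"
  obtains k m K W where "K \<in> carrier_mat k k" "W \<in> carrier_mat m m" "congruent_mat M (mat_sum K W)"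
    "det (pencil (K\<^sup>T) K) \<noteq> 0" "det S = (-1) ^ k"
proof -
  have mS: "- S \<in> carrier_mat n n" using S by simp
  have smS: "- S = (-1) \<cdot>\<^sub>m S" by (rule eq_matI) auto
  have "det (- S) \<noteq> 0" unfolding smS using S by simp
  from fitting_at_one[OF mS this] obtain k m P P' L C where n: "n = k + m"
    and P: "P \<in> carrier_mat n n" "P' \<in> carrier_mat n n" "det P \<noteq> 0" "P' * P = 1\<^sub>m n" "P * P' = 1\<^sub>m n"
    and L: "L \<in> carrier_mat k k" "upper_unitriangular L" and C: "C \<in> carrier_mat m m" "det (C - 1\<^sub>m m) \<noteq> 0"
    and eq: "P' * (- S) * P = mat_sum L C" by metis
  define N where "N = P\<^sup>T * M * P"
  have N: "N \<in> carrier_mat (k + m) (k + m)" unfolding N_def using P M n by auto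
  obtain K X Y W where blk: "N = four_block_mat K X Y W" "K \<in> carrier_mat k k" "X \<in> carrier_mat k m"
    "Y \<in> carrier_mat m k" "W \<in> carrier_mat m m" using square_blocks[OF N] .
  have D: "mat_sum L C \<in> carrier_mat n n" using L C n by simp
  have PD: "P * mat_sum L C = (- S) * P"
    unfolding eq[symmetric] using P S by (simp add: assoc_mult_dim mult_eq_assoc[OF P(5)])
  have "(mat_sum L C)\<^sup>T * N * mat_sum L C = (P * mat_sum L C)\<^sup>T * M * (P * mat_sum L C)"
    unfolding N_def using P M L C n by (simp add: transpose_mult_dim assoc_mult_dim)
  also have "\<dots> = P\<^sup>T * (S\<^sup>T * M * S) * P"
    unfolding PD using P S M by (simp add: transpose_mult_dim assoc_mult_dim transpose_uminus)
  finally have iso2: "(mat_sum L C)\<^sup>T * N * mat_sum L C = N" unfolding iso N_def .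
  have LC: "L\<^sup>T \<in> carrier_mat k k" "C\<^sup>T \<in> carrier_mat m m" using L C by auto
  have "(mat_sum L C)\<^sup>T * N * mat_sum L C =
      four_block_mat (L\<^sup>T * K * L) (L\<^sup>T * X * C) (C\<^sup>T * Y * L) (C\<^sup>T * W * C)"
    unfolding mat_sum_transpose unfolding blk(1) mat_sum_def using blk(2-) L(1) C(1) LC
    by (simp add: mult_four_block_mat[of _ k k _ m _ m _ _ k _ m])
  hence blks: "four_block_mat (L\<^sup>T * K * L) (L\<^sup>T * X * C) (C\<^sup>T * Y * L) (C\<^sup>T * W * C) = four_block_mat K X Y W"
    using iso2 blk(1) by simp
  have LX: "L\<^sup>T * X * C = X" and CY: "C\<^sup>T * Y * L = Y" and CW: "C\<^sup>T * W * C = W"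
    by (rule four_block_mat_inject(2)[OF blks, of k m] four_block_mat_inject(3)[OF blks, of k m]
        four_block_mat_inject(4)[OF blks, of k m]; use blk(2-) L(1) C(1) in auto)+
  have X0: "X = 0\<^sub>m k m"
    by (rule spectrally_disjoint_zero[OF blk(3) L one_carrier_mat C]) (use LX blk in simp)
  have "L\<^sup>T * Y\<^sup>T * C = Y\<^sup>T"
    using arg_cong[OF CY, of transpose_mat] blk L C by (simp add: transpose_mult_dim assoc_mult_dim)
  hence "Y\<^sup>T = 0\<^sub>m k m"
    by (intro spectrally_disjoint_zero[OF _ L one_carrier_mat C]) (use blk in auto)
  from arg_cong[OF this, of transpose_mat] have Y0: "Y = 0\<^sub>m m k" by simp
  have NKW: "N = mat_sum K W" unfolding blk(1) using blk X0 Y0 by (simp add: four_block_eq_mat_sum)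
  have "det (pencil (N\<^sup>T) N) \<noteq> 0" unfolding N_def using regular_congruent[OF M P(1,3)] reg by simp
  hence regs: "det (pencil (K\<^sup>T) K) \<noteq> 0" "det (pencil (W\<^sup>T) W) \<noteq> 0"
    unfolding NKW using regular_mat_sum[OF blk(2,5)] by auto
  have "det C = (-1) ^ m" by (rule det_isometry_no_fixed_vector[OF blk(5) C(1) CW regs(2) C(2)])
  moreover have "det (P' * (- S) * P) = det (- S)"
  proof -
    have "det P' * det P = 1" using det_mult[OF P(2,1)] P(4) by simp
    moreover have "det (P' * (- S) * P) = det P' * det (- S) * det P"
      using det_mult[OF mult_carrier_mat[OF P(2) mS] P(1)] det_mult[OF P(2) mS] by simp
    ultimately show ?thesis by (simp add: mult_ac)
  qed
  moreover have "det (mat_sum L C) = det C" using det_mat_sum[OF L(1) C(1)] det_upper_unitriangular[OF L] by simp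
  moreover have "det (- S) = (-1) ^ n * det S" unfolding smS using S by simp
  ultimately have "(-1) ^ n * det S = (-1) ^ m" unfolding eq by simp
  hence "det S = (-1) ^ k"
    unfolding n power_add
    by (cases "even m"; cases "even k") (auto simp: neg_eq_iff_add_eq_0 eq_neg_iff_add_eq_0 add.commute)
  moreover have "congruent_mat M (mat_sum K W)"
    using P(1,3) M unfolding NKW[symmetric] by (intro congruent_matI[of M n P]) (auto simp: N_def)
  ultimately show ?thesis using that blk regs by metis
qed

text \<open>The pencil \<open>(M\<^sup>T, M)\<close> splits at the eigenvalue \<open>1\<close> by an equivalence \<open>R\<close>, \<open>S\<close>. As the two matrices of
  the pencil are transposes of each other, the off-diagonal blocks of \<open>S\<^sup>T * M * S\<close> pair parts with
  different eigenvalues and vanish, so that \<open>S\<close> splits the form itself.\<close>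

lemma regular_splits_unipotent:
  fixes M :: "'a::field mat"
  assumes M: "M \<in> carrier_mat n n" and reg: "det (pencil (M\<^sup>T) M) \<noteq> 0"
  obtains k m K W L where "n = k + m" "K \<in> carrier_mat k k" "W \<in> carrier_mat m m"
    "congruent_mat M (mat_sum K W)" "det K \<noteq> 0" "L \<in> carrier_mat k k" "upper_unitriangular L"
    "K = K\<^sup>T * L" "det (W - W\<^sup>T) \<noteq> 0"
proof -
  have MT: "M\<^sup>T \<in> carrier_mat n n" using M by simp
  obtain k m R S L A2 B2 where n: "n = k + m" and R: "R \<in> carrier_mat n n" "det R \<noteq> 0"
    and S: "S \<in> carrier_mat n n" "det S \<noteq> 0"
    and L': "L \<in> carrier_mat k k" "upper_triangular L" "\<forall>i<k. L $$ (i, i) = 1"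
    and 2: "A2 \<in> carrier_mat m m" "B2 \<in> carrier_mat m m" "det (B2 - A2) \<noteq> 0"
    and eq: "R * M\<^sup>T * S = mat_sum (1\<^sub>m k) A2" "R * M * S = mat_sum L B2"
    using regular_pencil_splits_at_one[OF MT M reg] by blast
  have L: "L \<in> carrier_mat k k" "upper_unitriangular L" using L' by (auto simp: upper_unitriangular_def)
  obtain I where I: "I \<in> carrier_mat n n" "I * R = 1\<^sub>m n" "det I \<noteq> 0" using obtain_inverse[OF R] by metis
  \<comment> \<open>\<open>G\<close> compares the row operations \<open>R\<close> of the equivalence with the \<open>S\<^sup>T\<close> of a congruence\<close>
  define G where "G = S\<^sup>T * I"
  have G: "G \<in> carrier_mat (k + m) (k + m)" unfolding G_def using S I n by auto
  have detG: "det G \<noteq> 0"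
    unfolding G_def using det_mult[of "S\<^sup>T" n I] S I det_transpose[OF S(1)] by simp
  obtain g1 g2 g3 g4 where g: "G = four_block_mat g1 g2 g3 g4" "g1 \<in> carrier_mat k k"
    "g2 \<in> carrier_mat k m" "g3 \<in> carrier_mat m k" "g4 \<in> carrier_mat m m" using square_blocks[OF G] .
  have GR: "G * (R * Z * S) = S\<^sup>T * Z * S" if "Z \<in> carrier_mat n n" for Z
    unfolding G_def using S I(1) R that by (simp add: assoc_mult_dim mult_eq_assoc[OF I(2)])
  have N: "S\<^sup>T * M * S = four_block_mat (g1 * L) (g2 * B2) (g3 * L) (g4 * B2)"
    unfolding GR[OF M, symmetric] eq g(1) mat_sum_def using g(2-) L(1) 2(1,2)
    by (simp add: mult_four_block_mat[of _ k k _ m _ m _ _ k _ m])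
  have NT: "S\<^sup>T * M\<^sup>T * S = four_block_mat g1 (g2 * A2) g3 (g4 * A2)"
    unfolding GR[OF MT, symmetric] eq g(1) mat_sum_def using g(2-) 2(1,2)
    by (simp add: mult_four_block_mat[of _ k k _ m _ m _ _ k _ m])
  have "S\<^sup>T * M\<^sup>T * S = (S\<^sup>T * M * S)\<^sup>T" using S M by (simp add: transpose_mult_dim assoc_mult_dim)
  also have "\<dots> = four_block_mat ((g1 * L)\<^sup>T) ((g3 * L)\<^sup>T) ((g2 * B2)\<^sup>T) ((g4 * B2)\<^sup>T)"
    unfolding N by (rule transpose_four_block_mat[of _ k k _ m _ m]) (use g L 2 in auto)
  finally have blks: "four_block_mat g1 (g2 * A2) g3 (g4 * A2) =
    four_block_mat ((g1 * L)\<^sup>T) ((g3 * L)\<^sup>T) ((g2 * B2)\<^sup>T) ((g4 * B2)\<^sup>T)" unfolding NT .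
  have e1: "g1 = (g1 * L)\<^sup>T" and e2: "g2 * A2 = (g3 * L)\<^sup>T" and e3: "g3 = (g2 * B2)\<^sup>T"
    and e4: "g4 * A2 = (g4 * B2)\<^sup>T"
    by (rule four_block_mat_inject(1)[OF blks, of k m] four_block_mat_inject(2)[OF blks, of k m]
        four_block_mat_inject(3)[OF blks, of k m] four_block_mat_inject(4)[OF blks, of k m];
        use g(2-) L(1) 2(1,2) in auto)+
  have "g2 * A2 = L\<^sup>T * g2 * B2"
  proof -
    have "(g3 * L)\<^sup>T = L\<^sup>T * g3\<^sup>T" using g L by (simp add: transpose_mult_dim)
    also have "g3\<^sup>T = g2 * B2" using arg_cong[OF e3, of transpose_mat] by simp
    finally show ?thesis unfolding e2 using g L 2 by (simp add: assoc_mult_dim)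
  qed
  from spectrally_disjoint_zero[OF g(3) L 2(1,2,3) this] have g2: "g2 = 0\<^sub>m k m" .
  have g3: "g3 = 0\<^sub>m m k" unfolding e3 g2 using 2 by simp
  have "G = mat_sum g1 g4" unfolding g(1) using g g2 g3 by (simp add: four_block_eq_mat_sum)
  hence dg: "det g1 \<noteq> 0" "det g4 \<noteq> 0" using detG det_mat_sum[OF g(2,5)] by auto
  have N2: "S\<^sup>T * M * S = mat_sum (g1 * L) (g4 * B2)"
    unfolding N g2 g3 using g L 2 by (simp add: four_block_eq_mat_sum[of _ k k _ m m])
  have W: "g4 * B2 - (g4 * B2)\<^sup>T = g4 * (B2 - A2)" unfolding e4[symmetric] using g 2 by (simp add: mult_minus_dim)
  show ?thesis
  proof (rule that[OF n])
    show "congruent_mat M (mat_sum (g1 * L) (g4 * B2))" by (rule congruent_matI[OF M S N2])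
    show "det (g1 * L) \<noteq> 0" using det_mult[OF g(2) L(1)] dg det_upper_unitriangular[OF L] by simp
    show "g1 * L = (g1 * L)\<^sup>T * L" unfolding e1[symmetric] ..
    show "det (g4 * B2 - (g4 * B2)\<^sup>T) \<noteq> 0"
      unfolding W using det_mult[OF g(5) minus_carrier_mat[OF 2(1), of B2]] dg 2 by simp
  qed (use g L 2 in auto)
qed

text \<open>A skew-symmetric matrix of odd size has determinant zero when \<open>2 \<noteq> 0\<close>.\<close>

lemma even_dim_if_alternating_part_nonsingular:
  fixes W :: "'a::field mat"
  assumes W: "W \<in> carrier_mat m m" and nz: "det (W - W\<^sup>T) \<noteq> 0" and two: "(2::'a) \<noteq> 0"
  shows "even m"
proof (rule ccontr)
  assume odd: "odd m"
  have E: "W - W\<^sup>T \<in> carrier_mat m m" using W by (intro minus_carrier_mat) auto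
  have "(W - W\<^sup>T)\<^sup>T = (-1) \<cdot>\<^sub>m (W - W\<^sup>T)" by (rule eq_matI) (use W in auto)
  from arg_cong[OF this, of det] have "det (W - W\<^sup>T) = (-1) ^ m * det (W - W\<^sup>T)"
    using det_transpose[OF E] W by simp
  hence "2 * det (W - W\<^sup>T) = 0" using odd by simp
  thus False using nz two by simp
qed

section \<open>Cosquares and Jordan blocks\<close>

text \<open>The right-hand side characterises the cosquare without an inverse.\<close>

lemma cosquare_eq_iff:
  fixes K C :: "'a::field mat"
  assumes K: "K \<in> carrier_mat n n" "det K \<noteq> 0" and C: "C \<in> carrier_mat n n"
  shows "cosquare K = C \<longleftrightarrow> K = K\<^sup>T * C"
proof -
  have "mat_inverse K \<noteq> None"
    using mat_inverse(1)[OF K(1), of undefined] det_non_zero_imp_unit[OF K, of undefined] by blast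
  then obtain B where B: "mat_inverse K = Some B" by auto
  from mat_inverse(2)[OF K(1) B] have B': "K * B = 1\<^sub>m n" "B * K = 1\<^sub>m n" "B \<in> carrier_mat n n" by auto
  have KB: "K\<^sup>T * B\<^sup>T = 1\<^sub>m n" "B\<^sup>T * K\<^sup>T = 1\<^sub>m n"
    using B' K by (simp_all flip: transpose_mult_dim)
  have c: "cosquare K = B\<^sup>T * K" unfolding cosquare_def B by simp
  show ?thesis
  proof
    assume "cosquare K = C"
    hence "K\<^sup>T * C = K\<^sup>T * (B\<^sup>T * K)" unfolding c by simp
    also have "\<dots> = K\<^sup>T * B\<^sup>T * K" using K B' by (simp add: assoc_mult_dim)
    finally show "K = K\<^sup>T * C" unfolding KB using K by simp
  next
    assume e: "K = K\<^sup>T * C"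
    have "B\<^sup>T * K = B\<^sup>T * (K\<^sup>T * C)" using e by simp
    also have "\<dots> = B\<^sup>T * K\<^sup>T * C" using K B' C by (simp add: assoc_mult_dim)
    finally show "cosquare K = C" unfolding c KB using C by simp
  qed
qed

lemma cosquare_carrier:
  fixes K :: "'a::field mat"
  assumes K: "K \<in> carrier_mat n n" "det K \<noteq> 0"
  shows "cosquare K \<in> carrier_mat n n"
proof -
  have KT: "K\<^sup>T \<in> carrier_mat n n" "det (K\<^sup>T) \<noteq> 0" using K det_transpose[OF K(1)] by auto
  obtain B where B: "B \<in> carrier_mat n n" "K\<^sup>T * B = 1\<^sub>m n" using obtain_inverse[OF KT] by metis
  have "K\<^sup>T * (B * K) = K" using KT B K by (simp add: mult_eq_assoc[OF B(2)])
  hence "cosquare K = B * K" using cosquare_eq_iff[OF K, of "B * K"] B K by simp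
  thus ?thesis using B K by simp
qed

lemma transpose_mult_cosquare:
  fixes K :: "'a::field mat"
  assumes K: "K \<in> carrier_mat n n" "det K \<noteq> 0"
  shows "K\<^sup>T * cosquare K = K"
  using cosquare_eq_iff[OF K cosquare_carrier[OF K]] by simp

lemma similar_matI:
  fixes A B P :: "'a::field mat"
  assumes "A \<in> carrier_mat n n" "B \<in> carrier_mat n n" "P \<in> carrier_mat n n" "det P \<noteq> 0" "A * P = P * B"
  shows "similar_mat A B"
proof -
  obtain Q where Q: "Q \<in> carrier_mat n n" "P * Q = 1\<^sub>m n" "Q * P = 1\<^sub>m n"
    using obtain_inverse[OF assms(3,4)] by metis
  have "A = A * (P * Q)" using assms(1) Q by simp
  also have "\<dots> = A * P * Q" using assms(1,3) Q(1) by (simp add: assoc_mult_dim)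
  finally have "similar_mat_wit A B P Q" unfolding assms(5) using Q assms by (intro similar_mat_witI[of _ _ n]) auto
  thus ?thesis unfolding similar_mat_def by auto
qed

lemma similar_matE:
  fixes A B :: "'a::field mat"
  assumes "similar_mat A B" "A \<in> carrier_mat n n"
  obtains P where "B \<in> carrier_mat n n" "P \<in> carrier_mat n n" "det P \<noteq> 0" "A * P = P * B"
proof -
  from assms(1) obtain P Q where w: "similar_mat_wit A B P Q" unfolding similar_mat_def by auto
  note w = similar_mat_witD2[OF assms(2) w]
  have "A * P = P * B * (Q * P)" unfolding w(3) using w(5-7) by (simp add: assoc_mult_dim)
  hence "A * P = P * B" unfolding w(2) using w(5,6) by simp
  thus ?thesis using that[OF w(5,6) det_nonzero_if_right_inverse[OF w(6,7,1)]] by simp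
qed

lemma lower_jordan_block_carrier [simp]: "lower_jordan_block r a \<in> carrier_mat r r"
  unfolding lower_jordan_block_def by simp

lemma lower_jordan_block_dim [simp]:
  "dim_row (lower_jordan_block r a) = r" "dim_col (lower_jordan_block r a) = r"
  unfolding lower_jordan_block_def by simp_all

lemma lower_jordan_block_index:
  "i < r \<Longrightarrow> j < r \<Longrightarrow>
    lower_jordan_block r a $$ (i, j) = (if i = j then a else if i = Suc j then 1 else 0)"
  unfolding lower_jordan_block_def by auto

lemma det_lower_jordan_block: "det (lower_jordan_block r (a::'a::field)) = a ^ r"
proof -
  have "det (jordan_block r a) = prod_list (diag_mat (jordan_block r a))"
    by (intro det_upper_triangular[of _ r]) auto
  also have "diag_mat (jordan_block r a) = replicate r a"
    by (rule nth_equalityI) (auto simp: diag_mat_def)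
  finally show ?thesis unfolding lower_jordan_block_def using det_transpose[of "jordan_block r a" r] by simp
qed

lemma has_jordan_cosquare_carrier:
  assumes "has_jordan_cosquare r (Q::'a::field mat)"
  shows "Q \<in> carrier_mat r r" "det Q \<noteq> 0"
proof -
  from assms have i: "invertible_mat Q" and s: "similar_mat (cosquare Q) (lower_jordan_block r 1)"
    unfolding has_jordan_cosquare_def by auto
  have Q: "Q \<in> carrier_mat (dim_row Q) (dim_row Q)" using i unfolding invertible_mat_def by (auto intro: carrier_matI)
  have d: "det Q \<noteq> 0" using invertible_mat_iff_det[OF Q] i by simp
  have "lower_jordan_block r (1::'a) \<in> carrier_mat (dim_row Q) (dim_row Q)"
    by (rule similar_matE[OF s cosquare_carrier[OF Q d]])
  from carrier_matD(1)[OF this] have "dim_row Q = r" by simp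
  with Q d show "Q \<in> carrier_mat r r" "det Q \<noteq> 0" by simp_all
qed

lemma has_jordan_cosquareI:
  fixes Q :: "'a::field mat"
  assumes Q: "Q \<in> carrier_mat r r" "det Q \<noteq> 0" and P: "P \<in> carrier_mat r r" "det P \<noteq> 0"
    and eq: "Q * P = Q\<^sup>T * P * lower_jordan_block r 1"
  shows "has_jordan_cosquare r Q"
proof -
  have "cosquare Q * P = P * lower_jordan_block r 1"
  proof (rule mult_left_cancel_invertible[of "Q\<^sup>T" r])
    have "Q\<^sup>T * (cosquare Q * P) = Q\<^sup>T * cosquare Q * P"
      using Q cosquare_carrier[OF Q] P by (simp add: assoc_mult_dim)
    also have "\<dots> = Q\<^sup>T * (P * lower_jordan_block r 1)"
      unfolding transpose_mult_cosquare[OF Q] eq using Q P by (simp add: assoc_mult_dim)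
    finally show "Q\<^sup>T * (cosquare Q * P) = Q\<^sup>T * (P * lower_jordan_block r 1)" .
  qed (use Q P cosquare_carrier[OF Q] det_transpose[OF Q(1)] in auto)
  from similar_matI[OF cosquare_carrier[OF Q] _ P this] show ?thesis
    unfolding has_jordan_cosquare_def using Q invertible_mat_iff_det[OF Q(1)] by simp
qed

lemma has_jordan_cosquareE:
  fixes Q :: "'a::field mat"
  assumes "has_jordan_cosquare r Q"
  obtains P where "P \<in> carrier_mat r r" "det P \<noteq> 0" "Q * P = Q\<^sup>T * P * lower_jordan_block r 1"
proof -
  note Q = has_jordan_cosquare_carrier[OF assms]
  obtain P where P: "P \<in> carrier_mat r r" "det P \<noteq> 0" "cosquare Q * P = P * lower_jordan_block r 1"
    using similar_matE[OF _ cosquare_carrier[OF Q]] assms unfolding has_jordan_cosquare_def by metis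
  have "Q * P = Q\<^sup>T * cosquare Q * P" unfolding transpose_mult_cosquare[OF Q] ..
  also have "\<dots> = Q\<^sup>T * (cosquare Q * P)" using Q cosquare_carrier[OF Q] P(1) by (simp add: assoc_mult_dim)
  also have "\<dots> = Q\<^sup>T * P * lower_jordan_block r 1" unfolding P(3) using Q P(1) by (simp add: assoc_mult_dim)
  finally show ?thesis using that P by auto
qed

section \<open>Forms that a Jordan block preserves\<close>

lemma mult_lower_jordan_block:
  fixes X :: "'a::field mat"
  assumes X: "X \<in> carrier_mat n r" and ij: "i < n" "j < r"
  shows "(X * lower_jordan_block r 1) $$ (i, j) = X $$ (i, j) + (if Suc j < r then X $$ (i, Suc j) else 0)"
proof -
  have "(X * lower_jordan_block r 1) $$ (i, j) = (\<Sum>l<r. X $$ (i, l) * lower_jordan_block r 1 $$ (l, j))"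
    using X ij by (simp add: scalar_prod_def atLeast0LessThan)
  also have "\<dots> = (\<Sum>l<r. (if l = j then X $$ (i, l) else 0) + (if l = Suc j then X $$ (i, l) else 0))"
    using ij by (intro sum.cong) (auto simp: lower_jordan_block_index)
  also have "\<dots> = X $$ (i, j) + (if Suc j < r then X $$ (i, Suc j) else 0)"
    using ij by (simp add: sum.distrib)
  finally show ?thesis .
qed

lemma lower_jordan_block_transpose_mult:
  fixes X :: "'a::field mat"
  assumes X: "X \<in> carrier_mat r n" and ij: "i < r" "j < n"
  shows "((lower_jordan_block r 1)\<^sup>T * X) $$ (i, j) = X $$ (i, j) + (if Suc i < r then X $$ (Suc i, j) else 0)"
proof -
  have "(lower_jordan_block r 1)\<^sup>T * X = (X\<^sup>T * lower_jordan_block r 1)\<^sup>T"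
    using X by (simp add: transpose_mult_dim)
  thus ?thesis using mult_lower_jordan_block[of "X\<^sup>T" n r j i] X ij by simp
qed

text \<open>If \<open>p\<close> is the first index at which a vector of the kernel does not vanish, then row
  \<open>r - 1 - p\<close> of the matrix only meets that entry of the vector.\<close>

lemma det_antitriangular:
  fixes K :: "'a::field mat"
  assumes K: "K \<in> carrier_mat r r"
    and z: "\<And>i j. i < r \<Longrightarrow> j < r \<Longrightarrow> r \<le> i + j \<Longrightarrow> K $$ (i, j) = 0"
    and nz: "\<And>i. i < r \<Longrightarrow> K $$ (i, r - 1 - i) \<noteq> 0"
  shows "det K \<noteq> 0"
proof
  assume "det K = 0"
  then obtain v where v: "v \<in> carrier_vec r" "v \<noteq> 0\<^sub>v r" "K *\<^sub>v v = 0\<^sub>v r"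
    using det_0_iff_vec_prod_zero_field[OF K] by auto
  have ex: "\<exists>p. p < r \<and> v $ p \<noteq> 0"
  proof (rule ccontr)
    assume "\<not> ?thesis"
    hence "v = 0\<^sub>v r" using v(1) by (intro eq_vecI) auto
    thus False using v(2) by simp
  qed
  define p where "p = (LEAST p. p < r \<and> v $ p \<noteq> 0)"
  have p: "p < r" "v $ p \<noteq> 0" using LeastI_ex[OF ex] unfolding p_def by auto
  have least: "v $ l = 0" if "l < p" for l
    using not_less_Least[of l "\<lambda>p. p < r \<and> v $ p \<noteq> 0"] that p unfolding p_def[symmetric] by auto
  let ?i = "r - 1 - p"
  have i: "?i < r" using p by simp
  have "0 = (K *\<^sub>v v) $ ?i" using v(3) i by simp
  also have "\<dots> = (\<Sum>l<r. K $$ (?i, l) * v $ l)"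
    using K i v(1) by (simp add: scalar_prod_def atLeast0LessThan)
  also have "\<dots> = (\<Sum>l<r. if l = p then K $$ (?i, p) * v $ p else 0)"
  proof (rule sum.cong[OF refl])
    fix l assume "l \<in> {..<r}"
    thus "K $$ (?i, l) * v $ l = (if l = p then K $$ (?i, p) * v $ p else 0)"
      using least[of l] z[OF i, of l] p(1) by (cases l p rule: linorder_cases) auto
  qed
  also have "\<dots> = K $$ (?i, p) * v $ p" using p by simp
  finally show False using nz[OF i] p by simp
qed

text \<open>The equation amounts to
  \<open>K(i + 1, j) + K(i, j + 1) + K(i + 1, j + 1) = 0\<close>, where entries outside the matrix count as \<open>0\<close>.\<close>

lemma isometric_jordan_antitriangular:
  fixes K :: "'a::field mat"
  assumes K: "K \<in> carrier_mat r r" and eq: "(lower_jordan_block r 1)\<^sup>T * K * lower_jordan_block r 1 = K"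
  shows "\<And>i j. i < r \<Longrightarrow> j < r \<Longrightarrow> r \<le> i + j \<Longrightarrow> K $$ (i, j) = 0"
    and "\<And>i. i < r \<Longrightarrow> K $$ (i, r - 1 - i) = (-1) ^ i * K $$ (0, r - 1)"
proof -
  let ?L = "lower_jordan_block r (1::'a)"
  define k where "k i j = (if i < r \<and> j < r then K $$ (i, j) else 0)" for i j
  have rec: "k (Suc i) j + k i (Suc j) + k (Suc i) (Suc j) = 0" if "i < r" "j < r" for i j
  proof -
    have KL: "K * ?L \<in> carrier_mat r r" using K by auto
    have "?L\<^sup>T * K * ?L = ?L\<^sup>T * (K * ?L)" using K by (simp add: assoc_mult_dim)
    hence "k i j = (?L\<^sup>T * (K * ?L)) $$ (i, j)" using eq that unfolding k_def by simp
    also have "\<dots> = k i j + k i (Suc j) + (k (Suc i) j + k (Suc i) (Suc j))"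
      unfolding lower_jordan_block_transpose_mult[OF KL that]
      using that mult_lower_jordan_block[OF K that] mult_lower_jordan_block[OF K _ that(2), of "Suc i"]
      by (auto simp: k_def)
    finally show ?thesis by (simp add: algebra_simps)
  qed
  have zero: "k i j = 0" if "r = i + Suc d" "r \<le> i + j" for i j d
    using that
  proof (induction d arbitrary: i j)
    case 0
    then obtain j' where j: "j = Suc j'" by (cases j) auto
    show ?case using rec[of i j'] 0 j by (cases "j' < r") (auto simp: k_def)
  next
    case (Suc d)
    then obtain j' where j: "j = Suc j'" by (cases j) auto
    show ?case using rec[of i j'] Suc.IH[of "Suc i" j'] Suc.IH[of "Suc i" "Suc j'"] Suc.prems j
      by (cases "j' < r") (auto simp: k_def)
  qed
  show "K $$ (i, j) = 0" if "i < r" "j < r" "r \<le> i + j" for i j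
    using zero[of i "r - 1 - i" j] that by (simp add: k_def)
  have anti: "i < r \<Longrightarrow> k i (r - 1 - i) = (-1) ^ i * k 0 (r - 1)" for i
  proof (induction i)
    case (Suc i)
    have e: "Suc (r - 1 - Suc i) = r - 1 - i" using Suc.prems by simp
    have "k (Suc i) (r - 1 - i) = 0"
      using zero[of "Suc i" "r - 1 - Suc i" "r - 1 - i"] Suc.prems by simp
    hence "k (Suc i) (r - 1 - Suc i) = - k i (r - 1 - i)"
      using rec[of i "r - 1 - Suc i"] Suc.prems unfolding e by (simp add: add_eq_0_iff2)
    thus ?case using Suc by simp
  qed simp
  show "K $$ (i, r - 1 - i) = (-1) ^ i * K $$ (0, r - 1)" if "i < r" for i
    using anti[OF that] that by (auto simp: k_def)
qed

text \<open>Nonsingularity of such a form depends only on its corner entry, which is additive in the form.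
  This is what makes one of several vectors generate a nonsingular cyclic subspace.\<close>

lemma isometric_jordan_nonsingular_iff:
  fixes K :: "'a::field mat"
  assumes K: "K \<in> carrier_mat r r" and eq: "(lower_jordan_block r 1)\<^sup>T * K * lower_jordan_block r 1 = K"
    and r: "r > 0"
  shows "det K \<noteq> 0 \<longleftrightarrow> K $$ (0, r - 1) \<noteq> 0"
proof
  note anti = isometric_jordan_antitriangular[OF K eq]
  assume c: "K $$ (0, r - 1) \<noteq> 0"
  show "det K \<noteq> 0"
  proof (rule det_antitriangular[OF K anti(1)])
    show "K $$ (i, r - 1 - i) \<noteq> 0" if "i < r" for i unfolding anti(2)[OF that] using c by simp
  qed
next
  note anti = isometric_jordan_antitriangular[OF K eq]
  assume d: "det K \<noteq> 0"
  show "K $$ (0, r - 1) \<noteq> 0"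
  proof
    assume c: "K $$ (0, r - 1) = 0"
    have "K *\<^sub>v unit_vec r (r - 1) = 0\<^sub>v r"
    proof (rule eq_vecI)
      fix i assume "i < dim_vec (0\<^sub>v r :: 'a vec)"
      hence i: "i < r" by simp
      have "K $$ (i, r - 1) = 0" using anti(1)[of i "r - 1"] c i r by (cases "i = 0") auto
      thus "(K *\<^sub>v unit_vec r (r - 1)) $ i = 0\<^sub>v r $ i" using K i r by simp
    qed (use K in auto)
    moreover have "unit_vec r (r - 1) \<noteq> (0\<^sub>v r :: 'a vec)" using r by simp
    ultimately have "det K = 0" unfolding det_0_iff_vec_prod_zero_field[OF K]
      by (intro exI[of _ "unit_vec r (r - 1)"]) simp
    thus False using d by simp
  qed
qed

section \<open>The matrices \<open>\<Gamma>\<^sub>r\<close>\<close>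

text \<open>With \<open>U\<close> the upper shift and \<open>D\<close> the antidiagonal part of \<open>\<Gamma>\<close>, one has \<open>\<Gamma> = D * (1 + U)\<close> and,
  for odd \<open>r\<close>, \<open>\<Gamma>\<^sup>T = D * (1 - U)\<close>. The columns \<open>x j\<close> of a Jordan basis therefore have to satisfy
  \<open>2 * U * x j = (1 - U) * x (j + 1)\<close>, which is solved by applying
  \<open>(2 * U) ^ j * (1 - U) ^ (r - 1 - j)\<close> to the last unit vector.\<close>

lemma Gamma_mat_jordan_basis:
  assumes r: "odd r" and two: "(2::'a::field) \<noteq> 0"
  obtains X :: "'a::field mat" where "X \<in> carrier_mat r r" "det X \<noteq> 0"
    "Gamma_mat r * X = (Gamma_mat r)\<^sup>T * X * lower_jordan_block r 1"
proof -
  define x :: "nat \<Rightarrow> nat \<Rightarrow> 'a" where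
    "x i j = (if i + j < r then 2 ^ j * (-1) ^ (r - 1 - j - i) * of_nat ((r - 1 - j) choose (r - 1 - j - i)) else 0)" for i j
  define X where "X = mat r r (\<lambda>(i, j). x i j)"
  have X: "X \<in> carrier_mat r r" unfolding X_def by simp
  have "det X \<noteq> 0"
    by (rule det_antitriangular[OF X]) (use two in \<open>auto simp: X_def x_def\<close>)
  moreover have pascal: "2 * x (Suc i) j = x i (Suc j) - x (Suc i) (Suc j)" for i j
  proof (cases "Suc i + j < r")
    case True
    define k where "k = r - Suc (Suc (i + j))"
    have rk: "r = k + i + j + 2" using True k_def by simp
    show ?thesis
    proof (cases k)
      case 0
      thus ?thesis unfolding x_def rk by simp
    next
      case (Suc l)
      have "Suc (i + Suc l) choose Suc l = (i + Suc l choose l) + (i + Suc l choose Suc l)" by simp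
      thus ?thesis unfolding x_def rk Suc by (simp add: algebra_simps)
    qed
  next
    case False
    thus ?thesis unfolding x_def by simp
  qed
  moreover have "Gamma_mat r * X = (Gamma_mat r)\<^sup>T * X * lower_jordan_block r 1"
  proof (rule eq_matI)
    let ?L = "lower_jordan_block r (1::'a)"
    let ?G = "Gamma_mat r :: 'a mat"
    have G: "?G \<in> carrier_mat r r" unfolding Gamma_mat_def by simp
    fix i j assume "i < dim_row (?G\<^sup>T * X * ?L)" "j < dim_col (?G\<^sup>T * X * ?L)"
    hence ij: "i < r" "j < r" using G by auto
    define p where "p = r - 1 - i"
    have p: "p < r" "i = r - 1 - p" using ij p_def by auto
    have x0: "x a b = 0" if "r \<le> a \<or> r \<le> b" for a b using that unfolding x_def by auto
    have Gx: "(?G * X) $$ (i, j) = (-1) ^ p * (x p j + x (Suc p) j)"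
    proof -
      have "(?G * X) $$ (i, j) = (\<Sum>l<r. ?G $$ (i, l) * x l j)"
        using G X ij by (simp add: scalar_prod_def atLeast0LessThan X_def)
      also have "\<dots> = (\<Sum>l<r. (if l = p then (-1) ^ p * x l j else 0) + (if l = Suc p then (-1) ^ p * x l j else 0))"
        using ij p by (intro sum.cong) (auto simp: Gamma_mat_def)
      also have "\<dots> = (-1) ^ p * (x p j + x (Suc p) j)"
        using p x0[of "Suc p" j] by (simp add: sum.distrib algebra_simps)
      finally show ?thesis .
    qed
    have XL: "(X * ?L) $$ (l, j) = x l j + x l (Suc j)" if "l < r" for l
      using mult_lower_jordan_block[OF X that ij(2)] ij that x0[of l "Suc j"] by (auto simp: X_def)
    have par: "(-1) ^ i = ((-1) ^ p :: 'a)"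
    proof -
      have "even (i + p)" using p ij r by auto
      thus ?thesis by (metis minus_one_power_iff even_add)
    qed
    have "(?G\<^sup>T * X * ?L) $$ (i, j) = (?G\<^sup>T * (X * ?L)) $$ (i, j)" using G X by (simp add: assoc_mult_dim)
    also have "\<dots> = (\<Sum>l<r. ?G $$ (l, i) * (x l j + x l (Suc j)))"
      using mult_mat_index_sum[of "?G\<^sup>T" r r "X * ?L" r i j] G X ij XL
      by (auto intro!: sum.cong simp del: index_mult_mat(1))
    also have "\<dots> = (\<Sum>l<r. (if l = p then (-1) ^ p * (x l j + x l (Suc j)) else 0)
        - (if l = Suc p then (-1) ^ p * (x l j + x l (Suc j)) else 0))"
    proof (rule sum.cong[OF refl])
      fix l assume l: "l \<in> {..<r}"
      have "(-1) ^ (i - 1) = (- ((-1) ^ p) :: 'a)" if "0 < i" unfolding par[symmetric] using that by (cases i) auto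
      thus "?G $$ (l, i) * (x l j + x l (Suc j)) = (if l = p then (-1) ^ p * (x l j + x l (Suc j)) else 0)
        - (if l = Suc p then (-1) ^ p * (x l j + x l (Suc j)) else 0)"
        using l ij p par by (auto simp: Gamma_mat_def)
    qed
    also have "\<dots> = (-1) ^ p * (x p j + x p (Suc j)) - (-1) ^ p * (x (Suc p) j + x (Suc p) (Suc j))"
      using p x0[of "Suc p" j] x0[of "Suc p" "Suc j"] by (simp add: sum_subtractf)
    also have "\<dots> = (-1) ^ p * (x p j + (x p (Suc j) - x (Suc p) (Suc j)) - x (Suc p) j)"
      by (simp add: algebra_simps)
    also have "\<dots> = (?G * X) $$ (i, j)" unfolding Gx pascal[of p j, symmetric] by (simp add: algebra_simps)
    finally show "(?G * X) $$ (i, j) = (?G\<^sup>T * X * ?L) $$ (i, j)" ..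
  qed (auto simp: X_def Gamma_mat_def)
  ultimately show ?thesis using that X by auto
qed

lemma det_Gamma_mat: "det (Gamma_mat r :: 'a::field mat) \<noteq> 0"
proof -
  let ?L = "(lower_jordan_block r 1)\<^sup>T :: 'a mat"
  define D where "D = mat r r (\<lambda>(i, j). if i + j + 1 = r then (-1) ^ j else 0 :: 'a)"
  have D: "D \<in> carrier_mat r r" unfolding D_def by simp
  have "det D \<noteq> 0" by (rule det_antitriangular[OF D]) (auto simp: D_def)
  moreover have "Gamma_mat r = D * ?L"
  proof (rule eq_matI)
    fix i j assume "i < dim_row (D * ?L)" "j < dim_col (D * ?L)"
    hence ij: "i < r" "j < r" using D by auto
    have "(D * ?L) $$ (i, j) = (\<Sum>l<r. D $$ (i, l) * ?L $$ (l, j))"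
      using D ij by (simp add: scalar_prod_def atLeast0LessThan)
    also have "\<dots> = (\<Sum>l<r. if l = r - 1 - i then (-1) ^ (r - 1 - i) * ?L $$ (r - 1 - i, j) else 0)"
      using ij by (intro sum.cong) (auto simp: D_def)
    also have "\<dots> = (-1) ^ (r - 1 - i) * ?L $$ (r - 1 - i, j)" using ij by simp
    also have "\<dots> = Gamma_mat r $$ (i, j)"
      using ij by (auto simp: Gamma_mat_def lower_jordan_block_index)
    finally show "Gamma_mat r $$ (i, j) = (D * ?L) $$ (i, j)" ..
  qed (auto simp: D_def Gamma_mat_def)
  moreover have "det ?L = 1" using det_lower_jordan_block[of r 1] det_transpose[of "lower_jordan_block r (1::'a)" r] by simp
  ultimately show ?thesis using D by (simp add: det_mult[of _ r])
qed

lemma Gamma_mat_dim [simp]: "dim_row (Gamma_mat r) = r" "dim_col (Gamma_mat r) = r"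
  unfolding Gamma_mat_def by simp_all

lemma Gamma_mat_carrier [simp]: "Gamma_mat r \<in> carrier_mat r r" unfolding Gamma_mat_def by simp

lemma Gamma_mat_has_jordan_cosquare:
  assumes "odd r" "(2::'a::field) \<noteq> 0"
  shows "has_jordan_cosquare r (Gamma_mat r :: 'a mat)"
proof -
  obtain X :: "'a mat" where "X \<in> carrier_mat r r" "det X \<noteq> 0"
    "Gamma_mat r * X = (Gamma_mat r)\<^sup>T * X * lower_jordan_block r 1"
    using Gamma_mat_jordan_basis[OF assms] .
  from has_jordan_cosquareI[OF Gamma_mat_carrier det_Gamma_mat this] show ?thesis .
qed

section \<open>Summands of the pencil of a form\<close>

lemma equivalence_summandI:
  fixes A B :: "'a::field mat"
  assumes AB: "A \<in> carrier_mat n n" "B \<in> carrier_mat n n"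
    and R: "R \<in> carrier_mat n n" "det R \<noteq> 0" and S: "S \<in> carrier_mat n n" "det S \<noteq> 0"
    and A0: "A0 \<in> carrier_mat a b" "B0 \<in> carrier_mat a b" and C: "C \<in> carrier_mat c d" "D \<in> carrier_mat c d"
    and eq: "R * A * S = mat_sum A0 C" "R * B * S = mat_sum B0 D"
  shows "equivalence_summand (A0, B0) (A, B)"
proof -
  have "mat_sum A0 C \<in> carrier_mat n n" "mat_sum B0 D \<in> carrier_mat n n"
    using AB R S unfolding eq[symmetric] by auto
  hence "equivalent_pair (A, B) (pair_sum (A0, B0) (C, D))"
    unfolding equivalent_pair_def pair_sum_def using AB R S eq invertible_mat_iff_det[OF R(1)] invertible_mat_iff_det[OF S(1)]
    by (intro exI[of _ n] conjI bexI[of _ R] bexI[of _ S]) auto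
  thus ?thesis unfolding equivalence_summand_def
    by (intro conjI exI[of _ "(C, D)"]) (use A0 C in \<open>auto simp: same_size_def\<close>)
qed

lemma equivalence_summandE:
  fixes A B :: "'a::field mat"
  assumes e: "equivalence_summand (A0, B0) (A, B)"
    and A: "A \<in> carrier_mat n n" and A0: "A0 \<in> carrier_mat a b" "B0 \<in> carrier_mat a b"
  obtains R S C D c d where "R \<in> carrier_mat n n" "det R \<noteq> 0" "S \<in> carrier_mat n n" "det S \<noteq> 0"
    "C \<in> carrier_mat c d" "D \<in> carrier_mat c d" "n = a + c" "n = b + d"
    "R * A * S = mat_sum A0 C" "R * B * S = mat_sum B0 D"
proof -
  from e obtain C D where CD: "same_size (C, D)" "equivalent_pair (A, B) (mat_sum A0 C, mat_sum B0 D)"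
    unfolding equivalence_summand_def pair_sum_def by auto
  from CD(2) obtain p q R S where car: "A \<in> carrier_mat p q" "mat_sum A0 C \<in> carrier_mat p q"
    and R: "R \<in> carrier_mat p p" "invertible_mat R" and S: "S \<in> carrier_mat q q" "invertible_mat S"
    and eq: "R * A * S = mat_sum A0 C" "R * B * S = mat_sum B0 D"
    unfolding equivalent_pair_def by auto
  have pq: "p = n" "q = n" using car(1) A by auto
  note R = R[unfolded pq] and S = S[unfolded pq]
  have d: "n = a + dim_row C" "n = b + dim_col C"
    using carrier_matD[OF car(2)] A0(1) unfolding pq by auto
  have "C \<in> carrier_mat (dim_row C) (dim_col C)" "D \<in> carrier_mat (dim_row C) (dim_col C)"
    using CD(1) unfolding same_size_def by (auto intro: carrier_matI)
  from that[OF R(1) _ S(1) _ this d eq] show ?thesis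
    using R S invertible_mat_iff_det[OF R(1)] invertible_mat_iff_det[OF S(1)] by simp
qed

text \<open>The inclusion of the first \<open>k\<close> coordinates; its transpose is the projection onto them.\<close>

definition first_columns :: "nat \<Rightarrow> nat \<Rightarrow> 'a::{zero,one} mat" where
  "first_columns n k = mat n k (\<lambda>(i, j). if i = j then 1 else 0)"

lemma first_columns_carrier [simp]: "first_columns n k \<in> carrier_mat n k"
  unfolding first_columns_def by simp

lemma first_columns_dim [simp]: "dim_row (first_columns n k) = n" "dim_col (first_columns n k) = k"
  unfolding first_columns_def by simp_all

lemma mat_sum_mult_first_columns:
  fixes A C :: "'a::comm_semiring_1 mat"
  assumes A: "A \<in> carrier_mat a b" and C: "C \<in> carrier_mat c d"
  shows "mat_sum A C * first_columns (b + d) b = first_columns (a + c) a * A"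
proof (rule eq_matI)
  fix i j assume "i < dim_row (first_columns (a + c) a * A)" "j < dim_col (first_columns (a + c) a * A)"
  hence ij: "i < a + c" "j < b" using A by (auto simp: first_columns_def)
  have "(mat_sum A C * first_columns (b + d) b) $$ (i, j) =
      (\<Sum>l<b + d. mat_sum A C $$ (i, l) * first_columns (b + d) b $$ (l, j))"
    using A C ij by (simp add: scalar_prod_def atLeast0LessThan first_columns_def)
  also have "\<dots> = (\<Sum>l<b + d. if l = j then mat_sum A C $$ (i, l) else 0)"
    using ij by (intro sum.cong) (auto simp: first_columns_def)
  also have "\<dots> = mat_sum A C $$ (i, j)" using ij by simp
  finally have 1: "(mat_sum A C * first_columns (b + d) b) $$ (i, j) = mat_sum A C $$ (i, j)" .
  have "(first_columns (a + c) a * A) $$ (i, j) = (\<Sum>l<a. first_columns (a + c) a $$ (i, l) * A $$ (l, j))"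
    using A C ij by (simp add: scalar_prod_def atLeast0LessThan first_columns_def)
  also have "\<dots> = (\<Sum>l<a. if l = i then A $$ (l, j) else 0)"
    using ij by (intro sum.cong) (auto simp: first_columns_def)
  also have "\<dots> = mat_sum A C $$ (i, j)" using A C ij by (simp add: mat_sum_index)
  finally show "(mat_sum A C * first_columns (b + d) b) $$ (i, j) = (first_columns (a + c) a * A) $$ (i, j)"
    using 1 by simp
qed (use A C in \<open>auto simp: first_columns_def\<close>)

lemma first_columns_transpose_mult_mat_sum:
  fixes A C :: "'a::comm_semiring_1 mat"
  assumes A: "A \<in> carrier_mat a b" and C: "C \<in> carrier_mat c d"
  shows "(first_columns (a + c) a)\<^sup>T * mat_sum A C = A * (first_columns (b + d) b)\<^sup>T"
proof -
  have "(mat_sum (A\<^sup>T) (C\<^sup>T) * first_columns (a + c) a)\<^sup>T = (first_columns (b + d) b * A\<^sup>T)\<^sup>T"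
    using mat_sum_mult_first_columns[of "A\<^sup>T" b a "C\<^sup>T" d c] A C by simp
  thus ?thesis using A C
    by (simp add: transpose_mult_dim mat_sum_transpose first_columns_def)
qed

lemma first_columns_orthonormal:
  "(first_columns (a + c) a)\<^sup>T * first_columns (a + c) a = (1\<^sub>m a :: 'a::comm_semiring_1 mat)"
proof (rule eq_matI)
  fix i j assume "i < dim_row (1\<^sub>m a :: 'a mat)" "j < dim_col (1\<^sub>m a :: 'a mat)"
  hence ij: "i < a" "j < a" by auto
  have "((first_columns (a + c) a)\<^sup>T * first_columns (a + c) a) $$ (i, j) =
      (\<Sum>l<a + c. first_columns (a + c) a $$ (l, i) * (first_columns (a + c) a $$ (l, j) :: 'a))"
    using ij by (simp add: scalar_prod_def atLeast0LessThan first_columns_def)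
  also have "\<dots> = (\<Sum>l<a + c. if l = i then (if i = j then 1 else 0) else 0)"
    using ij by (intro sum.cong) (auto simp: first_columns_def)
  also have "\<dots> = 1\<^sub>m a $$ (i, j)" using ij by simp
  finally show "((first_columns (a + c) a)\<^sup>T * first_columns (a + c) a) $$ (i, j) = (1\<^sub>m a :: 'a mat) $$ (i, j)" .
qed (auto simp: first_columns_def)

text \<open>On a subspace invariant under the asymmetry, the asymmetry acts as the cosquare of the Gram
  matrix and preserves it.\<close>

lemma invariant_gram_isometric:
  fixes M Z L :: "'a::field mat"
  assumes M: "M \<in> carrier_mat n n" and Z: "Z \<in> carrier_mat n r" and L: "L \<in> carrier_mat r r"
    and inv: "M * Z = M\<^sup>T * Z * L"
  shows "Z\<^sup>T * M * Z = (Z\<^sup>T * M * Z)\<^sup>T * L" "L\<^sup>T * (Z\<^sup>T * M * Z) * L = Z\<^sup>T * M * Z"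
proof -
  have "Z\<^sup>T * M * Z = Z\<^sup>T * (M * Z)" using M Z by (simp add: assoc_mult_dim)
  also have "\<dots> = Z\<^sup>T * M\<^sup>T * Z * L" unfolding inv using M Z L by (simp add: assoc_mult_dim)
  also have "Z\<^sup>T * M\<^sup>T * Z = (Z\<^sup>T * M * Z)\<^sup>T" using M Z by (simp add: transpose_mult_dim assoc_mult_dim)
  finally show 1: "Z\<^sup>T * M * Z = (Z\<^sup>T * M * Z)\<^sup>T * L" .
  from arg_cong[OF this, of transpose_mat] have "(Z\<^sup>T * M * Z)\<^sup>T = L\<^sup>T * (Z\<^sup>T * M * Z)"
    using M Z L transpose_mult_dim[of "(Z\<^sup>T * M * Z)\<^sup>T" L] by simp
  with 1 show "L\<^sup>T * (Z\<^sup>T * M * Z) * L = Z\<^sup>T * M * Z" by simp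
qed

text \<open>The summand provides a Jordan chain \<open>X\<close> of the pencil and a dual chain \<open>Y\<close>. For odd \<open>r\<close> there is a
  form \<open>V\<close> with cosquare \<open>J\<^sub>r(1)\<close>, namely \<open>\<Gamma>\<^sub>r\<close> in a Jordan basis, and it turns the dual chain into a
  chain \<open>Z = Y * V\<close> of the same kind as \<open>X\<close>. The Gram matrices \<open>X\<^sup>T * M * Z\<close> and \<open>Z\<^sup>T * M * X\<close> are
  both equal to \<open>V\<close>, hence nonsingular. By polarisation, which uses \<open>2 \<noteq> 0\<close>, one of \<open>X\<close>, \<open>Z\<close> and
  \<open>X + Z\<close> has a nonsingular Gram matrix, and this one splits off.\<close>

lemma jordan_one_equivalence_summand_imp_congruence_summand:
  fixes M :: "'a::field mat"
  assumes M: "M \<in> carrier_mat n n" and r: "odd r" and two: "(2::'a) \<noteq> 0"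
    and summand: "equivalence_summand (1\<^sub>m r, lower_jordan_block r 1) (M\<^sup>T, M)"
  shows "\<exists>Q. has_jordan_cosquare r Q \<and> congruence_summand Q M"
proof -
  let ?L = "lower_jordan_block r (1::'a)" and ?I = "first_columns n r :: 'a mat"
  have MT: "M\<^sup>T \<in> carrier_mat n n" using M by simp
  obtain R S C D c d where R: "R \<in> carrier_mat n n" "det R \<noteq> 0" and S: "S \<in> carrier_mat n n" "det S \<noteq> 0"
    and CD: "C \<in> carrier_mat c d" "D \<in> carrier_mat c d" and n: "n = r + c" "n = r + d"
    and eq: "R * M\<^sup>T * S = mat_sum (1\<^sub>m r) C" "R * M * S = mat_sum ?L D"
    using equivalence_summandE[OF summand MT one_carrier_mat lower_jordan_block_carrier] .
  have I: "?I \<in> carrier_mat n r" by simp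
  define X where "X = S * ?I"
  define Y where "Y = R\<^sup>T * ?I"
  have XY: "X \<in> carrier_mat n r" "Y \<in> carrier_mat n r" unfolding X_def Y_def using R S by auto
  have "R * (M\<^sup>T * X) = R * M\<^sup>T * S * ?I" unfolding X_def using R S M I by (simp add: assoc_mult_dim)
  also have "\<dots> = ?I" unfolding eq(1) using mat_sum_mult_first_columns[OF one_carrier_mat CD(1), of r] n I by simp
  finally have RX1: "R * (M\<^sup>T * X) = ?I" .
  have "R * (M * X) = R * M * S * ?I" unfolding X_def using R S M I by (simp add: assoc_mult_dim)
  also have "\<dots> = ?I * ?L" unfolding eq(2) using mat_sum_mult_first_columns[OF lower_jordan_block_carrier CD(2), of r 1] n by simp
  also have "\<dots> = R * (M\<^sup>T * X) * ?L" unfolding RX1 ..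
  also have "\<dots> = R * (M\<^sup>T * X * ?L)" using R M XY by (simp add: assoc_mult_dim)
  finally have invX: "M * X = M\<^sup>T * X * ?L"
    by (rule mult_left_cancel_invertible[OF R, rotated 2]) (use M XY in auto)
  have "Y\<^sup>T * M\<^sup>T * S = ?I\<^sup>T * (R * M\<^sup>T * S)" unfolding Y_def using R S M I by (simp add: assoc_mult_dim transpose_mult_dim)
  also have "\<dots> = ?I\<^sup>T" unfolding eq(1)
    using first_columns_transpose_mult_mat_sum[OF one_carrier_mat CD(1), of r] n I by (simp add: first_columns_def)
  finally have RY1: "Y\<^sup>T * M\<^sup>T * S = ?I\<^sup>T" .
  have "Y\<^sup>T * M * S = ?I\<^sup>T * (R * M * S)" unfolding Y_def using R S M I by (simp add: assoc_mult_dim transpose_mult_dim)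
  also have "\<dots> = ?L * ?I\<^sup>T" unfolding eq(2)
    using first_columns_transpose_mult_mat_sum[OF lower_jordan_block_carrier CD(2), of r 1] n by simp
  also have "\<dots> = ?L * (Y\<^sup>T * M\<^sup>T) * S" unfolding RY1[symmetric] using S M XY by (simp add: assoc_mult_dim)
  finally have "Y\<^sup>T * M = ?L * (Y\<^sup>T * M\<^sup>T)"
    by (rule mult_right_cancel_invertible[OF S, rotated 2]) (use M XY in auto)
  from arg_cong[OF this, of transpose_mat] have invY: "M\<^sup>T * Y = M * (Y * ?L\<^sup>T)"
    using M XY by (simp add: transpose_mult_dim assoc_mult_dim)
  have "Y\<^sup>T * M\<^sup>T * X = ?I\<^sup>T * (R * (M\<^sup>T * X))"
    unfolding Y_def using R M I XY(1) by (simp add: assoc_mult_dim transpose_mult_dim)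
  also have "\<dots> = 1\<^sub>m r" unfolding RX1 using first_columns_orthonormal[of r c] n by simp
  finally have YX: "Y\<^sup>T * M\<^sup>T * X = 1\<^sub>m r" .
  from arg_cong[OF this, of transpose_mat] have XY1: "X\<^sup>T * (M * Y) = 1\<^sub>m r"
    using M XY by (simp add: transpose_mult_dim assoc_mult_dim)
  obtain B :: "'a mat" where B: "B \<in> carrier_mat r r" "det B \<noteq> 0"
    "Gamma_mat r * B = (Gamma_mat r)\<^sup>T * B * ?L" using Gamma_mat_jordan_basis[OF r two] .
  define V where "V = B\<^sup>T * Gamma_mat r * B"
  have V: "V \<in> carrier_mat r r" unfolding V_def using B by auto
  have VL: "V = V\<^sup>T * ?L" "?L\<^sup>T * V * ?L = V"
    unfolding V_def by (rule invariant_gram_isometric[OF Gamma_mat_carrier B(1) lower_jordan_block_carrier B(3)])+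
  have dV: "det V \<noteq> 0"
    unfolding V_def using B det_Gamma_mat[of r] det_transpose[OF B(1)]
      det_mult[of "B\<^sup>T * Gamma_mat r" r B] det_mult[of "B\<^sup>T" r "Gamma_mat r"] by auto
  define Z where "Z = Y * V"
  have Z: "Z \<in> carrier_mat n r" unfolding Z_def using XY V by auto
  have invZ: "M * Z = M\<^sup>T * Z * ?L"
  proof -
    have "M\<^sup>T * Z * ?L = M\<^sup>T * Y * (V * ?L)" unfolding Z_def using M XY V by (simp add: assoc_mult_dim)
    also have "\<dots> = M * (Y * (?L\<^sup>T * V * ?L))" unfolding invY using M XY V by (simp add: assoc_mult_dim)
    finally show ?thesis unfolding VL(2) Z_def ..
  qed
  have ZX: "Z\<^sup>T * M * X = V"
  proof -
    have "Z\<^sup>T * M * X = V\<^sup>T * (Y\<^sup>T * (M * X))" unfolding Z_def using M XY V by (simp add: transpose_mult_dim assoc_mult_dim)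
    also have "\<dots> = V\<^sup>T * (Y\<^sup>T * M\<^sup>T * X * ?L)" unfolding invX using M XY V by (simp add: assoc_mult_dim)
    finally show ?thesis unfolding YX using VL(1) by simp
  qed
  have XZ: "X\<^sup>T * M * Z = V"
  proof -
    have "X\<^sup>T * M * Z = X\<^sup>T * (M * Y) * V" unfolding Z_def using M XY V by (simp add: assoc_mult_dim)
    thus ?thesis unfolding XY1 using V by simp
  qed
  have r0: "r > 0" using r by (rule odd_pos)
  have crit: "det (U\<^sup>T * M * U) \<noteq> 0 \<longleftrightarrow> (U\<^sup>T * M * U) $$ (0, r - 1) \<noteq> 0"
    if "U \<in> carrier_mat n r" "M * U = M\<^sup>T * U * ?L" for U
    by (rule isometric_jordan_nonsingular_iff[OF _ invariant_gram_isometric(2)[OF M that(1) _ that(2)] r0])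
       (use M that in auto)
  have splits: ?thesis if U: "U \<in> carrier_mat n r" "M * U = M\<^sup>T * U * ?L" "det (U\<^sup>T * M * U) \<noteq> 0" for U
  proof (intro exI conjI)
    have Q: "U\<^sup>T * M * U \<in> carrier_mat r r" using U M by auto
    show "has_jordan_cosquare r (U\<^sup>T * M * U)"
      using invariant_gram_isometric(1)[OF M U(1) lower_jordan_block_carrier U(2)] Q U(1) M
      by (intro has_jordan_cosquareI[OF Q U(3) one_carrier_mat]) auto
    show "congruence_summand (U\<^sup>T * M * U) M"
      by (rule congruent_split_invariant[OF M U(1) lower_jordan_block_carrier U(2,3)])
  qed
  show ?thesis
  proof (cases "det (X\<^sup>T * M * X) \<noteq> 0 \<or> det (Z\<^sup>T * M * Z) \<noteq> 0")
    case True
    thus ?thesis using splits[OF XY(1) invX] splits[OF Z invZ] by auto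
  next
    case False
    define U where "U = X + Z"
    have U: "U \<in> carrier_mat n r" unfolding U_def using XY Z by auto
    have invU: "M * U = M\<^sup>T * U * ?L" unfolding U_def using M XY Z invX invZ
      by (simp add: mult_add_dim add_mult_dim)
    have "U\<^sup>T * M * U = X\<^sup>T * M * X + V + (V + Z\<^sup>T * M * Z)"
    proof -
      have "U\<^sup>T * M * U = X\<^sup>T * M * X + Z\<^sup>T * M * X + (X\<^sup>T * M * Z + Z\<^sup>T * M * Z)"
        unfolding U_def using M XY Z by (simp add: transpose_add_dim mult_add_dim add_mult_dim)
      thus ?thesis unfolding ZX XZ .
    qed
    hence "(U\<^sup>T * M * U) $$ (0, r - 1) = (X\<^sup>T * M * X) $$ (0, r - 1) + V $$ (0, r - 1)
        + (V $$ (0, r - 1) + (Z\<^sup>T * M * Z) $$ (0, r - 1))"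
      using XY Z V M r0 by (simp del: index_mult_mat(1))
    also have "\<dots> = 2 * V $$ (0, r - 1)"
      using False crit[OF XY(1) invX] crit[OF Z invZ] by simp
    also have "\<dots> \<noteq> 0" using isometric_jordan_nonsingular_iff[OF V VL(2) r0] dV two by simp
    finally have "det (U\<^sup>T * M * U) \<noteq> 0" using crit[OF U invU] by simp
    from splits[OF U invU this] show ?thesis .
  qed
qed

lemma jordan_cosquare_congruence_summand_imp_equivalence_summand:
  fixes M :: "'a::field mat"
  assumes M: "M \<in> carrier_mat n n" and Q: "has_jordan_cosquare r Q" and summand: "congruence_summand Q M"
  shows "equivalence_summand (1\<^sub>m r, lower_jordan_block r 1) (M\<^sup>T, M)"
proof -
  let ?L = "lower_jordan_block r (1::'a)"
  note Qc = has_jordan_cosquare_carrier[OF Q]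
  obtain P where P: "P \<in> carrier_mat r r" "det P \<noteq> 0" "Q * P = Q\<^sup>T * P * ?L" using has_jordan_cosquareE[OF Q] .
  obtain S B a b where S: "S \<in> carrier_mat n n" "det S \<noteq> 0" and eq: "S\<^sup>T * M * S = mat_sum Q B"
    and B: "Q \<in> carrier_mat a a" "B \<in> carrier_mat b b" and n: "n = a + b" using congruence_summandE[OF summand M] .
  have a: "a = r" using B(1) Qc by auto
  note n = n[unfolded a]
  have eqT: "S\<^sup>T * M\<^sup>T * S = mat_sum (Q\<^sup>T) (B\<^sup>T)"
    using arg_cong[OF eq, of transpose_mat] S M by (simp add: transpose_mult_dim assoc_mult_dim mat_sum_transpose)
  have QP: "Q\<^sup>T * P \<in> carrier_mat r r" "det (Q\<^sup>T * P) \<noteq> 0"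
    using Qc P det_mult[of "Q\<^sup>T" r P] det_transpose[OF Qc(1)] by auto
  obtain T where T: "T \<in> carrier_mat r r" "T * (Q\<^sup>T * P) = 1\<^sub>m r" "det T \<noteq> 0" using obtain_inverse[OF QP] by metis
  define E where "E = mat_sum T (1\<^sub>m b)"
  define F where "F = mat_sum P (1\<^sub>m b)"
  have EF: "E \<in> carrier_mat n n" "F \<in> carrier_mat n n" "det E \<noteq> 0" "det F \<noteq> 0"
    unfolding E_def F_def n using T P by (auto simp: det_mat_sum[of _ r _ b])
  have g: "E * S\<^sup>T * N * (S * F) = E * (S\<^sup>T * N * S) * F" if "N \<in> carrier_mat n n" for N
    using EF S that by (simp add: assoc_mult_dim)
  have MT: "M\<^sup>T \<in> carrier_mat n n" using M by simp
  show ?thesis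
  proof (rule equivalence_summandI[OF MT M, of "E * S\<^sup>T" "S * F" "1\<^sub>m r" r r ?L "B\<^sup>T" b b B])
    show "det (E * S\<^sup>T) \<noteq> 0" using det_mult[of E n "S\<^sup>T"] EF S det_transpose[OF S(1)] by simp
    show "det (S * F) \<noteq> 0" using det_mult[of S n F] EF S by simp
    have "E * mat_sum (Q\<^sup>T) (B\<^sup>T) * F = mat_sum (T * (Q\<^sup>T * P)) (B\<^sup>T)"
      unfolding E_def F_def using T P Qc B by (simp add: mat_sum_mult assoc_mult_dim)
    thus "E * S\<^sup>T * M\<^sup>T * (S * F) = mat_sum (1\<^sub>m r) (B\<^sup>T)" unfolding g[OF MT] eqT T(2) .
    have "E * mat_sum Q B * F = mat_sum (T * (Q * P)) B"
      unfolding E_def F_def using T P Qc B by (simp add: mat_sum_mult assoc_mult_dim)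
    also have "T * (Q * P) = T * (Q\<^sup>T * P) * ?L" unfolding P(3) using T(1) P(1) Qc by (simp add: assoc_mult_dim)
    finally have "E * mat_sum Q B * F = mat_sum ?L B" unfolding T(2) by simp
    thus "E * S\<^sup>T * M * (S * F) = mat_sum ?L B" unfolding g[OF M] eq .
  qed (use EF S B in auto)
qed

text \<open>Multiplication by the inverse of \<open>K\<^sup>T\<close> turns \<open>(K\<^sup>T, K)\<close> into \<open>(1, cosquare K)\<close>, and equivalences
  between pairs with first matrix \<open>1\<close> are similarities.\<close>

lemma similarity_summand_cosquare_iff:
  fixes K A :: "'a::field mat"
  assumes K: "K \<in> carrier_mat n n" "det K \<noteq> 0" and A: "A \<in> carrier_mat r r"
  shows "similarity_summand A (cosquare K) \<longleftrightarrow> equivalence_summand (1\<^sub>m r, A) (K\<^sup>T, K)"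
proof
  let ?c = "cosquare K"
  have c: "?c \<in> carrier_mat n n" by (rule cosquare_carrier[OF K])
  have KT: "K\<^sup>T \<in> carrier_mat n n" "det (K\<^sup>T) \<noteq> 0" using K det_transpose[OF K(1)] by auto
  {
    assume "similarity_summand A ?c"
    then obtain B where B: "square_mat B" "similar_mat ?c (mat_sum A B)" unfolding similarity_summand_def by auto
    obtain P where P: "mat_sum A B \<in> carrier_mat n n" "P \<in> carrier_mat n n" "det P \<noteq> 0" "?c * P = P * mat_sum A B"
      using similar_matE[OF B(2) c] .
    define b where "b = dim_row B"
    have Bb: "B \<in> carrier_mat b b" using B(1) unfolding b_def by (auto intro: carrier_matI)
    have n: "n = r + b" using carrier_matD(1)[OF P(1)] A Bb by simp
    have KP: "K\<^sup>T * P \<in> carrier_mat n n" "det (K\<^sup>T * P) \<noteq> 0" using KT P det_mult[OF KT(1) P(2)] by auto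
    obtain R where R: "R \<in> carrier_mat n n" "R * (K\<^sup>T * P) = 1\<^sub>m n" "det R \<noteq> 0" using obtain_inverse[OF KP] by metis
    show "equivalence_summand (1\<^sub>m r, A) (K\<^sup>T, K)"
    proof (rule equivalence_summandI[OF KT(1) K(1) R(1,3) P(2,3) _ A _ Bb])
      show "R * K\<^sup>T * P = mat_sum (1\<^sub>m r) (1\<^sub>m b)" using R KT P(2) n by (simp add: assoc_mult_dim mat_sum_one)
      have "R * K * P = R * (K\<^sup>T * ?c) * P" unfolding transpose_mult_cosquare[OF K] ..
      also have "\<dots> = R * (K\<^sup>T * (?c * P))" using R(1) KT P(2) c by (simp add: assoc_mult_dim)
      also have "\<dots> = R * (K\<^sup>T * P) * mat_sum A B"
        unfolding P(4) using R(1) KT P(2) A Bb n by (simp add: assoc_mult_dim)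
      finally show "R * K * P = mat_sum A B" unfolding R(2) left_mult_one_mat[OF P(1)] .
    qed auto
  next
    assume e: "equivalence_summand (1\<^sub>m r, A) (K\<^sup>T, K)"
    obtain R S C D s t where R: "R \<in> carrier_mat n n" "det R \<noteq> 0" and S: "S \<in> carrier_mat n n" "det S \<noteq> 0"
      and CD: "C \<in> carrier_mat s t" "D \<in> carrier_mat s t" and n: "n = r + s" "n = r + t"
      and eq: "R * K\<^sup>T * S = mat_sum (1\<^sub>m r) C" "R * K * S = mat_sum A D"
      using equivalence_summandE[OF e KT(1) one_carrier_mat A] .
    have t: "t = s" using n by simp
    note CD = CD[unfolded t]
    have RK: "R * K\<^sup>T \<in> carrier_mat n n" "det (R * K\<^sup>T) \<noteq> 0" using R KT det_mult[OF R(1) KT(1)] by auto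
    have "det (mat_sum (1\<^sub>m r) C) \<noteq> 0" unfolding eq(1)[symmetric] using det_mult[OF RK(1) S(1)] RK S by simp
    hence "det C \<noteq> 0" using det_mat_sum[OF one_carrier_mat CD(1), of r] by auto
    from obtain_inverse[OF CD(1) this] obtain I where I: "I \<in> carrier_mat s s" "C * I = 1\<^sub>m s" by metis
    define B where "B = mat_sum A (I * D)"
    have B: "B \<in> carrier_mat n n" unfolding B_def n(1) using A I CD by auto
    have "R * K\<^sup>T * (?c * S) = R * (K\<^sup>T * ?c) * S" using R(1) KT S c by (simp add: assoc_mult_dim)
    also have "\<dots> = mat_sum A D" unfolding transpose_mult_cosquare[OF K] eq(2) ..
    also have "\<dots> = mat_sum (1\<^sub>m r) C * B" unfolding B_def using A CD I
      by (simp add: mat_sum_mult mult_eq_assoc[OF I(2)])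
    also have "\<dots> = R * K\<^sup>T * (S * B)" unfolding eq(1)[symmetric] using R(1) KT S B by (simp add: assoc_mult_dim)
    finally have "?c * S = S * B"
      by (rule mult_left_cancel_invertible[OF RK, rotated 2]) (use c S B in auto)
    from similar_matI[OF c B S this] show "similarity_summand A ?c"
      unfolding similarity_summand_def B_def using A I CD by (intro conjI exI[of _ "I * D"]) auto
  }
qed

lemma similar_mat_sum_swap:
  fixes A B :: "'a::field mat"
  assumes A: "A \<in> carrier_mat a a" and B: "B \<in> carrier_mat b b"
  shows "similar_mat (mat_sum A B) (mat_sum B A)"
proof -
  let ?P = "four_block_mat (0\<^sub>m a b) (1\<^sub>m a) (1\<^sub>m b) (0\<^sub>m b a) :: 'a mat"
  let ?Q = "four_block_mat (0\<^sub>m b a) (1\<^sub>m b) (1\<^sub>m a) (0\<^sub>m a b) :: 'a mat"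
  have P: "?P \<in> carrier_mat (a + b) (a + b)" and Q: "?Q \<in> carrier_mat (a + b) (a + b)"
    by (auto simp: add.commute intro!: carrier_matI)
  have "?P * ?Q = 1\<^sub>m (a + b)"
    by (simp add: mult_four_block_mat[of _ a b _ a _ b _ _ a _ b])
  hence dP: "det ?P \<noteq> 0" by (rule det_nonzero_if_right_inverse[OF P Q])
  have "mat_sum A B * ?P = four_block_mat (0\<^sub>m a b) A B (0\<^sub>m b a)"
    unfolding mat_sum_def using A B by (simp add: mult_four_block_mat[of _ a a _ b _ b _ _ b _ a])
  moreover have "?P * mat_sum B A = four_block_mat (0\<^sub>m a b) A B (0\<^sub>m b a)"
    unfolding mat_sum_def using A B by (simp add: mult_four_block_mat[of _ a b _ a _ b _ _ b _ a])
  ultimately have "mat_sum A B * ?P = ?P * mat_sum B A" by simp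
  moreover have "mat_sum B A \<in> carrier_mat (a + b) (a + b)" using mat_sum_carrier[OF B A] by (simp add: add.commute)
  ultimately show ?thesis using similar_matI[of "mat_sum A B" "a + b" "mat_sum B A" ?P] A B P dP by simp
qed

lemma similar_mat_sum:
  fixes A B :: "'a::field mat"
  assumes "similar_mat A A'" "A \<in> carrier_mat a a" "B \<in> carrier_mat b b"
  shows "similar_mat (mat_sum A B) (mat_sum A' B)"
proof -
  have "A' \<in> carrier_mat a a" using similar_matE[OF assms(1,2)] by metis
  thus ?thesis unfolding mat_sum_def
    using similar_mat_four_block_0_0[OF assms(1) similar_mat_refl[OF assms(3)] assms(2,3)] assms(2,3) by simp
qed

text \<open>Reversing the order of the basis.\<close>

lemma similar_jordan_block_lower: "similar_mat (jordan_block r (a::'a::field)) (lower_jordan_block r a)"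
proof -
  define P where "P = mat r r (\<lambda>(i, j). if i + j + 1 = r then 1 else 0 :: 'a)"
  have P: "P \<in> carrier_mat r r" unfolding P_def by simp
  have dP: "det P \<noteq> 0" by (rule det_antitriangular[OF P]) (auto simp: P_def)
  have "jordan_block r a * P = P * lower_jordan_block r a"
  proof (rule eq_matI)
    fix i j assume "i < dim_row (P * lower_jordan_block r a)" "j < dim_col (P * lower_jordan_block r a)"
    hence ij: "i < r" "j < r" using P by auto
    have "(jordan_block r a * P) $$ (i, j) = (\<Sum>l<r. jordan_block r a $$ (i, l) * P $$ (l, j))"
      by (rule mult_mat_index_sum) (use P ij in auto)
    also have "\<dots> = (\<Sum>l<r. if l = r - 1 - j then jordan_block r a $$ (i, r - 1 - j) else 0)"
      using ij by (intro sum.cong) (auto simp: P_def)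
    also have "\<dots> = jordan_block r a $$ (i, r - 1 - j)" using ij by simp
    also have "\<dots> = lower_jordan_block r a $$ (r - 1 - i, j)"
      using ij by (auto simp: lower_jordan_block_index)
    also have "\<dots> = (\<Sum>l<r. if l = r - 1 - i then lower_jordan_block r a $$ (r - 1 - i, j) else 0)"
      using ij by simp
    also have "\<dots> = (\<Sum>l<r. P $$ (i, l) * lower_jordan_block r a $$ (l, j))"
      using ij by (intro sum.cong) (auto simp: P_def)
    also have "\<dots> = (P * lower_jordan_block r a) $$ (i, j)"
      by (rule mult_mat_index_sum[symmetric]) (use P ij in auto)
    finally show "(jordan_block r a * P) $$ (i, j) = (P * lower_jordan_block r a) $$ (i, j)" .
  qed (use P in auto)
  from similar_matI[OF jordan_block_carrier lower_jordan_block_carrier P dP this] show ?thesis .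
qed

text \<open>The sizes of the Jordan blocks add up to an odd number, so one of them is odd.\<close>

lemma upper_unitriangular_odd_jordan_summand:
  fixes L :: "'a::field mat"
  assumes L: "L \<in> carrier_mat k k" "upper_unitriangular L" and k: "odd k"
  obtains r where "odd r" "similarity_summand (lower_jordan_block r 1) L"
proof -
  have ut: "upper_triangular L" using L unfolding upper_unitriangular_def by simp
  obtain n_as where jnf: "jordan_nf L n_as" using triangular_to_jnf_vector[OF L(1) ut] by auto
  hence n0: "0 \<notin> fst ` set n_as" and sim: "similar_mat L (jordan_matrix n_as)" unfolding jordan_nf_def by auto
  have "jordan_matrix n_as \<in> carrier_mat k k" using similar_matE[OF sim L(1)] by metis
  hence sum: "sum_list (map fst n_as) = k" using carrier_matD(1) by fastforce
  have "\<exists>na\<in>set n_as. odd (fst na)"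
  proof (rule ccontr)
    assume "\<not> ?thesis"
    hence "even (sum_list (map fst n_as))" by (induction n_as) auto
    thus False using sum k by simp
  qed
  then obtain r a where ra: "(r, a) \<in> set n_as" "odd r" by auto
  have "diag_mat L = replicate k 1"
    using L by (intro nth_equalityI) (auto simp: diag_mat_def upper_unitriangular_def)
  hence "char_poly L = [:-1, 1:] ^ k" using char_poly_upper_triangular[OF L(1) ut] by simp
  moreover have "char_poly L = (\<Prod>(n, a)\<leftarrow>n_as. [:- a, 1:] ^ n)"
    using char_poly_similar[OF sim] by (simp add: jordan_matrix_char_poly)
  moreover have "poly (\<Prod>(n, a)\<leftarrow>n_as. [:- a, 1:] ^ n) a = 0"
    using ra odd_pos[OF ra(2)] by (auto simp: poly_prod_list prod_list_zero_iff image_iff intro!: bexI[of _ "(r, a)"])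
  ultimately have "poly ([:-1, 1:] ^ k) a = 0" by simp
  hence a: "a = 1" by simp
  obtain xs ys where n_as: "n_as = xs @ (r, a) # ys" using split_list[OF ra(1)] by auto
  have app: "jordan_matrix (us @ vs) = mat_sum (jordan_matrix us) (jordan_matrix vs)" for us vs :: "(nat \<times> 'a) list"
    unfolding jordan_matrix_def map_append diag_block_mat_append mat_sum_def Let_def ..
  have cons: "jordan_matrix ((r, a) # ys) = mat_sum (jordan_block r 1) (jordan_matrix ys)"
    unfolding a jordan_matrix_Cons mat_sum_def by simp
  define s where "s = sum_list (map fst xs)"
  define t where "t = sum_list (map fst ys)"
  let ?J = "jordan_block r (1::'a)"
  have c: "jordan_matrix xs \<in> carrier_mat s s" "jordan_matrix ys \<in> carrier_mat t t" unfolding s_def t_def by simp_all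
  let ?R = "mat_sum (jordan_matrix ys) (jordan_matrix xs)"
  have R: "?R \<in> carrier_mat (t + s) (t + s)" using c by simp
  have "similar_mat (jordan_matrix n_as) (mat_sum (mat_sum ?J (jordan_matrix ys)) (jordan_matrix xs))"
    unfolding n_as app cons by (rule similar_mat_sum_swap[OF c(1), of _ "r + t"]) (use c in simp)
  also have "mat_sum (mat_sum ?J (jordan_matrix ys)) (jordan_matrix xs) = mat_sum ?J ?R"
    by (simp add: mat_sum_assoc)
  finally have "similar_mat L (mat_sum ?J ?R)" using similar_mat_trans[OF sim] by blast
  moreover have "similar_mat (mat_sum ?J ?R) (mat_sum (lower_jordan_block r 1) ?R)"
    by (rule similar_mat_sum[OF similar_jordan_block_lower jordan_block_carrier R])
  ultimately have "similar_mat L (mat_sum (lower_jordan_block r 1) ?R)" by (rule similar_mat_trans)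
  hence "similarity_summand (lower_jordan_block r 1) L"
    unfolding similarity_summand_def using R by (intro conjI exI[of _ ?R]) auto
  thus ?thesis using that ra by auto
qed

section \<open>Regular forms\<close>

text \<open>The part with nonsingular skew-symmetric part has even size, so the part with unipotent cosquare
  has odd size, and its cosquare has a Jordan block of odd size.\<close>

lemma odd_regular_has_jordan_summand:
  fixes M :: "'a::field mat"
  assumes M: "M \<in> carrier_mat n n" and reg: "det (pencil (M\<^sup>T) M) \<noteq> 0" and n: "odd n" and two: "(2::'a) \<noteq> 0"
  shows "\<exists>r Q. odd r \<and> has_jordan_cosquare r Q \<and> congruence_summand Q M"
proof -
  obtain k m K W L where km: "n = k + m" and KW: "K \<in> carrier_mat k k" "W \<in> carrier_mat m m"
    and cong: "congruent_mat M (mat_sum K W)" and K: "det K \<noteq> 0" and L: "L \<in> carrier_mat k k" "upper_unitriangular L"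
    and KL: "K = K\<^sup>T * L" and W: "det (W - W\<^sup>T) \<noteq> 0" using regular_splits_unipotent[OF M reg] .
  have "odd k" using even_dim_if_alternating_part_nonsingular[OF KW(2) W two] n km by simp
  then obtain r where r: "odd r" "similarity_summand (lower_jordan_block r 1) L"
    using upper_unitriangular_odd_jordan_summand[OF L] by metis
  have "cosquare K = L" using cosquare_eq_iff[OF KW(1) K L(1)] KL by simp
  hence "equivalence_summand (1\<^sub>m r, lower_jordan_block r 1) (K\<^sup>T, K)"
    using r(2) similarity_summand_cosquare_iff[OF KW(1) K lower_jordan_block_carrier] by simp
  from jordan_one_equivalence_summand_imp_congruence_summand[OF KW(1) r(1) two this]
  obtain Q where Q: "has_jordan_cosquare r Q" "congruence_summand Q K" by auto
  have "congruence_summand Q M" by (rule congruence_summand_trans[OF Q(2) cong]) (use KW in auto)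
  thus ?thesis using r Q by auto
qed

lemma regular_nonunimodular_has_jordan_summand:
  fixes M S :: "'a::field mat"
  assumes M: "M \<in> carrier_mat n n" and reg: "det (pencil (M\<^sup>T) M) \<noteq> 0" and two: "(2::'a) \<noteq> 0"
    and S: "S \<in> carrier_mat n n" "det S \<noteq> 0" "S\<^sup>T * M * S = M" "det S \<noteq> 1"
  shows "\<exists>r Q. odd r \<and> has_jordan_cosquare r Q \<and> congruence_summand Q M"
proof -
  obtain k m K W where KW: "K \<in> carrier_mat k k" "W \<in> carrier_mat m m" "congruent_mat M (mat_sum K W)"
    "det (pencil (K\<^sup>T) K) \<noteq> 0" "det S = (-1) ^ k"
    using isometry_splits_off_odd_summand[OF M reg S(1-3)] .
  have "odd k"
  proof
    assume "even k"
    thus False using KW(5) S(4) by simp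
  qed
  from odd_regular_has_jordan_summand[OF KW(1,4) this two] obtain r Q where
    Q: "odd r" "has_jordan_cosquare r Q" "congruence_summand Q K" by auto
  have "congruence_summand Q M" by (rule congruence_summand_trans[OF Q(3) KW(3)]) (use KW in auto)
  thus ?thesis using Q by auto
qed

text \<open>The isometry that is \<open>-1\<close> on the summand and \<open>1\<close> on its complement has determinant \<open>-1\<close>.\<close>

lemma odd_summand_imp_not_Xi:
  fixes M A :: "'a::field mat"
  assumes M: "M \<in> carrier_mat n n" and A: "A \<in> carrier_mat r r" and r: "odd r" and two: "(2::'a) \<noteq> 0"
    and summand: "congruence_summand A M"
  shows "M \<notin> Xi n"
proof -
  obtain S B a b where S: "S \<in> carrier_mat n n" "det S \<noteq> 0" and eq: "S\<^sup>T * M * S = mat_sum A B"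
    and B: "A \<in> carrier_mat a a" "B \<in> carrier_mat b b" and n: "n = a + b" using congruence_summandE[OF summand M] .
  have a: "a = r" using B(1) A by auto
  note n = n[unfolded a]
  obtain I where I: "I \<in> carrier_mat n n" "S * I = 1\<^sub>m n" "I * S = 1\<^sub>m n" "det I \<noteq> 0" using obtain_inverse[OF S] .
  define D where "D = mat_sum (- 1\<^sub>m r) (1\<^sub>m b :: 'a mat)"
  have D: "D \<in> carrier_mat n n" unfolding D_def n by simp
  have IS: "I\<^sup>T * S\<^sup>T = 1\<^sub>m n" using I S transpose_mult_dim[of S I] by simp
  have "D\<^sup>T * mat_sum A B * D = mat_sum A B"
    unfolding D_def mat_sum_transpose using A B by (simp add: mat_sum_mult transpose_uminus)
  hence dd: "D\<^sup>T * (S\<^sup>T * M * S) * D = S\<^sup>T * M * S" unfolding eq .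
  define T where "T = S * D * I"
  have T: "T \<in> carrier_mat n n" unfolding T_def using S D I by auto
  have "T\<^sup>T * M * T = I\<^sup>T * (D\<^sup>T * (S\<^sup>T * M * S) * D) * I"
    unfolding T_def using S D I(1) M by (simp add: transpose_mult_dim assoc_mult_dim)
  also have "\<dots> = I\<^sup>T * S\<^sup>T * M * (S * I)" unfolding dd using S I(1) M by (simp add: assoc_mult_dim)
  finally have iso: "T\<^sup>T * M * T = M" unfolding IS I(2) using M by simp
  have "det (- 1\<^sub>m r :: 'a mat) = -1"
  proof -
    have "- 1\<^sub>m r = (-1) \<cdot>\<^sub>m (1\<^sub>m r :: 'a mat)" by (rule eq_matI) auto
    thus ?thesis using r by simp
  qed
  hence "det D = -1" unfolding D_def using det_mat_sum[of "- 1\<^sub>m r :: 'a mat" r "1\<^sub>m b" b] by simp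
  moreover have "det S * det I = 1" using det_mult[OF S(1) I(1)] I(2) by simp
  moreover have "det T = det S * det D * det I"
    unfolding T_def using det_mult[of "S * D" n I] det_mult[of S n D] S D I by simp
  ultimately have dT: "det T = -1" by simp
  have "(-1 :: 'a) \<noteq> 1" using two by (metis add.right_inverse one_add_one)
  thus ?thesis unfolding Xi_def using T iso dT invertible_mat_iff_det[OF T] by auto
qed

section \<open>Singular pencils and their chains\<close>

text \<open>The vector \<open>\<Sum>j<t. \<lambda> ^ j * x j\<close> over the polynomials lies in the kernel of \<open>M - \<lambda> * M\<^sup>T\<close>.
  The sequence continues with zeros, so that the last equation \<open>M\<^sup>T *\<^sub>v x (t - 1) = 0\<close> is an instance of
  the general one.\<close>

definition singular_chain :: "'a::field mat \<Rightarrow> nat \<Rightarrow> (nat \<Rightarrow> 'a vec) \<Rightarrow> bool" where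
  "singular_chain M t x \<longleftrightarrow> (\<forall>j. x j \<in> carrier_vec (dim_row M)) \<and>
     M *\<^sub>v x 0 = 0\<^sub>v (dim_row M) \<and> (\<forall>j. M *\<^sub>v x (Suc j) = M\<^sup>T *\<^sub>v x j) \<and>
     (\<forall>j\<ge>t. x j = 0\<^sub>v (dim_row M)) \<and> (\<exists>j. x j \<noteq> 0\<^sub>v (dim_row M))"

lemma mult_mat_vec_index_sum:
  assumes "A \<in> carrier_mat n r" "v \<in> carrier_vec r" "i < n"
  shows "(A *\<^sub>v v) $ i = (\<Sum>l<r. A $$ (i, l) * v $ l)"
  using assms by (simp add: scalar_prod_def atLeast0LessThan)

text \<open>The coefficients of a polynomial vector in the kernel of the pencil form a chain.\<close>

lemma singular_pencil_has_chain:
  fixes M :: "'a::field mat"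
  assumes M: "M \<in> carrier_mat n n" and sing: "det (pencil (M\<^sup>T) M) = 0"
  obtains t x where "singular_chain M t x"
proof -
  have MT: "M\<^sup>T \<in> carrier_mat n n" using M by simp
  have P: "pencil (M\<^sup>T) M \<in> carrier_mat n n" using M by simp
  obtain v where v: "v \<in> carrier_vec n" "v \<noteq> 0\<^sub>v n" "pencil (M\<^sup>T) M *\<^sub>v v = 0\<^sub>v n"
    using sing[unfolded det_0_iff_vec_prod_zero[OF P]] by auto
  define x where "x j = vec n (\<lambda>i. coeff (v $ i) j)" for j
  have x: "x j \<in> carrier_vec n" for j unfolding x_def by simp
  have row: "(\<Sum>l<n. Polynomial.smult (M $$ (i, l)) (v $ l)) + pCons 0 (\<Sum>l<n. Polynomial.smult (- M\<^sup>T $$ (i, l)) (v $ l)) = 0"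
    if i: "i < n" for i
  proof -
    have "0 = (pencil (M\<^sup>T) M *\<^sub>v v) $ i" using v(3) i by simp
    also have "\<dots> = (\<Sum>l<n. pencil (M\<^sup>T) M $$ (i, l) * v $ l)" by (rule mult_mat_vec_index_sum[OF P v(1) i])
    also have "\<dots> = (\<Sum>l<n. Polynomial.smult (M $$ (i, l)) (v $ l) + pCons 0 (Polynomial.smult (- M\<^sup>T $$ (i, l)) (v $ l)))"
      using i pencil_index[OF MT M i] by (intro sum.cong) (auto simp del: index_transpose_mat(1))
    finally show ?thesis by (simp add: sum.distrib sum_pCons_0_commute)
  qed
  have "singular_chain M (Suc (\<Sum>i<n. degree (v $ i))) x"
    unfolding singular_chain_def carrier_matD(1)[OF M]
  proof (intro conjI allI impI)
    show "M *\<^sub>v x 0 = 0\<^sub>v n"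
    proof (rule eq_vecI)
      fix i assume "i < dim_vec (0\<^sub>v n :: 'a vec)"
      hence i: "i < n" by simp
      from arg_cong[OF row[OF i], of "\<lambda>p. coeff p 0"]
      show "(M *\<^sub>v x 0) $ i = 0\<^sub>v n $ i"
        using i mult_mat_vec_index_sum[OF M x i, of 0] by (simp add: coeff_sum x_def)
    qed (use M in auto)
    show "M *\<^sub>v x (Suc j) = M\<^sup>T *\<^sub>v x j" for j
    proof (rule eq_vecI)
      fix i assume "i < dim_vec (M\<^sup>T *\<^sub>v x j)"
      hence i: "i < n" using M by simp
      from arg_cong[OF row[OF i], of "\<lambda>p. coeff p (Suc j)"]
      show "(M *\<^sub>v x (Suc j)) $ i = (M\<^sup>T *\<^sub>v x j) $ i"
        using i mult_mat_vec_index_sum[OF M x i, of "Suc j"] mult_mat_vec_index_sum[OF MT x i, of j]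
        by (simp add: coeff_sum x_def sum_negf del: index_transpose_mat(1) index_mult_mat_vec)
    qed (use M in auto)
    show "x j = 0\<^sub>v n" if "Suc (\<Sum>i<n. degree (v $ i)) \<le> j" for j
    proof (rule eq_vecI)
      fix i assume "i < dim_vec (0\<^sub>v n :: 'a vec)"
      hence i: "i < n" by simp
      have "degree (v $ i) \<le> (\<Sum>i<n. degree (v $ i))" using i by (intro member_le_sum) auto
      hence "degree (v $ i) < j" using that by simp
      thus "x j $ i = 0\<^sub>v n $ i" using i unfolding x_def by (simp add: coeff_eq_0)
    qed (simp add: x_def)
    show "\<exists>j. x j \<noteq> 0\<^sub>v n"
    proof (rule ccontr)
      assume "\<not> ?thesis"
      hence z: "x j = 0\<^sub>v n" for j by auto
      have "v = 0\<^sub>v n"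
      proof (rule eq_vecI)
        fix i assume "i < dim_vec (0\<^sub>v n :: 'a poly vec)"
        hence i: "i < n" by simp
        have "coeff (v $ i) j = 0" for j using arg_cong[OF z[of j], of "\<lambda>w. w $ i"] i unfolding x_def by simp
        thus "v $ i = 0\<^sub>v n $ i" using i by (simp add: poly_eq_iff)
      qed (use v in auto)
      thus False using v(2) by simp
    qed
  qed (rule x)
  thus ?thesis by (rule that)
qed

lemma F_mat_carrier [simp]: "F_mat t \<in> carrier_mat (t - 1) t" unfolding F_mat_def by simp
lemma G_mat_carrier [simp]: "G_mat t \<in> carrier_mat (t - 1) t" unfolding G_mat_def by simp
lemma F_mat_dim [simp]: "dim_row (F_mat t) = t - 1" "dim_col (F_mat t) = t" unfolding F_mat_def by simp_all
lemma G_mat_dim [simp]: "dim_row (G_mat t) = t - 1" "dim_col (G_mat t) = t" unfolding G_mat_def by simp_all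

lemma mult_F_mat:
  fixes A :: "'a::comm_semiring_1 mat"
  assumes A: "A \<in> carrier_mat n (t - 1)" and ij: "i < n" "j < t"
  shows "(A * F_mat t) $$ (i, j) = (if j < t - 1 then A $$ (i, j) else 0)"
proof -
  have "(A * F_mat t) $$ (i, j) = (\<Sum>l<t-1. A $$ (i, l) * F_mat t $$ (l, j))"
    by (rule mult_mat_index_sum[OF A F_mat_carrier ij])
  also have "\<dots> = (\<Sum>l<t-1. if l = j then A $$ (i, j) else 0)"
    using ij by (intro sum.cong) (auto simp: F_mat_def)
  finally show ?thesis by simp
qed

lemma mult_G_mat:
  fixes A :: "'a::comm_semiring_1 mat"
  assumes A: "A \<in> carrier_mat n (t - 1)" and ij: "i < n" "j < t"
  shows "(A * G_mat t) $$ (i, j) = (if j = 0 then 0 else A $$ (i, j - 1))"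
proof -
  have "(A * G_mat t) $$ (i, j) = (\<Sum>l<t-1. A $$ (i, l) * G_mat t $$ (l, j))"
    by (rule mult_mat_index_sum[OF A G_mat_carrier ij])
  also have "\<dots> = (\<Sum>l<t-1. if l = j - 1 then (if j = 0 then 0 else A $$ (i, j - 1)) else 0)"
    using ij by (intro sum.cong) (auto simp: G_mat_def)
  finally show ?thesis using ij by auto
qed

lemma F_mat_mult:
  fixes A :: "'a::comm_semiring_1 mat"
  assumes A: "A \<in> carrier_mat t n" and ij: "i < t - 1" "j < n"
  shows "(F_mat t * A) $$ (i, j) = A $$ (i, j)"
proof -
  have "(F_mat t * A) $$ (i, j) = (\<Sum>l<t. F_mat t $$ (i, l) * A $$ (l, j))"
    by (rule mult_mat_index_sum[OF F_mat_carrier A ij])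
  also have "\<dots> = (\<Sum>l<t. if l = i then A $$ (i, j) else 0)"
    using ij by (intro sum.cong) (auto simp: F_mat_def)
  finally show ?thesis using ij by simp
qed

lemma G_mat_mult:
  fixes A :: "'a::comm_semiring_1 mat"
  assumes A: "A \<in> carrier_mat t n" and ij: "i < t - 1" "j < n"
  shows "(G_mat t * A) $$ (i, j) = A $$ (Suc i, j)"
proof -
  have "(G_mat t * A) $$ (i, j) = (\<Sum>l<t. G_mat t $$ (i, l) * A $$ (l, j))"
    by (rule mult_mat_index_sum[OF G_mat_carrier A ij])
  also have "\<dots> = (\<Sum>l<t. if l = Suc i then A $$ (Suc i, j) else 0)"
    using ij by (intro sum.cong) (auto simp: G_mat_def)
  finally show ?thesis using ij by simp
qed

text \<open>The equations say that \<open>X\<close> and \<open>W\<close> form a morphism from \<open>(F\<^sub>t, G\<^sub>t)\<close> to \<open>(M\<^sup>T, M)\<close>; the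
  unit vectors, a chain of \<open>(F\<^sub>t, G\<^sub>t)\<close>, are carried along.\<close>

lemma singular_chain_of_matrices:
  fixes M X W :: "'a::field mat"
  assumes M: "M \<in> carrier_mat n n" and X: "X \<in> carrier_mat n t" and W: "W \<in> carrier_mat n (t - 1)"
    and G: "M * X = W * G_mat t" and F: "M\<^sup>T * X = W * F_mat t" and nz: "X \<noteq> 0\<^sub>m n t" and t: "t > 0"
  shows "singular_chain M t (\<lambda>j. if j < t then col X j else 0\<^sub>v n)"
  unfolding singular_chain_def carrier_matD(1)[OF M]
proof (intro conjI allI impI)
  have MT: "M\<^sup>T \<in> carrier_mat n n" using M by simp
  have cM: "M *\<^sub>v col X j = col (W * G_mat t) j" "M\<^sup>T *\<^sub>v col X j = col (W * F_mat t) j" if "j < t" for j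
    unfolding G[symmetric] F[symmetric] using that M X MT by (auto intro!: col_mult2[symmetric])
  have iG: "col (W * G_mat t) j $ i = (if j = 0 then 0 else W $$ (i, j - 1))" if "i < n" "j < t" for i j
    using mult_G_mat[OF W that] W that by (subst index_col) auto
  have iF: "col (W * F_mat t) j $ i = (if j < t - 1 then W $$ (i, j) else 0)" if "i < n" "j < t" for i j
    using mult_F_mat[OF W that] W that by (subst index_col) auto
  show "(if j < t then col X j else 0\<^sub>v n) \<in> carrier_vec n" for j using X by auto
  show "M *\<^sub>v (if 0 < t then col X 0 else 0\<^sub>v n) = 0\<^sub>v n"
    by (rule eq_vecI) (use t cM iG M W in auto)
  have z: "M *\<^sub>v 0\<^sub>v n = 0\<^sub>v n" "M\<^sup>T *\<^sub>v 0\<^sub>v n = 0\<^sub>v n" using M by auto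
  show "M *\<^sub>v (if Suc j < t then col X (Suc j) else 0\<^sub>v n) = M\<^sup>T *\<^sub>v (if j < t then col X j else 0\<^sub>v n)" for j
  proof (cases "j < t")
    case True
    have "M *\<^sub>v (if Suc j < t then col X (Suc j) else 0\<^sub>v n) = col (W * F_mat t) j"
    proof (rule eq_vecI)
      fix i assume "i < dim_vec (col (W * F_mat t) j)"
      hence i: "i < n" using W by simp
      show "(M *\<^sub>v (if Suc j < t then col X (Suc j) else 0\<^sub>v n)) $ i = col (W * F_mat t) j $ i"
        using iF[OF i True] iG[OF i, of "Suc j"] cM(1)[of "Suc j"] z i True by auto
    qed (use M W in auto)
    thus ?thesis using True cM(2)[OF True] by simp
  next
    case False
    thus ?thesis using z by simp
  qed
  show "(if j < t then col X j else 0\<^sub>v n) = 0\<^sub>v n" if "t \<le> j" for j using that by simp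
  show "\<exists>j. (if j < t then col X j else 0\<^sub>v n) \<noteq> 0\<^sub>v n"
  proof (rule ccontr)
    assume "\<not> ?thesis"
    hence c: "col X j = 0\<^sub>v n" if "j < t" for j using that by metis
    have "X = 0\<^sub>m n t"
    proof (rule eq_matI)
      fix i j assume "i < dim_row (0\<^sub>m n t :: 'a mat)" "j < dim_col (0\<^sub>m n t :: 'a mat)"
      hence ij: "i < n" "j < t" by auto
      have "X $$ (i, j) = col X j $ i" using ij X by simp
      thus "X $$ (i, j) = 0\<^sub>m n t $$ (i, j)" unfolding c[OF ij(2)] using ij by simp
    qed (use X in auto)
    thus False using nz by simp
  qed
qed

lemma FG_equivalence_summand_imp_chain:
  fixes M :: "'a::field mat"
  assumes M: "M \<in> carrier_mat n n" and t: "t > 0" and e: "equivalence_summand (F_mat t, G_mat t) (M\<^sup>T, M)"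
  shows "\<exists>t x. singular_chain M t x"
proof -
  have MT: "M\<^sup>T \<in> carrier_mat n n" using M by simp
  obtain R S C D c d where R: "R \<in> carrier_mat n n" "det R \<noteq> 0" and S: "S \<in> carrier_mat n n" "det S \<noteq> 0"
    and CD: "C \<in> carrier_mat c d" "D \<in> carrier_mat c d" and n: "n = t - 1 + c" "n = t + d"
    and eq: "R * M\<^sup>T * S = mat_sum (F_mat t) C" "R * M * S = mat_sum (G_mat t) D"
    using equivalence_summandE[OF e MT F_mat_carrier G_mat_carrier] .
  obtain I where I: "I \<in> carrier_mat n n" "R * I = 1\<^sub>m n" using obtain_inverse[OF R] by metis
  define X where "X = S * first_columns n t"
  define W where "W = I * first_columns n (t - 1)"
  have X: "X \<in> carrier_mat n t" and W: "W \<in> carrier_mat n (t - 1)" unfolding X_def W_def using S I by auto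
  have RW: "R * (W * Z) = first_columns n (t - 1) * Z" if "dim_row Z = t - 1" for Z
    unfolding W_def using R I(1) that by (simp add: assoc_mult_dim mult_eq_assoc[OF I(2)])
  have "M * X = W * G_mat t"
  proof (rule mult_left_cancel_invertible[OF R])
    have "R * (M * X) = R * M * S * first_columns n t" unfolding X_def using R M S by (simp add: assoc_mult_dim)
    thus "R * (M * X) = R * (W * G_mat t)"
      unfolding RW[OF G_mat_dim(1)] eq mat_sum_mult_first_columns[OF G_mat_carrier[of t] CD(2), folded n] .
  qed (use M X W in auto)
  moreover have "M\<^sup>T * X = W * F_mat t"
  proof (rule mult_left_cancel_invertible[OF R])
    have "R * (M\<^sup>T * X) = R * M\<^sup>T * S * first_columns n t" unfolding X_def using R M S by (simp add: assoc_mult_dim)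
    thus "R * (M\<^sup>T * X) = R * (W * F_mat t)"
      unfolding RW[OF F_mat_dim(1)] eq mat_sum_mult_first_columns[OF F_mat_carrier[of t] CD(1), folded n] .
  qed (use M X W in auto)
  moreover have "X \<noteq> 0\<^sub>m n t"
  proof
    assume "X = 0\<^sub>m n t"
    hence "S * first_columns n t = S * 0\<^sub>m n t" unfolding X_def using S by simp
    hence "first_columns n t = (0\<^sub>m n t :: 'a mat)" by (rule mult_left_cancel_invertible[OF S, rotated 2]) auto
    from arg_cong[OF this, of "\<lambda>Z. Z $$ (0, 0)"] show False using t n by (simp add: first_columns_def)
  qed
  ultimately show ?thesis using singular_chain_of_matrices[OF M X W _ _ _ t] by blast
qed

text \<open>With indices from \<open>0\<close>, the unit vectors with indices \<open>s - 1\<close>, \<open>s - 3\<close>, and so on down to \<open>0\<close>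
  form a chain of \<open>J\<^sub>s(0)\<close>; it ends at \<open>0\<close> because \<open>s\<close> is odd.\<close>

lemma odd_nilpotent_summand_imp_chain:
  fixes M :: "'a::field mat"
  assumes M: "M \<in> carrier_mat n n" and s: "odd s" and e: "congruence_summand (lower_jordan_block s 0) M"
  shows "\<exists>t x. singular_chain M t x"
proof -
  let ?J = "lower_jordan_block s (0::'a)"
  obtain S B a b where S: "S \<in> carrier_mat n n" "det S \<noteq> 0" and eq: "S\<^sup>T * M * S = mat_sum ?J B"
    and B: "?J \<in> carrier_mat a a" "B \<in> carrier_mat b b" and n: "n = a + b" using congruence_summandE[OF e M] .
  have a: "a = s" using carrier_matD(1)[OF B(1)] by simp
  note n = n[unfolded a]
  obtain k where k: "s = 2 * k + 1" using s oddE by blast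
  define t where "t = Suc k"
  have st: "s = 2 * t - 1" "t > 0" unfolding t_def k by auto
  have ST: "S\<^sup>T \<in> carrier_mat n n" "det (S\<^sup>T) \<noteq> 0" using S det_transpose[OF S(1)] by auto
  obtain I where I: "I \<in> carrier_mat n n" "S\<^sup>T * I = 1\<^sub>m n" using obtain_inverse[OF ST] by metis
  have eqT: "S\<^sup>T * M\<^sup>T * S = mat_sum (?J\<^sup>T) (B\<^sup>T)"
    using arg_cong[OF eq, of transpose_mat] S M by (simp add: transpose_mult_dim assoc_mult_dim mat_sum_transpose)
  define E where "E = mat s t (\<lambda>(i, j). if i = s - 1 - 2 * j then 1 else 0 :: 'a)"
  define W0 where "W0 = mat s (t - 1) (\<lambda>(i, j). if i = s - 2 - 2 * j then 1 else 0 :: 'a)"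
  have E: "E \<in> carrier_mat s t" and W0: "W0 \<in> carrier_mat s (t - 1)" unfolding E_def W0_def by auto
  have JE: "?J * E = W0 * G_mat t"
  proof (rule eq_matI)
    fix i j assume "i < dim_row (W0 * G_mat t)" "j < dim_col (W0 * G_mat t)"
    hence ij: "i < s" "j < t" using W0 by auto
    have "(?J * E) $$ (i, j) = (\<Sum>l<s. ?J $$ (i, l) * E $$ (l, j))"
      by (rule mult_mat_index_sum[OF _ E ij]) simp
    also have "\<dots> = (\<Sum>l<s. if l = s - 1 - 2 * j then ?J $$ (i, s - 1 - 2 * j) else 0)"
      using ij by (intro sum.cong) (auto simp: E_def)
    also have "\<dots> = ?J $$ (i, s - 1 - 2 * j)" using ij by auto
    also have "\<dots> = (if j = 0 then 0 else W0 $$ (i, j - 1))"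
    proof (cases j)
      case 0
      thus ?thesis using ij by (auto simp: lower_jordan_block_index)
    next
      case (Suc j')
      have "2 * j' + 3 \<le> s" "j' < t - 1" using ij(2) st(1) Suc by linarith+
      hence "s - 1 - 2 * j < s" "Suc (s - 1 - 2 * j) = s - 2 - 2 * j'" unfolding Suc by simp_all
      thus ?thesis using ij(1) \<open>j' < t - 1\<close> Suc by (simp add: lower_jordan_block_index W0_def del: diff_diff_left)
    qed
    also have "\<dots> = (W0 * G_mat t) $$ (i, j)" using mult_G_mat[OF W0 ij] by simp
    finally show "(?J * E) $$ (i, j) = (W0 * G_mat t) $$ (i, j)" .
  qed (use E W0 in auto)
  have JTE: "?J\<^sup>T * E = W0 * F_mat t"
  proof (rule eq_matI)
    fix i j assume "i < dim_row (W0 * F_mat t)" "j < dim_col (W0 * F_mat t)"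
    hence ij: "i < s" "j < t" using W0 by auto
    have "(?J\<^sup>T * E) $$ (i, j) = (\<Sum>l<s. ?J\<^sup>T $$ (i, l) * E $$ (l, j))"
      by (rule mult_mat_index_sum[OF _ E ij]) simp
    also have "\<dots> = (\<Sum>l<s. if l = s - 1 - 2 * j then ?J\<^sup>T $$ (i, s - 1 - 2 * j) else 0)"
      using ij by (intro sum.cong) (auto simp: E_def)
    also have "\<dots> = ?J\<^sup>T $$ (i, s - 1 - 2 * j)" using ij by auto
    also have "\<dots> = (if j < t - 1 then W0 $$ (i, j) else 0)"
    proof (cases "j < t - 1")
      case True
      have le: "2 * j + 3 \<le> s" using True st(1) by linarith
      hence lt: "s - 1 - 2 * j < s" "s - 1 - 2 * j = Suc (s - 2 - 2 * j)" by simp_all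
      show ?thesis unfolding index_transpose_mat(1)[of _ ?J, simplified lower_jordan_block_dim, OF ij(1) lt(1)]
          lower_jordan_block_index[OF lt(1) ij(1)]
        using ij(1) True lt(2) by (auto simp: W0_def)
    next
      case False
      hence "s - 1 - 2 * j = 0" "0 < s" using ij st by linarith+
      thus ?thesis using False ij(1) by (simp add: lower_jordan_block_index)
    qed
    also have "\<dots> = (W0 * F_mat t) $$ (i, j)" using mult_F_mat[OF W0 ij] by simp
    finally show "(?J\<^sup>T * E) $$ (i, j) = (W0 * F_mat t) $$ (i, j)" .
  qed (use E W0 in auto)
  let ?i = "first_columns n s :: 'a mat"
  define X where "X = S * (?i * E)"
  define W where "W = I * (?i * W0)"
  have X: "X \<in> carrier_mat n t" and W: "W \<in> carrier_mat n (t - 1)"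
    unfolding X_def W_def using S I E W0 by auto
  have SW: "S\<^sup>T * (W * Z) = ?i * (W0 * Z)" if "dim_row Z = t - 1" for Z
    unfolding W_def using S I(1) W0 that by (simp add: assoc_mult_dim mult_eq_assoc[OF I(2)])
  have "M * X = W * G_mat t"
  proof (rule mult_left_cancel_invertible[OF ST])
    have "S\<^sup>T * (M * X) = S\<^sup>T * M * S * ?i * E" unfolding X_def using M S E by (simp add: assoc_mult_dim)
    also have "\<dots> = ?i * ?J * E" unfolding eq using mat_sum_mult_first_columns[OF lower_jordan_block_carrier B(2), of s 0] n by simp
    also have "\<dots> = ?i * (?J * E)" using E by (simp add: assoc_mult_dim)
    finally show "S\<^sup>T * (M * X) = S\<^sup>T * (W * G_mat t)" unfolding SW[OF G_mat_dim(1)] JE .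
  qed (use M X W in auto)
  moreover have "M\<^sup>T * X = W * F_mat t"
  proof (rule mult_left_cancel_invertible[OF ST])
    have "S\<^sup>T * (M\<^sup>T * X) = S\<^sup>T * M\<^sup>T * S * ?i * E" unfolding X_def using M S E by (simp add: assoc_mult_dim)
    also have "\<dots> = ?i * ?J\<^sup>T * E" unfolding eqT using mat_sum_mult_first_columns[of "?J\<^sup>T" s s "B\<^sup>T" b b] n B by simp
    also have "\<dots> = ?i * (?J\<^sup>T * E)" using E by (simp add: assoc_mult_dim)
    finally show "S\<^sup>T * (M\<^sup>T * X) = S\<^sup>T * (W * F_mat t)" unfolding SW[OF F_mat_dim(1)] JTE .
  qed (use M X W in auto)
  moreover have "X \<noteq> 0\<^sub>m n t"
  proof
    assume "X = 0\<^sub>m n t"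
    hence "S * (?i * E) = S * 0\<^sub>m n t" unfolding X_def using S by simp
    hence "?i * E = 0\<^sub>m n t" by (rule mult_left_cancel_invertible[OF S, rotated 2]) (use E in auto)
    hence "?i\<^sup>T * (?i * E) = 0\<^sub>m s t" by simp
    moreover have "?i\<^sup>T * (?i * E) = E"
      using mult_eq_assoc[OF first_columns_orthonormal[of s b], of E] E unfolding n by simp
    ultimately have "E = 0\<^sub>m s t" by simp
    from arg_cong[OF this, of "\<lambda>Z. Z $$ (s - 1, 0)"] show False using st by (simp add: E_def)
  qed
  ultimately show ?thesis using singular_chain_of_matrices[OF M X W _ _ _ st(2)] by blast
qed

lemma nonsingular_no_chain:
  fixes M :: "'a::field mat"
  assumes M: "M \<in> carrier_mat n n" "det M \<noteq> 0"
  shows "\<not> singular_chain M t x"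
proof
  assume "singular_chain M t x"
  hence x: "\<And>j. x j \<in> carrier_vec n" "M *\<^sub>v x 0 = 0\<^sub>v n" "\<And>j. M *\<^sub>v x (Suc j) = M\<^sup>T *\<^sub>v x j" "\<exists>j. x j \<noteq> 0\<^sub>v n"
    using M(1) unfolding singular_chain_def by auto
  have inj: "v = 0\<^sub>v n" if "v \<in> carrier_vec n" "M *\<^sub>v v = 0\<^sub>v n" for v
    using M(2) det_0_iff_vec_prod_zero_field[OF M(1)] that by auto
  have "x j = 0\<^sub>v n" for j
  proof (induction j)
    case 0
    show ?case by (rule inj[OF x(1,2)])
  next
    case (Suc j)
    have "M *\<^sub>v x (Suc j) = 0\<^sub>v n" unfolding x(3) Suc using M by auto
    thus ?case by (rule inj[OF x(1)])
  qed
  thus False using x(4) by simp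
qed

definition minimal_chain :: "'a::field mat \<Rightarrow> nat \<Rightarrow> (nat \<Rightarrow> 'a vec) \<Rightarrow> bool" where
  "minimal_chain M t x \<longleftrightarrow> singular_chain M t x \<and> (\<forall>s<t. \<forall>y. \<not> singular_chain M s y)"

lemma minimal_chain_exists:
  assumes "singular_chain M t x"
  obtains t x where "minimal_chain M t x"
proof -
  define s where "s = (LEAST s. \<exists>y. singular_chain M s y)"
  have "\<exists>y. singular_chain M s y" unfolding s_def by (rule LeastI_ex) (use assms in auto)
  moreover have "\<not> singular_chain M s' y" if "s' < s" for s' y
    using not_less_Least[of s' "\<lambda>s. \<exists>y. singular_chain M s y"] that unfolding s_def by auto
  ultimately show ?thesis using that[of s] unfolding minimal_chain_def by blast
qed

lemma minimal_chain_last: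
  fixes M :: "'a::field mat"
  assumes "minimal_chain M t x"
  shows "t > 0" "x (t - 1) \<noteq> 0\<^sub>v (dim_row M)"
proof -
  have c: "singular_chain M t x" and m: "\<And>s y. s < t \<Longrightarrow> \<not> singular_chain M s y"
    using assms unfolding minimal_chain_def by auto
  show t: "t > 0" using c unfolding singular_chain_def by auto
  show "x (t - 1) \<noteq> 0\<^sub>v (dim_row M)"
  proof
    assume z: "x (t - 1) = 0\<^sub>v (dim_row M)"
    have "x j = 0\<^sub>v (dim_row M)" if "t - 1 \<le> j" for j
      using that z c t unfolding singular_chain_def by (cases "j = t - 1") auto
    hence "singular_chain M (t - 1) x" using c unfolding singular_chain_def by auto
    thus False using m[of "t - 1"] t by auto
  qed
qed

text \<open>The columns of \<open>Y\<close> are functionals that extend the first one, which is normalised on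
  \<open>M\<^sup>T *\<^sub>v x 0\<close>, to the dual of a chain. By the Fredholm alternative they exist unless vectors
  \<open>U 0, \<dots>, U (s - 1)\<close> satisfy \<open>M *\<^sub>v U 0 = M\<^sup>T *\<^sub>v x 0\<close> and \<open>M *\<^sub>v U (j + 1) = M\<^sup>T *\<^sub>v U j\<close>, with \<open>0\<close> after
  the last one. But then the vectors \<open>x (j + 1) - U j\<close> form a shorter chain. This argument
  replaces the solution of the matrix equations by which Kronecker's reduction decouples a
  minimal chain from the rest of the pencil.\<close>

lemma minimal_chain_functional:
  fixes M :: "'a::field mat"
  assumes M: "M \<in> carrier_mat n n" and min: "minimal_chain M t x" and t: "t = Suc (Suc s)"
  obtains Y where "Y \<in> carrier_mat n (Suc s)"
    "\<And>q l. q < s \<Longrightarrow> l < n \<Longrightarrow> (Y\<^sup>T * M) $$ (q, l) = (Y\<^sup>T * M\<^sup>T) $$ (Suc q, l)"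
    "(\<Sum>i<n. Y $$ (i, 0) * (M\<^sup>T *\<^sub>v x 0) $ i) = 1"
proof -
  have MT: "M\<^sup>T \<in> carrier_mat n n" using M by simp
  have x: "\<And>j. x j \<in> carrier_vec n" "M *\<^sub>v x 0 = 0\<^sub>v n" "\<And>j. M *\<^sub>v x (Suc j) = M\<^sup>T *\<^sub>v x j"
    "\<And>j. t \<le> j \<Longrightarrow> x j = 0\<^sub>v n"
    using min M unfolding minimal_chain_def singular_chain_def by auto
  have last: "x (Suc s) \<noteq> 0\<^sub>v n" using minimal_chain_last(2)[OF min] t M by simp
  let ?I = "{..<Suc s} \<times> {..<n}" and ?J = "{..<s} \<times> {..<n}"
  define a where "a = (\<lambda>(p, i) (q, l). (if p = q then M $$ (i, l) else 0) - (if p = Suc q then M\<^sup>T $$ (i, l) else 0))"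
  define w where "w = (\<lambda>(p::nat, i). if p = 0 then (M\<^sup>T *\<^sub>v x 0) $ i else 0)"
  have "finite ?I" "finite ?J" by auto
  from finite_fredholm_alternative[OF this, of w a] show ?thesis
  proof
    assume "\<exists>u. \<forall>i\<in>?I. w i = (\<Sum>j\<in>?J. a i j * u j)"
    then obtain u where u: "\<And>p i. p < Suc s \<Longrightarrow> i < n \<Longrightarrow> w (p, i) = (\<Sum>j\<in>?J. a (p, i) j * u j)" by auto
    define U where "U q = vec n (\<lambda>l. if q < s then u (q, l) else 0)" for q
    have U: "U q \<in> carrier_vec n" for q unfolding U_def by simp
    have U0: "U q = 0\<^sub>v n" if "s \<le> q" for q unfolding U_def using that by (auto intro: eq_vecI)
    have rec: "w (p, i) = (M *\<^sub>v U p) $ i - (if p = 0 then 0 else (M\<^sup>T *\<^sub>v U (p - 1)) $ i)"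
      if p: "p < Suc s" and i: "i < n" for p i
    proof -
      have "w (p, i) = (\<Sum>q<s. \<Sum>l<n. a (p, i) (q, l) * u (q, l))"
        unfolding u[OF that] by (simp add: sum.cartesian_product)
      also have "\<dots> = (\<Sum>q<s. (if q = p then (M *\<^sub>v U q) $ i else 0) - (if p = Suc q then (M\<^sup>T *\<^sub>v U q) $ i else 0))"
      proof (rule sum.cong[OF refl])
        fix q assume "q \<in> {..<s}"
        hence q: "q < s" by simp
        have e: "(N *\<^sub>v U q) $ i = (\<Sum>l<n. N $$ (i, l) * u (q, l))" if "N \<in> carrier_mat n n" for N
          using mult_mat_vec_index_sum[OF that U i, of q] q by (simp add: U_def)
        show "(\<Sum>l<n. a (p, i) (q, l) * u (q, l)) =
          (if q = p then (M *\<^sub>v U q) $ i else 0) - (if p = Suc q then (M\<^sup>T *\<^sub>v U q) $ i else 0)"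
          unfolding e[OF M] e[OF MT] a_def by (auto simp: sum_negf)
      qed
      also have "\<dots> = (if p < s then (M *\<^sub>v U p) $ i else 0) - (\<Sum>q<s. if p = Suc q then (M\<^sup>T *\<^sub>v U q) $ i else 0)"
        by (simp add: sum_subtractf)
      also have "(\<Sum>q<s. if p = Suc q then (M\<^sup>T *\<^sub>v U q) $ i else 0) = (if p = 0 then 0 else (M\<^sup>T *\<^sub>v U (p - 1)) $ i)"
      proof (cases p)
        case (Suc p')
        have "(\<Sum>q<s. if p = Suc q then (M\<^sup>T *\<^sub>v U q) $ i else 0) = (\<Sum>q<s. if q = p' then (M\<^sup>T *\<^sub>v U q) $ i else 0)"
          by (rule sum.cong) (auto simp: Suc)
        thus ?thesis using Suc p by simp
      qed simp
      also have "(if p < s then (M *\<^sub>v U p) $ i else 0) = (M *\<^sub>v U p) $ i"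
        using U0[of p] M i by auto
      finally show ?thesis .
    qed
    have MU0: "M *\<^sub>v U 0 = M\<^sup>T *\<^sub>v x 0"
      by (rule eq_vecI) (use rec[of 0] M in \<open>auto simp: w_def\<close>)
    have MUS: "M *\<^sub>v U (Suc j) = M\<^sup>T *\<^sub>v U j" for j
    proof (cases "Suc j < Suc s")
      case True
      show ?thesis by (rule eq_vecI) (use rec[OF True] M in \<open>auto simp: w_def\<close>)
    next
      case False
      thus ?thesis using U0[of j] U0[of "Suc j"] M by auto
    qed
    have "singular_chain M (Suc s) (\<lambda>j. x (Suc j) - U j)"
      unfolding singular_chain_def carrier_matD(1)[OF M]
    proof (intro conjI allI impI)
      have d: "N *\<^sub>v (x (Suc j) - U j) = N *\<^sub>v x (Suc j) - N *\<^sub>v U j" if "N \<in> carrier_mat n n" for N j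
        by (rule mult_minus_distrib_mat_vec[OF that x(1) U])
      show "x (Suc j) - U j \<in> carrier_vec n" for j using x(1) U by auto
      show "M *\<^sub>v (x (Suc 0) - U 0) = 0\<^sub>v n" unfolding d[OF M] MU0 x(3) using MT x(1) by auto
      show "M *\<^sub>v (x (Suc (Suc j)) - U (Suc j)) = M\<^sup>T *\<^sub>v (x (Suc j) - U j)" for j
        unfolding d[OF M] d[OF MT] MUS x(3) ..
      show "x (Suc j) - U j = 0\<^sub>v n" if "Suc s \<le> j" for j using x(4)[of "Suc j"] U0[of j] that t by auto
      have "x (Suc s) - U s = x (Suc s)" using U0[of s] x(1)[of "Suc s"] by simp
      thus "\<exists>j. x (Suc j) - U j \<noteq> 0\<^sub>v n" using last by (intro exI[of _ s]) simp
    qed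
    thus ?thesis using min t unfolding minimal_chain_def by auto
  next
    assume "\<exists>k. (\<forall>j\<in>?J. (\<Sum>i\<in>?I. k i * a i j) = 0) \<and> (\<Sum>i\<in>?I. k i * w i) \<noteq> 0"
    then obtain k where k: "\<And>q l. q < s \<Longrightarrow> l < n \<Longrightarrow> (\<Sum>i\<in>?I. k i * a i (q, l)) = 0"
      "(\<Sum>i\<in>?I. k i * w i) \<noteq> 0" by auto
    define c where "c = (\<Sum>i\<in>?I. k i * w i)"
    define Y where "Y = mat n (Suc s) (\<lambda>(i, p). k (p, i) / c)"
    have Y: "Y \<in> carrier_mat n (Suc s)" unfolding Y_def by simp
    have c_eq: "c = (\<Sum>i<n. k (0, i) * (M\<^sup>T *\<^sub>v x 0) $ i)"
    proof -
      have "c = (\<Sum>p<Suc s. \<Sum>i<n. k (p, i) * w (p, i))" unfolding c_def by (simp add: sum.cartesian_product)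
      also have "\<dots> = (\<Sum>p<Suc s. if p = 0 then (\<Sum>i<n. k (0, i) * (M\<^sup>T *\<^sub>v x 0) $ i) else 0)"
        by (rule sum.cong) (auto simp: w_def)
      finally show ?thesis by simp
    qed
    have c0: "c \<noteq> 0" using k(2) c_def by simp
    show ?thesis
    proof (rule that[OF Y])
      fix q l assume q: "q < s" and l: "l < n"
      have "0 = (\<Sum>p<Suc s. \<Sum>i<n. k (p, i) * a (p, i) (q, l))"
        using k(1)[OF q l] by (simp add: sum.cartesian_product)
      also have "\<dots> = (\<Sum>p<Suc s. (if p = q then (\<Sum>i<n. k (q, i) * M $$ (i, l)) else 0)
          - (if p = Suc q then (\<Sum>i<n. k (Suc q, i) * M\<^sup>T $$ (i, l)) else 0))"
        by (rule sum.cong) (auto simp: a_def sum_negf)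
      also have "\<dots> = (\<Sum>i<n. k (q, i) * M $$ (i, l)) - (\<Sum>i<n. k (Suc q, i) * M\<^sup>T $$ (i, l))"
        using q by (simp add: sum_subtractf)
      finally have "(\<Sum>i<n. k (q, i) * M $$ (i, l)) = (\<Sum>i<n. k (Suc q, i) * M\<^sup>T $$ (i, l))" by simp
      moreover have "(Y\<^sup>T * N) $$ (p, l) = (\<Sum>i<n. k (p, i) * N $$ (i, l)) / c"
        if "N \<in> carrier_mat n n" "p < Suc s" for N p
        using mult_mat_index_sum[of "Y\<^sup>T" "Suc s" n N n p l] that l Y
        by (simp add: Y_def sum_divide_distrib)
      ultimately show "(Y\<^sup>T * M) $$ (q, l) = (Y\<^sup>T * M\<^sup>T) $$ (Suc q, l)" using M MT q by simp
    next
      have "(\<Sum>i<n. Y $$ (i, 0) * (M\<^sup>T *\<^sub>v x 0) $ i) = (\<Sum>i<n. k (0, i) * (M\<^sup>T *\<^sub>v x 0) $ i) / c"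
        unfolding sum_divide_distrib by (rule sum.cong) (auto simp: Y_def)
      thus "(\<Sum>i<n. Y $$ (i, 0) * (M\<^sup>T *\<^sub>v x 0) $ i) = 1" using c0 c_eq by simp
    qed
  qed
qed

section \<open>Splitting off a minimal chain\<close>

text \<open>The pair \<open>(F\<^sub>t, G\<^sub>t)\<close> is embedded into \<open>(M\<^sup>T, M)\<close> by \<open>X\<close> on the domain and by \<open>W\<close> on the codomain,
  and \<open>H\<close> and \<open>Y\<^sup>T\<close> form a retraction of this embedding.\<close>

definition chain_retraction :: "'a::field mat \<Rightarrow> nat \<Rightarrow> nat \<Rightarrow> 'a mat \<Rightarrow> 'a mat \<Rightarrow> 'a mat \<Rightarrow> 'a mat \<Rightarrow> bool" where
  "chain_retraction M n t X W Y H \<longleftrightarrow> X \<in> carrier_mat n t \<and> W \<in> carrier_mat n (t - 1) \<and>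
     Y \<in> carrier_mat n (t - 1) \<and> H \<in> carrier_mat t n \<and>
     M * X = W * G_mat t \<and> M\<^sup>T * X = W * F_mat t \<and>
     Y\<^sup>T * M = G_mat t * H \<and> Y\<^sup>T * M\<^sup>T = F_mat t * H \<and> Y\<^sup>T * W = 1\<^sub>m (t - 1) \<and> H * X = 1\<^sub>m t"

text \<open>The equations make both matrices constant along the diagonals and zero where a diagonal other than
  the main one meets the first column or the last column.\<close>

lemma FG_endomorphism_scalar:
  fixes Z P :: "'a::field mat"
  assumes Z: "Z \<in> carrier_mat t t" and P: "P \<in> carrier_mat (t - 1) (t - 1)"
    and G: "G_mat t * Z = P * G_mat t" and F: "F_mat t * Z = P * F_mat t" and t: "t > 1"
    and one: "P $$ (0, 0) = 1"
  shows "Z = 1\<^sub>m t" "P = 1\<^sub>m (t - 1)"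
proof -
  have top: "Z $$ (i, j) = (if j < t - 1 then P $$ (i, j) else 0)" if "i < t - 1" "j < t" for i j
    using F_mat_mult[OF Z that] mult_F_mat[OF P that] F by simp
  have bot: "Z $$ (Suc i, j) = (if j = 0 then 0 else P $$ (i, j - 1))" if "i < t - 1" "j < t" for i j
    using G_mat_mult[OF Z that] mult_G_mat[OF P that] G by simp
  have shift: "Z $$ (Suc i, Suc j) = Z $$ (i, j)" if "Suc i < t" "Suc j < t" for i j
    using top[of i j] bot[of i "Suc j"] that by simp
  have shifts: "Z $$ (i + d, j + d) = Z $$ (i, j)" if "i + d < t" "j + d < t" for i j d
    using that by (induction d) (auto simp: shift)
  show Z1: "Z = 1\<^sub>m t"
  proof (rule eq_matI)
    fix i j assume "i < dim_row (1\<^sub>m t :: 'a mat)" "j < dim_col (1\<^sub>m t :: 'a mat)"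
    hence ij: "i < t" "j < t" by auto
    consider "i = j" | "j < i" | "i < j" by linarith
    thus "Z $$ (i, j) = 1\<^sub>m t $$ (i, j)"
    proof cases
      case 1
      thus ?thesis using shifts[of 0 i 0] ij top[of 0 0] one t by simp
    next
      case 2
      then obtain d where d: "i = Suc d + j" using less_iff_Suc_add[of j i] by auto
      show ?thesis using shifts[of "Suc d" j 0] bot[of d 0] ij d by simp
    next
      case 3
      have "Z $$ (i + (t - 1 - j), j + (t - 1 - j)) = Z $$ (i, j)" by (rule shifts) (use 3 ij in auto)
      moreover have "Z $$ (i + (t - 1 - j), t - 1) = 0" using top[of "i + (t - 1 - j)" "t - 1"] 3 ij by simp
      ultimately show ?thesis using 3 ij by simp
    qed
  qed (use Z in auto)
  show "P = 1\<^sub>m (t - 1)"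
  proof (rule eq_matI)
    fix i j assume "i < dim_row (1\<^sub>m (t - 1) :: 'a mat)" "j < dim_col (1\<^sub>m (t - 1) :: 'a mat)"
    thus "P $$ (i, j) = 1\<^sub>m (t - 1) $$ (i, j)" using top[of i j] unfolding Z1 by simp
  qed (use P in auto)
qed

text \<open>The functionals define a morphism from the pencil to \<open>(F\<^sub>t, G\<^sub>t)\<close>. Its composition with the
  embedding of the chain is an endomorphism of \<open>(F\<^sub>t, G\<^sub>t)\<close>, hence a scalar, and this scalar is
  \<open>1\<close> by normalisation.\<close>

lemma minimal_chain_retraction:
  fixes M :: "'a::field mat"
  assumes M: "M \<in> carrier_mat n n" and min: "minimal_chain M t x"
  obtains X W Y H where "chain_retraction M n t X W Y H"
proof -
  have MT: "M\<^sup>T \<in> carrier_mat n n" using M by simp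
  have x: "\<And>j. x j \<in> carrier_vec n" "M *\<^sub>v x 0 = 0\<^sub>v n" "\<And>j. M *\<^sub>v x (Suc j) = M\<^sup>T *\<^sub>v x j"
    "\<And>j. t \<le> j \<Longrightarrow> x j = 0\<^sub>v n"
    using min M unfolding minimal_chain_def singular_chain_def by auto
  have t: "t > 0" and last: "x (t - 1) \<noteq> 0\<^sub>v n" using minimal_chain_last[OF min] M by auto
  define X where "X = mat n t (\<lambda>(i, j). x j $ i)"
  define W where "W = mat n (t - 1) (\<lambda>(i, j). (M\<^sup>T *\<^sub>v x j) $ i)"
  have X: "X \<in> carrier_mat n t" and W: "W \<in> carrier_mat n (t - 1)" unfolding X_def W_def by auto
  have NX: "(N * X) $$ (i, j) = (N *\<^sub>v x j) $ i" if "N \<in> carrier_mat n n" "i < n" "j < t" for N i j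
    using mult_mat_index_sum[OF that(1) X that(2,3)] mult_mat_vec_index_sum[OF that(1) x(1) that(2), of j] that
    by (simp add: X_def)
  have MX: "M * X = W * G_mat t"
  proof (rule eq_matI)
    fix i j assume "i < dim_row (W * G_mat t)" "j < dim_col (W * G_mat t)"
    hence ij: "i < n" "j < t" using W by auto
    have "(M *\<^sub>v x j) $ i = (if j = 0 then 0 else W $$ (i, j - 1))"
      using x(2) x(3)[of "j - 1"] ij by (cases j) (simp_all add: W_def)
    thus "(M * X) $$ (i, j) = (W * G_mat t) $$ (i, j)" using NX[OF M ij] mult_G_mat[OF W ij] by simp
  qed (use M X W in auto)
  have MTX: "M\<^sup>T * X = W * F_mat t"
  proof (rule eq_matI)
    fix i j assume "i < dim_row (W * F_mat t)" "j < dim_col (W * F_mat t)"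
    hence ij: "i < n" "j < t" using W by auto
    have "(M\<^sup>T *\<^sub>v x j) $ i = (if j < t - 1 then W $$ (i, j) else 0)"
    proof (cases "j < t - 1")
      case True
      thus ?thesis using ij by (simp add: W_def)
    next
      case False
      hence "M\<^sup>T *\<^sub>v x j = M *\<^sub>v 0\<^sub>v n" using x(3)[of j] x(4)[of "Suc j"] by simp
      also have "\<dots> = 0\<^sub>v n" using M by auto
      finally show ?thesis using False ij by simp
    qed
    thus "(M\<^sup>T * X) $$ (i, j) = (W * F_mat t) $$ (i, j)" using NX[OF MT ij] mult_F_mat[OF W ij] by simp
  qed (use M X W in auto)
  show ?thesis
  proof (cases "t = 1")
    case True
    obtain p where p: "p < n" "x 0 $ p \<noteq> 0"
    proof (rule ccontr)
      assume "\<not> thesis"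
      hence "x 0 = 0\<^sub>v n" using that x(1)[of 0] by (intro eq_vecI) auto
      thus False using last True by simp
    qed
    define H where "H = mat 1 n (\<lambda>(i, j). if j = p then 1 / x 0 $ p else 0)"
    have H: "H \<in> carrier_mat t n" unfolding H_def True by simp
    have "H * X = 1\<^sub>m t"
    proof (rule eq_matI)
      fix i j assume "i < dim_row (1\<^sub>m t :: 'a mat)" "j < dim_col (1\<^sub>m t :: 'a mat)"
      hence ij: "i = 0" "j = 0" "i < t" "j < t" unfolding True by auto
      have "(H * X) $$ (i, j) = (\<Sum>l<n. H $$ (i, l) * X $$ (l, j))" by (rule mult_mat_index_sum[OF H X ij(3,4)])
      also have "\<dots> = (\<Sum>l<n. if l = p then 1 else 0)"
        using ij p by (intro sum.cong) (auto simp: H_def X_def)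
      finally show "(H * X) $$ (i, j) = 1\<^sub>m t $$ (i, j)" using ij p by simp
    qed (use H X in auto)
    hence "chain_retraction M n t X W (0\<^sub>m n 0) H"
      unfolding chain_retraction_def using X W H MX MTX M True by (auto intro!: eq_matI)
    thus ?thesis by (rule that)
  next
    case False
    have "t = Suc (Suc (t - 2))" using False t by linarith
    then obtain s where s: "t = Suc (Suc s)" by blast
    obtain Y where Y: "Y \<in> carrier_mat n (Suc s)"
      "\<And>q l. q < s \<Longrightarrow> l < n \<Longrightarrow> (Y\<^sup>T * M) $$ (q, l) = (Y\<^sup>T * M\<^sup>T) $$ (Suc q, l)"
      "(\<Sum>i<n. Y $$ (i, 0) * (M\<^sup>T *\<^sub>v x 0) $ i) = 1"
      by (rule minimal_chain_functional[OF M min s]) blast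
    have Yt: "Y \<in> carrier_mat n (t - 1)" using Y(1) s by simp
    define H where "H = mat t n (\<lambda>(i, l). if i < Suc s then (Y\<^sup>T * M\<^sup>T) $$ (i, l) else (Y\<^sup>T * M) $$ (s, l))"
    have H: "H \<in> carrier_mat t n" unfolding H_def by simp
    have YM: "Y\<^sup>T * M = G_mat t * H"
    proof (rule eq_matI)
      fix i l assume "i < dim_row (G_mat t * H)" "l < dim_col (G_mat t * H)"
      hence il: "i < t - 1" "l < n" using H by auto
      have "(Y\<^sup>T * M) $$ (i, l) = H $$ (Suc i, l)"
      proof (cases "i < s")
        case True
        thus ?thesis using il s Y(2)[of i l] by (simp add: H_def del: index_mult_mat(1))
      next
        case False
        hence "i = s" using il s by simp
        thus ?thesis using il s by (simp add: H_def del: index_mult_mat(1))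
      qed
      thus "(Y\<^sup>T * M) $$ (i, l) = (G_mat t * H) $$ (i, l)" using G_mat_mult[OF H il] by simp
    qed (use Yt M H in auto)
    have YMT: "Y\<^sup>T * M\<^sup>T = F_mat t * H"
    proof (rule eq_matI)
      fix i l assume "i < dim_row (F_mat t * H)" "l < dim_col (F_mat t * H)"
      hence il: "i < t - 1" "l < n" using H by auto
      have "(Y\<^sup>T * M\<^sup>T) $$ (i, l) = H $$ (i, l)" using il s by (simp add: H_def del: index_mult_mat(1))
      thus "(Y\<^sup>T * M\<^sup>T) $$ (i, l) = (F_mat t * H) $$ (i, l)" using F_mat_mult[OF H il] by simp
    qed (use Yt M H in auto)
    have Z: "H * X \<in> carrier_mat t t" using H X by simp
    have P: "Y\<^sup>T * W \<in> carrier_mat (t - 1) (t - 1)" using Yt W by simp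
    have "G_mat t * (H * X) = Y\<^sup>T * (M * X)" using H X M Yt YM by (simp flip: assoc_mult_dim)
    hence G: "G_mat t * (H * X) = Y\<^sup>T * W * G_mat t" unfolding MX using Yt W by (simp add: assoc_mult_dim)
    have "F_mat t * (H * X) = Y\<^sup>T * (M\<^sup>T * X)" using H X M Yt YMT by (simp flip: assoc_mult_dim)
    hence F: "F_mat t * (H * X) = Y\<^sup>T * W * F_mat t" unfolding MTX using Yt W by (simp add: assoc_mult_dim)
    have "(Y\<^sup>T * W) $$ (0, 0) = (\<Sum>l<n. Y\<^sup>T $$ (0, l) * W $$ (l, 0))"
      by (rule mult_mat_index_sum) (use Yt W s in auto)
    also have "\<dots> = 1" unfolding Y(3)[symmetric] using Y(1) s by (intro sum.cong) (auto simp: W_def)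
    finally have "H * X = 1\<^sub>m t" "Y\<^sup>T * W = 1\<^sub>m (t - 1)"
      using FG_endomorphism_scalar[OF Z P G F] s by auto
    hence "chain_retraction M n t X W Y H"
      unfolding chain_retraction_def using X W Yt H MX MTX YM YMT by blast
    thus ?thesis by (rule that)
  qed
qed

lemma chain_retraction_equivalence_summand:
  fixes M :: "'a::field mat"
  assumes M: "M \<in> carrier_mat n n" and r: "chain_retraction M n t X W Y H"
  shows "equivalence_summand (F_mat t, G_mat t) (M\<^sup>T, M)"
proof -
  have X: "X \<in> carrier_mat n t" and W: "W \<in> carrier_mat n (t - 1)" and Y: "Y \<in> carrier_mat n (t - 1)"
    and H: "H \<in> carrier_mat t n" and eq: "M * X = W * G_mat t" "M\<^sup>T * X = W * F_mat t"
      "Y\<^sup>T * M = G_mat t * H" "Y\<^sup>T * M\<^sup>T = F_mat t * H" and YW: "Y\<^sup>T * W = 1\<^sub>m (t - 1)" and HX: "H * X = 1\<^sub>m t"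
    using r unfolding chain_retraction_def by auto
  have YT: "Y\<^sup>T \<in> carrier_mat (t - 1) n" using Y by simp
  obtain V B m where V: "n = t + m" "V \<in> carrier_mat n m" "B \<in> carrier_mat m n" "H * V = 0\<^sub>m t m"
      "X * H + V * B = 1\<^sub>m n"
    using complete_left_inverse[OF H X HX] by metis
  obtain V' B' m' where V': "n = t - 1 + m'" "V' \<in> carrier_mat n m'" "B' \<in> carrier_mat m' n"
      "B' * W = 0\<^sub>m m' (t - 1)" "W * Y\<^sup>T + V' * B' = 1\<^sub>m n"
    using complete_left_inverse[OF YT W YW] by metis
  define R where "R = vcat (Y\<^sup>T) B'"
  define S where "S = hcat X V"
  have R: "R \<in> carrier_mat n n" "det R \<noteq> 0"
    using vcat_carrier[OF YT V'(3)] det_hcat_complement(2)[OF YT W V'(2,3,1,5)] V'(1) unfolding R_def by auto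
  have S: "S \<in> carrier_mat n n" "det S \<noteq> 0"
    using hcat_carrier[OF X V(2)] det_hcat_complement(1)[OF H X V(2,3,1,5)] V(1) unfolding S_def by auto
  have main: "R * N * S = mat_sum E (B' * N * V)"
    if N: "N \<in> carrier_mat n n" and E: "E \<in> carrier_mat (t - 1) t" and NX: "N * X = W * E" and YN: "Y\<^sup>T * N = E * H" for N E
  proof -
    have "R * N = vcat (Y\<^sup>T * N) (B' * N)" unfolding R_def by (rule vcat_mult) (use N Y V' in auto)
    hence "R * N * S = four_block_mat (Y\<^sup>T * N * X) (Y\<^sup>T * N * V) (B' * N * X) (B' * N * V)"
      unfolding S_def using N YT V' X V by (simp add: vcat_mult_hcat[of _ "t - 1" n _ m' _ t _ m])
    also have "Y\<^sup>T * N * X = E" unfolding YN using E H X HX by (simp add: assoc_mult_dim)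
    also have "Y\<^sup>T * N * V = 0\<^sub>m (t - 1) m" unfolding YN using E H V by (simp add: assoc_mult_dim)
    also have "B' * N * X = 0\<^sub>m m' t"
    proof -
      have "B' * N * X = B' * (W * E)" unfolding NX[symmetric] using V'(3) N X by (simp add: assoc_mult_dim)
      thus ?thesis using mult_eq_assoc[OF V'(4), of E] V'(3) W E by simp
    qed
    finally show ?thesis using E N V' V by (simp add: four_block_eq_mat_sum[of _ "t - 1" t _ m' m])
  qed
  have MT: "M\<^sup>T \<in> carrier_mat n n" using M by simp
  show ?thesis
    by (rule equivalence_summandI[OF MT M R S F_mat_carrier G_mat_carrier _ _
        main[OF MT F_mat_carrier eq(2,4)] main[OF M G_mat_carrier eq(1,3)]])
      (use V V' M in auto)
qed

lemma congruent_reindex: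
  fixes A :: "'a::field mat"
  assumes A: "A \<in> carrier_mat n n" and \<sigma>: "\<sigma> ` {..<n} \<subseteq> {..<n}" "inj_on \<sigma> {..<n}"
  shows "congruent_mat A (mat n n (\<lambda>(i, j). A $$ (\<sigma> i, \<sigma> j)))"
proof -
  define P where "P = mat n n (\<lambda>(a, i). if a = \<sigma> i then 1 else 0 :: 'a)"
  have P: "P \<in> carrier_mat n n" unfolding P_def by simp
  have s: "\<sigma> i < n" if "i < n" for i using \<sigma>(1) that by auto
  have left: "(P\<^sup>T * B) $$ (i, j) = B $$ (\<sigma> i, j)" if "B \<in> carrier_mat n n" "i < n" "j < n" for B i j
  proof -
    have "(P\<^sup>T * B) $$ (i, j) = (\<Sum>l<n. P\<^sup>T $$ (i, l) * B $$ (l, j))"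
      by (rule mult_mat_index_sum) (use P that in auto)
    also have "\<dots> = (\<Sum>l<n. if l = \<sigma> i then B $$ (\<sigma> i, j) else 0)"
      using that by (intro sum.cong) (auto simp: P_def)
    finally show ?thesis using s[OF that(2)] by simp
  qed
  have right: "(B * P) $$ (i, j) = B $$ (i, \<sigma> j)" if "B \<in> carrier_mat n n" "i < n" "j < n" for B i j
  proof -
    have "(B * P) $$ (i, j) = (\<Sum>l<n. B $$ (i, l) * P $$ (l, j))"
      by (rule mult_mat_index_sum) (use P that in auto)
    also have "\<dots> = (\<Sum>l<n. if l = \<sigma> j then B $$ (i, \<sigma> j) else 0)"
      using that by (intro sum.cong) (auto simp: P_def)
    finally show ?thesis using s[OF that(3)] by simp
  qed
  have "P\<^sup>T * P = 1\<^sub>m n"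
  proof (rule eq_matI)
    fix i j assume "i < dim_row (1\<^sub>m n :: 'a mat)" "j < dim_col (1\<^sub>m n :: 'a mat)"
    hence ij: "i < n" "j < n" by auto
    thus "(P\<^sup>T * P) $$ (i, j) = 1\<^sub>m n $$ (i, j)"
      using left[OF P ij] s[OF ij(1)] inj_onD[OF \<sigma>(2), of i j] by (auto simp: P_def)
  qed (use P in auto)
  hence "det P \<noteq> 0" using det_nonzero_if_right_inverse[of "P\<^sup>T" n P] P det_transpose[OF P] by simp
  moreover have "P\<^sup>T * A * P = mat n n (\<lambda>(i, j). A $$ (\<sigma> i, \<sigma> j))"
  proof (rule eq_matI)
    fix i j assume "i < dim_row (mat n n (\<lambda>(i, j). A $$ (\<sigma> i, \<sigma> j)))" "j < dim_col (mat n n (\<lambda>(i, j). A $$ (\<sigma> i, \<sigma> j)))"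
    hence ij: "i < n" "j < n" by auto
    have PA: "P\<^sup>T * A \<in> carrier_mat n n" using P A by simp
    show "(P\<^sup>T * A * P) $$ (i, j) = mat n n (\<lambda>(i, j). A $$ (\<sigma> i, \<sigma> j)) $$ (i, j)"
      using right[OF PA ij] left[OF A ij(1) s[OF ij(2)]] ij by simp
  qed (use P A in auto)
  ultimately show ?thesis by (intro congruent_matI[OF A P])
qed

text \<open>The basis vectors of the two blocks are listed alternately, each block in reverse order.\<close>

lemma chain_block_congruent_jordan:
  assumes t: "t > 0"
  shows "congruent_mat (four_block_mat (0\<^sub>m t t) ((F_mat t)\<^sup>T) (G_mat t) (0\<^sub>m (t - 1) (t - 1)))
    (lower_jordan_block (2 * t - 1) (0::'a::field))"
proof -
  let ?N = "four_block_mat (0\<^sub>m t t) ((F_mat t)\<^sup>T) (G_mat t) (0\<^sub>m (t - 1) (t - 1)) :: 'a mat"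
  define s where "s = 2 * t - 1"
  have st: "s = t + (t - 1)" unfolding s_def using t by simp
  have N: "?N \<in> carrier_mat s s" unfolding st by simp
  define \<sigma> where "\<sigma> i = (if even i then t - 1 - i div 2 else t + (t - 2 - i div 2))" for i
  have range: "\<sigma> i < s" "even i \<Longrightarrow> \<sigma> i < t" "odd i \<Longrightarrow> t \<le> \<sigma> i" if "i < s" for i
  proof -
    have "t \<ge> 2" if "odd i" using \<open>i < s\<close> that unfolding s_def by (cases "t = 1") auto
    thus "\<sigma> i < s" "even i \<Longrightarrow> \<sigma> i < t" "odd i \<Longrightarrow> t \<le> \<sigma> i" unfolding \<sigma>_def st using t by auto
  qed
  have inj: "inj_on \<sigma> {..<s}"
  proof (rule inj_onI)
    fix i j assume ij: "i \<in> {..<s}" "j \<in> {..<s}" "\<sigma> i = \<sigma> j"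
    have par: "even i \<longleftrightarrow> even j" using range(2,3)[of i] range(2,3)[of j] ij by fastforce
    have b: "i div 2 < t" "j div 2 < t" "odd i \<Longrightarrow> i div 2 < t - 1" "odd j \<Longrightarrow> j div 2 < t - 1"
      using ij unfolding s_def by (auto elim!: oddE)
    have "i div 2 = j div 2"
    proof (cases "even i")
      case True
      hence "t - 1 - i div 2 = t - 1 - j div 2" using ij(3) par unfolding \<sigma>_def by simp
      thus ?thesis using b(1,2) by linarith
    next
      case False
      hence "t + (t - 2 - i div 2) = t + (t - 2 - j div 2)" using ij(3) par unfolding \<sigma>_def by simp
      thus ?thesis using b(3,4) False par by linarith
    qed
    thus "i = j" using par by (metis div_mult_mod_eq even_iff_mod_2_eq_zero not_mod_2_eq_0_eq_1)
  qed
  have "mat s s (\<lambda>(i, j). ?N $$ (\<sigma> i, \<sigma> j)) = lower_jordan_block s 0"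
  proof (rule eq_matI)
    fix i j assume "i < dim_row (lower_jordan_block s (0::'a))" "j < dim_col (lower_jordan_block s (0::'a))"
    hence ij: "i < s" "j < s" by auto
    have N_index: "?N $$ (\<sigma> i, \<sigma> j) = (if \<sigma> i < t then if \<sigma> j < t then 0 else (F_mat t)\<^sup>T $$ (\<sigma> i, \<sigma> j - t)
        else if \<sigma> j < t then G_mat t $$ (\<sigma> i - t, \<sigma> j) else 0)"
      using range(1)[OF ij(1)] range(1)[OF ij(2)] unfolding st
      by (subst index_mat_four_block(1)) auto
    have "?N $$ (\<sigma> i, \<sigma> j) = (if i = Suc j then 1 else 0)"
    proof (cases "even i")
      case i: True
      then obtain k where k: "i = 2 * k" by (elim evenE)
      have si: "\<sigma> i = t - 1 - k" "k < t" using k ij unfolding \<sigma>_def s_def by auto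
      show ?thesis
      proof (cases "even j")
        case True
        thus ?thesis unfolding N_index using i range(2)[OF ij(1)] range(2)[OF ij(2)] by auto
      next
        case False
        then obtain l where l: "j = 2 * l + 1" by (elim oddE)
        have sj: "\<sigma> j = t + (t - 2 - l)" "l < t - 1" using l ij unfolding \<sigma>_def s_def by auto
        have "?N $$ (\<sigma> i, \<sigma> j) = F_mat t $$ (t - 2 - l, t - 1 - k)"
          unfolding N_index using si sj by simp
        also have "\<dots> = (if t - 1 - k = t - 2 - l then 1 else 0)"
          using si sj by (simp add: F_mat_def)
        also have "t - 1 - k = t - 2 - l \<longleftrightarrow> i = Suc j" unfolding k l using si sj by auto
        finally show ?thesis .
      qed
    next
      case i: False
      then obtain k where k: "i = 2 * k + 1" by (elim oddE)
      have si: "\<sigma> i = t + (t - 2 - k)" "k < t - 1" using k ij unfolding \<sigma>_def s_def by auto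
      show ?thesis
      proof (cases "even j")
        case False
        thus ?thesis unfolding N_index using i range(3)[OF ij(1)] range(3)[OF ij(2)] by auto
      next
        case True
        then obtain l where l: "j = 2 * l" by (elim evenE)
        have sj: "\<sigma> j = t - 1 - l" "l < t" using l ij unfolding \<sigma>_def s_def by auto
        have "?N $$ (\<sigma> i, \<sigma> j) = G_mat t $$ (t - 2 - k, t - 1 - l)"
          unfolding N_index using si sj by simp
        also have "\<dots> = (if t - 1 - l = Suc (t - 2 - k) then 1 else 0)"
          using si sj by (simp add: G_mat_def)
        also have "t - 1 - l = Suc (t - 2 - k) \<longleftrightarrow> i = Suc j" unfolding k l using si sj by auto
        finally show ?thesis .
      qed
    qed
    thus "mat s s (\<lambda>(i, j). ?N $$ (\<sigma> i, \<sigma> j)) $$ (i, j) = lower_jordan_block s 0 $$ (i, j)"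
      using ij by (simp add: lower_jordan_block_index del: index_mat_four_block)
  qed auto
  moreover have "\<sigma> ` {..<s} \<subseteq> {..<s}" using range(1) by auto
  ultimately show ?thesis using congruent_reindex[OF N _ inj] unfolding s_def by simp
qed

text \<open>The solution of \<open>a i j + h (i + 1) j + h j i = 0\<close> with vanishing first row. Each equation links
  the unknown at \<open>(i + 1, j)\<close> with the one at \<open>(j, i)\<close>, whose indices have a smaller sum.\<close>

function zigzag :: "(nat \<Rightarrow> nat \<Rightarrow> 'a::ab_group_add) \<Rightarrow> nat \<Rightarrow> nat \<Rightarrow> 'a" where
  "zigzag a 0 j = 0"
| "zigzag a (Suc i) j = - a i j - zigzag a j i"
  by pat_completeness auto
termination by (relation "measure (\<lambda>(a, i, j). i + j)") auto

text \<open>The span of \<open>X\<close> is totally isotropic and paired by \<open>Y\<close> with its dual. Adding to \<open>Y\<close> a combination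
  \<open>X * H0\<close> makes the span of \<open>Z = Y + X * H0\<close> totally isotropic as well, so that the Gram matrix of \<open>X\<close>
  and \<open>Z\<close> is that of \<open>J\<close> up to the order of the basis. The vectors killed by \<open>H\<close> and \<open>W\<^sup>T\<close> form
  the complement: \<open>X\<close> pairs with them through \<open>W\<^sup>T\<close> and \<open>Y\<close> through \<open>H\<close>.\<close>

lemma chain_retraction_congruence_summand:
  fixes M :: "'a::field mat"
  assumes M: "M \<in> carrier_mat n n" and t: "t > 0" and r: "chain_retraction M n t X W Y H"
  shows "congruence_summand (lower_jordan_block (2 * t - 1) 0) M"
proof -
  have X: "X \<in> carrier_mat n t" and W: "W \<in> carrier_mat n (t - 1)" and Y: "Y \<in> carrier_mat n (t - 1)"
    and H: "H \<in> carrier_mat t n" and eq: "M * X = W * G_mat t" "M\<^sup>T * X = W * F_mat t"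
      "Y\<^sup>T * M = G_mat t * H" "Y\<^sup>T * M\<^sup>T = F_mat t * H" and YW: "Y\<^sup>T * W = 1\<^sub>m (t - 1)" and HX: "H * X = 1\<^sub>m t"
    using r unfolding chain_retraction_def by auto
  let ?F = "F_mat t :: 'a mat" and ?G = "G_mat t :: 'a mat"
  have XTM: "X\<^sup>T * M = ?F\<^sup>T * W\<^sup>T" "X\<^sup>T * M\<^sup>T = ?G\<^sup>T * W\<^sup>T"
    using arg_cong[OF eq(2), of transpose_mat] arg_cong[OF eq(1), of transpose_mat] X W M
    by (simp_all add: transpose_mult_dim)
  have MTY: "M\<^sup>T * Y = H\<^sup>T * ?G\<^sup>T" "M * Y = H\<^sup>T * ?F\<^sup>T"
    using arg_cong[OF eq(3), of transpose_mat] arg_cong[OF eq(4), of transpose_mat] Y H M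
    by (simp_all add: transpose_mult_dim)
  define S where "S = X\<^sup>T * M * X"
  define P where "P = X\<^sup>T * W"
  have S: "S \<in> carrier_mat t t" and P: "P \<in> carrier_mat t (t - 1)" unfolding S_def P_def using X W M by auto
  have SG: "S = P * ?G" unfolding S_def P_def using X W M eq(1) by (simp add: assoc_mult_dim)
  have "S\<^sup>T = X\<^sup>T * (M\<^sup>T * X)" unfolding S_def using X M by (simp add: transpose_mult_dim assoc_mult_dim)
  hence SF: "S\<^sup>T = P * ?F" unfolding P_def eq(2) using X W by (simp add: assoc_mult_dim)
  have SPG: "S $$ (i, j) = (if j = 0 then 0 else P $$ (i, j - 1))" if "i < t" "j < t" for i j
    unfolding SG by (rule mult_G_mat[OF P that])
  have SPF: "S $$ (j, i) = (if j < t - 1 then P $$ (i, j) else 0)" if "i < t" "j < t" for i j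
    using mult_F_mat[OF P that] S that unfolding SF[symmetric] by simp
  \<comment> \<open>\<open>S (i, j + 1) = S (j, i)\<close> lowers the sum of the indices\<close>
  have S0: "S $$ (i, j) = 0" if "i < t" "j < t" for i j
    using that
  proof (induction "i + j" arbitrary: i j rule: less_induct)
    case less
    show ?case
    proof (cases j)
      case 0
      thus ?thesis using SPG[OF less.prems] by simp
    next
      case (Suc j')
      have "S $$ (i, j) = P $$ (i, j')" using SPG[OF less.prems] Suc by simp
      also have "\<dots> = S $$ (j', i)" using SPF[of i j'] less.prems Suc by simp
      also have "\<dots> = 0" using less.hyps[of j' i] less.prems Suc by simp
      finally show ?thesis .
    qed
  qed
  have S_zero: "X\<^sup>T * M * X = 0\<^sub>m t t" unfolding S_def[symmetric] by (rule eq_matI) (use S S0 in auto)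
  have P_zero: "X\<^sup>T * W = 0\<^sub>m t (t - 1)" unfolding P_def[symmetric]
  proof (rule eq_matI)
    fix i j assume "i < dim_row (0\<^sub>m t (t - 1) :: 'a mat)" "j < dim_col (0\<^sub>m t (t - 1) :: 'a mat)"
    thus "P $$ (i, j) = 0\<^sub>m t (t - 1) $$ (i, j)" using SPG[of i "Suc j"] S0[of i "Suc j"] by simp
  qed (use P in auto)
  have WX: "W\<^sup>T * X = 0\<^sub>m (t - 1) t"
    using arg_cong[OF P_zero, of transpose_mat] X W by (simp add: transpose_mult_dim)
  have ST_zero: "X\<^sup>T * M\<^sup>T * X = 0\<^sub>m t t"
    using arg_cong[OF S_zero, of transpose_mat] X M by (simp add: transpose_mult_dim assoc_mult_dim)
  define A where "A = Y\<^sup>T * M * Y"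
  have A: "A \<in> carrier_mat (t - 1) (t - 1)" unfolding A_def using Y M by auto
  define H0 where "H0 = mat t (t - 1) (\<lambda>(i, j). zigzag (\<lambda>i j. A $$ (i, j)) i j)"
  have H0: "H0 \<in> carrier_mat t (t - 1)" unfolding H0_def by simp
  have zz: "A + (?G * H0 + (?F * H0)\<^sup>T) = 0\<^sub>m (t - 1) (t - 1)"
  proof (rule eq_matI)
    fix i j assume "i < dim_row (0\<^sub>m (t - 1) (t - 1) :: 'a mat)" "j < dim_col (0\<^sub>m (t - 1) (t - 1) :: 'a mat)"
    hence ij: "i < t - 1" "j < t - 1" by auto
    have "(?G * H0) $$ (i, j) = - A $$ (i, j) - zigzag (\<lambda>i j. A $$ (i, j)) j i"
      using G_mat_mult[OF H0 ij] ij by (simp add: H0_def)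
    moreover have "(?F * H0) $$ (j, i) = zigzag (\<lambda>i j. A $$ (i, j)) j i"
      using F_mat_mult[OF H0 ij(2,1)] ij by (simp add: H0_def)
    ultimately show "(A + (?G * H0 + (?F * H0)\<^sup>T)) $$ (i, j) = 0\<^sub>m (t - 1) (t - 1) $$ (i, j)"
      using ij A H0 by (simp del: index_mult_mat(1))
  qed (use A H0 in auto)
  define Z where "Z = Y + X * H0"
  have Z: "Z \<in> carrier_mat n (t - 1)" unfolding Z_def using Y X H0 by auto
  have YX: "Y\<^sup>T * M * X = ?G" using Y M X H HX unfolding eq(3) by (simp add: assoc_mult_dim)
  have YTX: "Y\<^sup>T * M\<^sup>T * X = ?F" using Y M X H HX unfolding eq(4) by (simp add: assoc_mult_dim)
  have ZT: "Z\<^sup>T = Y\<^sup>T + H0\<^sup>T * X\<^sup>T" unfolding Z_def using Y X H0 by (simp add: transpose_add_dim transpose_mult_dim)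
  have ZX: "Z\<^sup>T * M * X = ?G"
  proof -
    have "Z\<^sup>T * M * X = Y\<^sup>T * M * X + H0\<^sup>T * (X\<^sup>T * M * X)"
      unfolding ZT using Y X H0 M by (simp add: add_mult_dim assoc_mult_dim)
    thus ?thesis unfolding S_zero YX using H0 right_add_zero_mat[OF G_mat_carrier] by simp
  qed
  have ZTX: "Z\<^sup>T * M\<^sup>T * X = ?F"
  proof -
    have "Z\<^sup>T * M\<^sup>T * X = Y\<^sup>T * M\<^sup>T * X + H0\<^sup>T * (X\<^sup>T * M\<^sup>T * X)"
      unfolding ZT using Y X H0 M by (simp add: add_mult_dim assoc_mult_dim)
    thus ?thesis unfolding ST_zero YTX using H0 right_add_zero_mat[OF F_mat_carrier] by simp
  qed
  have XZ: "X\<^sup>T * M * Z = ?F\<^sup>T"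
    using arg_cong[OF ZTX, of transpose_mat] Z X M by (simp add: transpose_mult_dim assoc_mult_dim)
  have ZZ: "Z\<^sup>T * M * Z = 0\<^sub>m (t - 1) (t - 1)"
  proof -
    have "X\<^sup>T * M * Y = ?F\<^sup>T"
      using arg_cong[OF YTX, of transpose_mat] Y X M by (simp add: transpose_mult_dim assoc_mult_dim)
    hence "Z\<^sup>T * M * Y = A + H0\<^sup>T * ?F\<^sup>T"
      unfolding ZT A_def using Y X H0 M by (simp add: add_mult_dim assoc_mult_dim)
    moreover have "Z\<^sup>T * M * (X * H0) = ?G * H0" unfolding ZX[symmetric] using Z M X H0 by (simp add: assoc_mult_dim)
    moreover have "Z\<^sup>T * M * Z = Z\<^sup>T * M * Y + Z\<^sup>T * M * (X * H0)"
      unfolding Z_def[symmetric] by (subst (2) Z_def) (use Z M X Y H0 in \<open>simp add: mult_add_dim\<close>)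
    ultimately have "Z\<^sup>T * M * Z = A + H0\<^sup>T * ?F\<^sup>T + ?G * H0" by simp
    also have "\<dots> = A + (?G * H0 + (?F * H0)\<^sup>T)"
      using A H0 by (intro eq_matI) (auto simp: transpose_mult_dim simp del: index_mult_mat(1))
    finally show ?thesis unfolding zz .
  qed
  have WZ: "W\<^sup>T * Z = 1\<^sub>m (t - 1)"
  proof -
    have "W\<^sup>T * Y = 1\<^sub>m (t - 1)" using arg_cong[OF YW, of transpose_mat] Y W by (simp add: transpose_mult_dim)
    moreover have "W\<^sup>T * Z = W\<^sup>T * Y + W\<^sup>T * X * H0" unfolding Z_def using W Y X H0 by (simp add: mult_add_dim assoc_mult_dim)
    ultimately show ?thesis unfolding WX using H0 by simp
  qed
  \<comment> \<open>\<open>H1\<close> and \<open>W\<^sup>T\<close> are the dual basis of \<open>X\<close> and \<open>Z\<close>\<close>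
  define H1 where "H1 = H - H * Z * W\<^sup>T"
  have H1: "H1 \<in> carrier_mat t n" unfolding H1_def using H Z W by (intro minus_carrier_mat) auto
  have WT: "W\<^sup>T \<in> carrier_mat (t - 1) n" using W by simp
  have "1\<^sub>m t - 0\<^sub>m t t = (1\<^sub>m t :: 'a mat)" by (rule eq_matI) auto
  hence HX1: "H1 * X = 1\<^sub>m t" unfolding H1_def using H Z W X HX WX by (simp add: minus_mult_dim assoc_mult_dim)
  have HZ1: "H1 * Z = 0\<^sub>m t (t - 1)" unfolding H1_def using H Z W WZ by (simp add: minus_mult_dim assoc_mult_dim)
  define U where "U = hcat X Z"
  define U' where "U' = vcat H1 (W\<^sup>T)"
  have U: "U \<in> carrier_mat n (t + (t - 1))" and U': "U' \<in> carrier_mat (t + (t - 1)) n"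
    unfolding U_def U'_def using hcat_carrier[OF X Z] vcat_carrier[OF H1 WT] by auto
  have "U' * U = 1\<^sub>m (t + (t - 1))"
    unfolding U_def U'_def by (simp add: vcat_mult_hcat[OF H1 WT X Z] HX1 HZ1 WX WZ)
  then obtain V B m where V: "n = t + (t - 1) + m" "V \<in> carrier_mat n m" "B \<in> carrier_mat m n"
      "U' * V = 0\<^sub>m (t + (t - 1)) m" "U * U' + V * B = 1\<^sub>m n"
    using complete_left_inverse[OF U' U] by metis
  have HV1: "H1 * V = 0\<^sub>m t m" and WV: "W\<^sup>T * V = 0\<^sub>m (t - 1) m"
    using vcat_eq_zero[of "H1 * V" "W\<^sup>T * V" t "t - 1" m] V(4) vcat_mult[of H1 V "W\<^sup>T"] H1 WT V(2)
    unfolding U'_def by auto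
  have HV: "H * V = 0\<^sub>m t m"
  proof -
    have "H1 * V = H * V - H * Z * (W\<^sup>T * V)"
      unfolding H1_def using H Z W V(2) by (simp add: minus_mult_dim assoc_mult_dim)
    hence "H * V - 0\<^sub>m t m = 0\<^sub>m t m" unfolding HV1 WV using H Z by simp
    moreover have "H * V - 0\<^sub>m t m = H * V" using H V(2) by (intro eq_matI) auto
    ultimately show ?thesis by simp
  qed
  have XV: "X\<^sup>T * M * V = 0\<^sub>m t m" unfolding XTM using W V(2) WV by (simp add: assoc_mult_dim)
  have XTV: "X\<^sup>T * M\<^sup>T * V = 0\<^sub>m t m" unfolding XTM using W V(2) WV by (simp add: assoc_mult_dim)
  have YV: "Y\<^sup>T * M * V = 0\<^sub>m (t - 1) m" unfolding eq(3) using H V(2) HV by (simp add: assoc_mult_dim)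
  have YTV: "Y\<^sup>T * M\<^sup>T * V = 0\<^sub>m (t - 1) m" unfolding eq(4) using H V(2) HV by (simp add: assoc_mult_dim)
  have ZV: "Z\<^sup>T * N * V = 0\<^sub>m (t - 1) m"
    if "N \<in> carrier_mat n n" "X\<^sup>T * N * V = 0\<^sub>m t m" "Y\<^sup>T * N * V = 0\<^sub>m (t - 1) m" for N
  proof -
    have "Z\<^sup>T * N * V = Y\<^sup>T * N * V + H0\<^sup>T * (X\<^sup>T * N * V)"
      unfolding ZT using Y X H0 that(1) V(2) by (simp add: add_mult_dim assoc_mult_dim)
    thus ?thesis unfolding that using H0 by simp
  qed
  have UV: "U\<^sup>T * N * V = 0\<^sub>m (t + (t - 1)) m"
    if "N \<in> carrier_mat n n" "X\<^sup>T * N * V = 0\<^sub>m t m" "Y\<^sup>T * N * V = 0\<^sub>m (t - 1) m" for N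
  proof -
    have "U\<^sup>T * N * V = vcat (X\<^sup>T * N * V) (Z\<^sup>T * N * V)"
      unfolding U_def using X Z that(1) V(2) by (simp add: transpose_hcat vcat_mult)
    thus ?thesis unfolding that(2) ZV[OF that] by (auto simp: vcat_def intro!: eq_matI)
  qed
  have MT: "M\<^sup>T \<in> carrier_mat n n" using M by simp
  have "V\<^sup>T * M * U = (U\<^sup>T * M\<^sup>T * V)\<^sup>T" using U M V(2) by (simp add: transpose_mult_dim assoc_mult_dim)
  also have "\<dots> = 0\<^sub>m m (t + (t - 1))" unfolding UV[OF MT XTV YTV] by simp
  finally have "congruence_summand (U\<^sup>T * M * U) M"
    by (intro congruent_split[OF M U' U V(2,3,1,5) UV[OF M XV YV]])
  moreover have "U\<^sup>T * M * U = four_block_mat (0\<^sub>m t t) (?F\<^sup>T) ?G (0\<^sub>m (t - 1) (t - 1))"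
  proof -
    have c: "X\<^sup>T * M \<in> carrier_mat t n" "Z\<^sup>T * M \<in> carrier_mat (t - 1) n" using X Z M by auto
    have "U\<^sup>T * M * U = vcat (X\<^sup>T * M) (Z\<^sup>T * M) * hcat X Z"
      unfolding U_def using X Z M by (simp add: transpose_hcat vcat_mult)
    thus ?thesis unfolding vcat_mult_hcat[OF c X Z] S_zero XZ ZX ZZ .
  qed
  ultimately show ?thesis using congruence_summand_congruent[OF chain_block_congruent_jordan[OF t]] by simp
qed

lemma chain_imp_summands:
  fixes M :: "'a::field mat"
  assumes M: "M \<in> carrier_mat n n" and c: "singular_chain M t x"
  shows "\<exists>s. odd s \<and> congruence_summand (lower_jordan_block s 0) M"
    and "\<exists>t>0. equivalence_summand (F_mat t, G_mat t) (M\<^sup>T, M)"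
proof -
  obtain u y where min: "minimal_chain M u y" using minimal_chain_exists[OF c] .
  obtain X W Y H where r: "chain_retraction M n u X W Y H" using minimal_chain_retraction[OF M min] .
  have u: "u > 0" by (rule minimal_chain_last[OF min])
  have "odd (2 * u - 1)" using u by auto
  with chain_retraction_congruence_summand[OF M u r]
  show "\<exists>s. odd s \<and> congruence_summand (lower_jordan_block s 0) M" by blast
  from chain_retraction_equivalence_summand[OF M r] u
  show "\<exists>t>0. equivalence_summand (F_mat t, G_mat t) (M\<^sup>T, M)" by blast
qed

section \<open>Uniqueness over algebraically closed fields\<close>

lemma mult_smult_dim:
  fixes A B :: "'a::comm_ring_1 mat"
  assumes "dim_col A = dim_row B"
  shows "A * (k \<cdot>\<^sub>m B) = k \<cdot>\<^sub>m (A * B)"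
  by (rule mult_smult_distrib[of A "dim_row A" "dim_row B" B "dim_col B"]) (use assms in \<open>auto intro: carrier_matI\<close>)

lemma smult_mult_dim:
  fixes A B :: "'a::comm_ring_1 mat"
  assumes "dim_col A = dim_row B"
  shows "(k \<cdot>\<^sub>m A) * B = k \<cdot>\<^sub>m (A * B)"
  by (rule mult_smult_assoc_mat[of A "dim_row A" "dim_row B" B "dim_col B"]) (use assms in \<open>auto intro: carrier_matI\<close>)

lemma lower_jordan_block_mult:
  fixes X :: "'a::field mat"
  assumes X: "X \<in> carrier_mat r n" and ij: "i < r" "j < n"
  shows "(lower_jordan_block r 1 * X) $$ (i, j) = X $$ (i, j) + (if i = 0 then 0 else X $$ (i - 1, j))"
proof -
  have "(lower_jordan_block r 1 * X) $$ (i, j) = (\<Sum>l<r. lower_jordan_block r 1 $$ (i, l) * X $$ (l, j))"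
    by (rule mult_mat_index_sum[OF _ X ij]) simp
  also have "\<dots> = (\<Sum>l<r. (if l = i then X $$ (l, j) else 0) + (if l = i - 1 then (if i = 0 then 0 else X $$ (l, j)) else 0))"
    using ij by (intro sum.cong) (auto simp: lower_jordan_block_index)
  also have "\<dots> = X $$ (i, j) + (if i = 0 then 0 else X $$ (i - 1, j))"
    using ij by (simp add: sum.distrib)
  finally show ?thesis .
qed

text \<open>Comparing the entries of both products gives \<open>Y(i, j + 1) = Y(i - 1, j)\<close>, where entries outside
  the matrix count as \<open>0\<close>.\<close>

lemma commutes_with_jordan_block:
  fixes Y :: "'a::field mat"
  assumes Y: "Y \<in> carrier_mat r r" and comm: "lower_jordan_block r 1 * Y = Y * lower_jordan_block r 1"
  shows "\<And>i j. i < j \<Longrightarrow> j < r \<Longrightarrow> Y $$ (i, j) = 0" and "\<And>i. i < r \<Longrightarrow> Y $$ (i, i) = Y $$ (0, 0)"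
proof -
  have step: "(if Suc j < r then Y $$ (i, Suc j) else 0) = (if i = 0 then 0 else Y $$ (i - 1, j))"
    if "i < r" "j < r" for i j
    using lower_jordan_block_mult[OF Y that] mult_lower_jordan_block[OF Y that] comm by simp
  show "Y $$ (i, j) = 0" if "i < j" "j < r" for i j
    using that
  proof (induction i arbitrary: j)
    case 0
    thus ?case using step[of 0 "j - 1"] by simp
  next
    case (Suc i)
    thus ?case using step[of "Suc i" "j - 1"] Suc.IH[of "j - 1"] by simp
  qed
  show "Y $$ (i, i) = Y $$ (0, 0)" if "i < r" for i
    using that
  proof (induction i)
    case (Suc i)
    thus ?case using step[of "Suc i" i] by simp
  qed simp
qed

text \<open>The first \<open>k\<close> diagonals, counted downwards from the main diagonal, and everything above them
  vanish.\<close>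

definition lower_depth :: "nat \<Rightarrow> nat \<Rightarrow> 'a::zero mat \<Rightarrow> bool" where
  "lower_depth r k A \<longleftrightarrow> (\<forall>i<r. \<forall>j<r. i < j + k \<longrightarrow> A $$ (i, j) = 0)"

lemma lower_depth_mult:
  fixes A B :: "'a::field mat"
  assumes A: "A \<in> carrier_mat r r" "lower_depth r a A" and B: "B \<in> carrier_mat r r" "lower_depth r b B"
  shows "lower_depth r (a + b) (A * B)"
  unfolding lower_depth_def
proof (intro allI impI)
  fix i j assume ij: "i < r" "j < r" "i < j + (a + b)"
  have "(A * B) $$ (i, j) = (\<Sum>l<r. A $$ (i, l) * B $$ (l, j))"
    by (rule mult_mat_index_sum[OF A(1) B(1) ij(1,2)])
  also have "\<dots> = 0"
  proof (rule sum.neutral, rule ballI)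
    fix l assume "l \<in> {..<r}"
    hence l: "l < r" by simp
    show "A $$ (i, l) * B $$ (l, j) = 0"
    proof (cases "i < l + a")
      case True
      thus ?thesis using A(2) ij l unfolding lower_depth_def by simp
    next
      case False
      hence "l < j + b" using ij(3) by simp
      thus ?thesis using B(2) ij l unfolding lower_depth_def by simp
    qed
  qed
  finally show "(A * B) $$ (i, j) = 0" .
qed

text \<open>Newton's iteration \<open>X - (X * X - Y) / (2 * c)\<close> for the square root, with the inverse of the
  derivative frozen at the starting point \<open>c\<close>. Each step moves the error \<open>X * X - Y\<close> one diagonal
  further away from the main diagonal, and \<open>X\<close> stays selfadjoint and commutes with \<open>Y\<close>.\<close>

lemma selfadjoint_square_root:
  fixes G Y :: "'a::field mat"
  assumes G: "G \<in> carrier_mat r r" and Y: "Y \<in> carrier_mat r r" and adj: "G * Y = Y\<^sup>T * G"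
    and low: "\<And>i j. i < j \<Longrightarrow> j < r \<Longrightarrow> Y $$ (i, j) = 0" and diag: "\<And>i. i < r \<Longrightarrow> Y $$ (i, i) = c * c"
    and c: "c \<noteq> 0" and two: "(2::'a) \<noteq> 0"
  obtains X where "X \<in> carrier_mat r r" "G * X = X\<^sup>T * G" "X * X = Y"
proof -
  \<comment> \<open>\<open>X\<close> keeps the diagonal \<open>c\<close>, so that \<open>2 * c\<close> stays a good enough derivative\<close>
  have "\<exists>X. X \<in> carrier_mat r r \<and> G * X = X\<^sup>T * G \<and> X * Y = Y * X \<and>
      lower_depth r 1 (X - c \<cdot>\<^sub>m 1\<^sub>m r) \<and> lower_depth r (Suc k) (X * X - Y)" for k
  proof (induction k)
    case 0
    show ?case
    proof (intro exI conjI)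
      show "c \<cdot>\<^sub>m 1\<^sub>m r \<in> carrier_mat r r" by simp
      have T: "(c \<cdot>\<^sub>m 1\<^sub>m r)\<^sup>T = c \<cdot>\<^sub>m 1\<^sub>m r" by (rule eq_matI) auto
      show "G * (c \<cdot>\<^sub>m 1\<^sub>m r) = (c \<cdot>\<^sub>m 1\<^sub>m r)\<^sup>T * G" unfolding T using G by (simp add: mult_smult_dim smult_mult_dim)
      show "c \<cdot>\<^sub>m 1\<^sub>m r * Y = Y * (c \<cdot>\<^sub>m 1\<^sub>m r)" using Y by (simp add: mult_smult_dim smult_mult_dim)
      show "lower_depth r 1 (c \<cdot>\<^sub>m 1\<^sub>m r - c \<cdot>\<^sub>m 1\<^sub>m r)" unfolding lower_depth_def by simp
      have "(c \<cdot>\<^sub>m 1\<^sub>m r) * (c \<cdot>\<^sub>m 1\<^sub>m r) = c \<cdot>\<^sub>m (c \<cdot>\<^sub>m 1\<^sub>m r)" by (simp add: mult_smult_dim smult_mult_dim)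
      thus "lower_depth r (Suc 0) ((c \<cdot>\<^sub>m 1\<^sub>m r) * (c \<cdot>\<^sub>m 1\<^sub>m r) - Y)"
        unfolding lower_depth_def using Y low diag by (auto simp: less_Suc_eq)
    qed
  next
    case (Suc k)
    then obtain X where X: "X \<in> carrier_mat r r" "G * X = X\<^sup>T * G" "X * Y = Y * X"
      "lower_depth r 1 (X - c \<cdot>\<^sub>m 1\<^sub>m r)" "lower_depth r (Suc k) (X * X - Y)" by blast
    define E where "E = X * X - Y"
    define d where "d = 1 / (2 * c)"
    define Z where "Z = X - d \<cdot>\<^sub>m E"
    have E: "E \<in> carrier_mat r r" unfolding E_def using Y by (rule minus_carrier_mat)
    have Z: "Z \<in> carrier_mat r r" unfolding Z_def using E by (intro minus_carrier_mat) auto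
    have EX: "E * X = X * E" unfolding E_def using X Y by (simp add: mult_minus_dim minus_mult_dim assoc_mult_dim)
    have "X * X * Y = Y * (X * X)"
    proof -
      have "X * X * Y = X * (X * Y)" using X(1) Y by (simp add: assoc_mult_dim)
      also have "\<dots> = X * (Y * X)" unfolding X(3) ..
      also have "\<dots> = X * Y * X" using X(1) Y by (simp add: assoc_mult_dim)
      also have "\<dots> = Y * (X * X)" unfolding X(3) using X(1) Y by (simp add: assoc_mult_dim)
      finally show ?thesis .
    qed
    hence EY: "E * Y = Y * E" unfolding E_def using X(1) Y by (simp add: mult_minus_dim minus_mult_dim)
    have GE: "G * E = E\<^sup>T * G"
    proof -
      have "G * (X * X) = G * X * X" using G X(1) by (simp add: assoc_mult_dim)
      also have "\<dots> = X\<^sup>T * (G * X)" using G X(1) by (simp add: X(2) assoc_mult_dim)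
      also have "\<dots> = (X * X)\<^sup>T * G" unfolding X(2) using G X(1) by (simp add: assoc_mult_dim transpose_mult_dim)
      finally have GXX: "G * (X * X) = (X * X)\<^sup>T * G" .
      have "G * E = G * (X * X) - G * Y" unfolding E_def using G X(1) Y by (simp add: mult_minus_dim)
      also have "\<dots> = ((X * X)\<^sup>T - Y\<^sup>T) * G" unfolding GXX adj using G X(1) Y by (simp add: minus_mult_dim)
      also have "(X * X)\<^sup>T - Y\<^sup>T = E\<^sup>T" unfolding E_def using X(1) Y by (intro transpose_minus_dim[symmetric]) auto
      finally show ?thesis .
    qed
    have EE: "lower_depth r (Suc k + Suc k) (E * E)"
      using lower_depth_mult[OF E _ E, of "Suc k" "Suc k"] X(5) unfolding E_def by simp
    have Xc: "X - c \<cdot>\<^sub>m 1\<^sub>m r \<in> carrier_mat r r" by (intro minus_carrier_mat) simp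
    have XE: "lower_depth r (1 + Suc k) ((X - c \<cdot>\<^sub>m 1\<^sub>m r) * E)"
      using lower_depth_mult[OF Xc X(4) E] X(5) unfolding E_def by simp
    have XE': "(X - c \<cdot>\<^sub>m 1\<^sub>m r) * E = X * E - c \<cdot>\<^sub>m E"
      using X(1) E by (simp add: minus_mult_dim smult_mult_dim)
    have ZZ: "Z * Z = (X * X - d \<cdot>\<^sub>m (X * E)) - (d \<cdot>\<^sub>m (X * E) - d \<cdot>\<^sub>m (d \<cdot>\<^sub>m (E * E)))"
    proof -
      have "Z * Z = (X - d \<cdot>\<^sub>m E) * X - (X - d \<cdot>\<^sub>m E) * (d \<cdot>\<^sub>m E)"
        unfolding Z_def using X(1) E by (simp add: mult_minus_dim)
      also have "(X - d \<cdot>\<^sub>m E) * X = X * X - d \<cdot>\<^sub>m (X * E)"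
        using X(1) E EX by (simp add: minus_mult_dim smult_mult_dim)
      also have "(X - d \<cdot>\<^sub>m E) * (d \<cdot>\<^sub>m E) = d \<cdot>\<^sub>m (X * E) - d \<cdot>\<^sub>m (d \<cdot>\<^sub>m (E * E))"
      proof -
        have "(X - d \<cdot>\<^sub>m E) * (d \<cdot>\<^sub>m E) = X * (d \<cdot>\<^sub>m E) - (d \<cdot>\<^sub>m E) * (d \<cdot>\<^sub>m E)"
          using X(1) E by (intro minus_mult_dim) auto
        thus ?thesis using X(1) E by (simp add: smult_mult_dim mult_smult_dim)
      qed
      finally show ?thesis .
    qed
    show ?case
    proof (intro exI conjI)
      show "Z \<in> carrier_mat r r" by (rule Z)
      have ZT: "Z\<^sup>T = X\<^sup>T - d \<cdot>\<^sub>m E\<^sup>T" unfolding Z_def by (rule eq_matI) (use X(1) E in auto)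
      show "G * Z = Z\<^sup>T * G"
        unfolding ZT unfolding Z_def using G X(1,2) E GE by (simp add: mult_minus_dim minus_mult_dim mult_smult_dim smult_mult_dim)
      show "Z * Y = Y * Z"
        unfolding Z_def using Y X(1,3) E EY by (simp add: mult_minus_dim minus_mult_dim mult_smult_dim smult_mult_dim)
      show "lower_depth r 1 (Z - c \<cdot>\<^sub>m 1\<^sub>m r)"
        using X(1,4,5) E unfolding lower_depth_def E_def[symmetric] Z_def by simp
      show "lower_depth r (Suc (Suc k)) (Z * Z - Y)"
        unfolding lower_depth_def
      proof (intro allI impI)
        fix i j assume ij: "i < r" "j < r" "i < j + Suc (Suc k)"
        have e0: "(E * E) $$ (i, j) = 0" using EE ij unfolding lower_depth_def by simp
        have "(X * E - c \<cdot>\<^sub>m E) $$ (i, j) = 0" using XE ij unfolding lower_depth_def XE' by simp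
        hence xe: "(X * E) $$ (i, j) = c * E $$ (i, j)" using X(1) E ij by (simp del: index_mult_mat(1))
        have "(Z * Z - Y) $$ (i, j) = (X * X) $$ (i, j) - Y $$ (i, j) - 2 * (d * (X * E) $$ (i, j)) + d * (d * (E * E) $$ (i, j))"
          unfolding ZZ using X(1) E Y ij by (simp add: algebra_simps del: index_mult_mat(1))
        also have "(X * X) $$ (i, j) - Y $$ (i, j) = E $$ (i, j)"
          unfolding E_def using X(1) Y ij by (simp del: index_mult_mat(1))
        finally show "(Z * Z - Y) $$ (i, j) = 0" unfolding e0 xe d_def using c two by simp
      qed
    qed
  qed
  then obtain X where X: "X \<in> carrier_mat r r" "G * X = X\<^sup>T * G" "lower_depth r (Suc r) (X * X - Y)" by blast
  have "X * X = Y"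
  proof (rule eq_matI)
    fix i j assume "i < dim_row Y" "j < dim_col Y"
    hence ij: "i < r" "j < r" using Y by auto
    hence "(X * X - Y) $$ (i, j) = 0" using X(3) unfolding lower_depth_def by simp
    thus "(X * X) $$ (i, j) = Y $$ (i, j)" using X(1) Y ij by (simp del: index_mult_mat(1))
  qed (use X Y in auto)
  thus ?thesis using that X by blast
qed

text \<open>The quotient \<open>Y\<close> of the two forms, \<open>Q = G * Y\<close>, commutes with the common cosquare and is
  selfadjoint for \<open>G\<close>. A selfadjoint square root \<open>X\<close> of \<open>Y\<close> gives \<open>X\<^sup>T * G * X = G * X * X = Q\<close>.\<close>

lemma same_jordan_cosquare_congruent:
  fixes G Q :: "'a::field mat"
  assumes ac: "algebraically_closed TYPE('a)" and two: "(2::'a) \<noteq> 0" and r: "r > 0"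
    and G: "G \<in> carrier_mat r r" "det G \<noteq> 0" "G = G\<^sup>T * lower_jordan_block r 1"
    and Q: "Q \<in> carrier_mat r r" "det Q \<noteq> 0" "Q = Q\<^sup>T * lower_jordan_block r 1"
  shows "congruent_mat G Q"
proof -
  let ?L = "lower_jordan_block r (1::'a)"
  have iso: "?L\<^sup>T * K * ?L = K" if "K \<in> carrier_mat r r" "K = K\<^sup>T * ?L" for K
  proof -
    have "K\<^sup>T = ?L\<^sup>T * K" using arg_cong[OF that(2), of transpose_mat] that(1) transpose_mult_dim[of "K\<^sup>T" ?L] by simp
    thus ?thesis using that(2) by simp
  qed
  obtain I where I: "I \<in> carrier_mat r r" "G * I = 1\<^sub>m r" using obtain_inverse[OF G(1,2)] by metis
  define Y where "Y = I * Q"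
  have Y: "Y \<in> carrier_mat r r" unfolding Y_def using I Q by auto
  have GY: "G * Y = Q" unfolding Y_def using I G Q mult_eq_assoc[OF I(2), of Q] by simp
  have LG: "?L\<^sup>T * G \<in> carrier_mat r r" "det (?L\<^sup>T * G) \<noteq> 0"
    using G(1,2) det_mult[of "?L\<^sup>T" r G] det_transpose[of ?L r] det_lower_jordan_block[of r "1::'a"] by auto
  have comm: "?L * Y = Y * ?L"
  proof (rule mult_left_cancel_invertible[OF LG])
    have "?L\<^sup>T * G * (?L * Y) = ?L\<^sup>T * G * ?L * Y" using G Y by (simp add: assoc_mult_dim)
    also have "\<dots> = ?L\<^sup>T * Q * ?L" unfolding iso[OF G(1,3)] iso[OF Q(1,3)] GY ..
    also have "\<dots> = ?L\<^sup>T * G * (Y * ?L)" unfolding GY[symmetric] using G Y by (simp add: assoc_mult_dim)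
    finally show "?L\<^sup>T * G * (?L * Y) = ?L\<^sup>T * G * (Y * ?L)" .
  qed (use Y in auto)
  have adj: "G * Y = Y\<^sup>T * G"
  proof -
    have "Q = (G * Y)\<^sup>T * ?L" unfolding GY by (rule Q(3))
    also have "\<dots> = Y\<^sup>T * (G\<^sup>T * ?L)" using G(1) Y by (simp add: transpose_mult_dim assoc_mult_dim)
    finally show ?thesis unfolding GY G(3)[symmetric] .
  qed
  note str = commutes_with_jordan_block[OF Y comm]
  define y where "y = Y $$ (0, 0)"
  have dY: "det Y \<noteq> 0" using det_mult[OF G(1) Y] GY Q(2) by auto
  have "det Y = prod_list (diag_mat Y)" by (rule det_lower_triangular[OF _ Y]) (use str in auto)
  moreover have "y \<in> set (diag_mat Y)" unfolding y_def diag_mat_def using r Y by force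
  ultimately have "y \<noteq> 0" using dY by (auto simp: prod_list_zero_iff)
  have "degree [:- y, 0, 1:] > 0" by simp
  then obtain c where "poly [:- y, 0, 1:] c = 0" using ac unfolding algebraically_closed_def by blast
  hence c: "y = c * c" by (simp add: algebra_simps)
  hence "c \<noteq> 0" using \<open>y \<noteq> 0\<close> by auto
  have diag: "Y $$ (i, i) = c * c" if "i < r" for i unfolding str(2)[OF that] using c unfolding y_def .
  obtain X where X: "X \<in> carrier_mat r r" "G * X = X\<^sup>T * G" "X * X = Y"
    using selfadjoint_square_root[OF G(1) Y adj str(1) diag \<open>c \<noteq> 0\<close> two] .
  have "det X \<noteq> 0" using dY det_mult[OF X(1,1)] X(3) by auto
  moreover have "X\<^sup>T * G * X = Q"
    unfolding X(2)[symmetric] GY[symmetric] X(3)[symmetric] using G(1) X(1) by (simp add: assoc_mult_dim)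
  ultimately show ?thesis by (intro congruent_matI[OF G(1) X(1)])
qed

text \<open>A basis in which the cosquare becomes the Jordan block itself also serves as a congruence.\<close>

lemma has_jordan_cosquare_congruent_normal:
  fixes Q :: "'a::field mat"
  assumes "has_jordan_cosquare r Q"
  obtains K where "K \<in> carrier_mat r r" "det K \<noteq> 0" "K = K\<^sup>T * lower_jordan_block r 1" "congruent_mat Q K"
proof -
  note Q = has_jordan_cosquare_carrier[OF assms]
  obtain P where P: "P \<in> carrier_mat r r" "det P \<noteq> 0" "Q * P = Q\<^sup>T * P * lower_jordan_block r 1"
    using has_jordan_cosquareE[OF assms] .
  have K: "P\<^sup>T * Q * P \<in> carrier_mat r r" using P Q by auto
  have "det (P\<^sup>T * Q * P) \<noteq> 0"
    using det_mult[of "P\<^sup>T * Q" r P] det_mult[of "P\<^sup>T" r Q] P Q det_transpose[OF P(1)] by auto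
  from that[OF K this invariant_gram_isometric(1)[OF Q(1) P(1) lower_jordan_block_carrier P(3)]]
  show ?thesis using congruent_matI[OF Q(1) P(1,2) refl] .
qed

lemma jordan_cosquare_congruent:
  fixes G Q :: "'a::field mat"
  assumes "algebraically_closed TYPE('a)" "(2::'a) \<noteq> 0" "r > 0"
    and "has_jordan_cosquare r Q" "has_jordan_cosquare r G"
  shows "congruent_mat Q G"
proof -
  obtain K where K: "K \<in> carrier_mat r r" "det K \<noteq> 0" "K = K\<^sup>T * lower_jordan_block r 1" "congruent_mat Q K"
    using has_jordan_cosquare_congruent_normal[OF assms(4)] .
  obtain N where N: "N \<in> carrier_mat r r" "det N \<noteq> 0" "N = N\<^sup>T * lower_jordan_block r 1" "congruent_mat G N"
    using has_jordan_cosquare_congruent_normal[OF assms(5)] .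
  show ?thesis
    using congruent_mat_trans[OF K(4) congruent_mat_trans[OF
      same_jordan_cosquare_congruent[OF assms(1-3) K(1-3) N(1-3)] congruent_mat_sym[OF N(4)]]] .
qed

section \<open>The characterisation\<close>

lemma two_neq_zero:
  assumes "CHAR('a::field) \<noteq> 2"
  shows "(2::'a) \<noteq> 0"
proof
  assume "(2::'a) = 0"
  hence "of_nat 2 = (0::'a)" by simp
  hence "CHAR('a) dvd 2" by (simp only: of_nat_eq_0_iff_char_dvd)
  hence "CHAR('a) \<noteq> 0" "CHAR('a) \<le> 2" by (auto intro!: Nat.gr0I dest: dvd_imp_le)
  moreover have "CHAR('a) \<noteq> 1" by simp
  ultimately show False using assms by linarith
qed

theorem theorem3:
  fixes M :: "'a::field mat"
  assumes "CHAR('a) \<noteq> 2"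
    and "M \<in> carrier_mat n n"
  shows
    "(M \<notin> Xi n \<longleftrightarrow>
        (\<exists>r Q. odd r \<and> has_jordan_cosquare r Q \<and> congruence_summand Q M) \<or>
        (\<exists>s. odd s \<and> congruence_summand (lower_jordan_block s 0) M)) \<and>
     (M \<notin> Xi n \<longleftrightarrow>
        (\<exists>r. odd r \<and> equivalence_summand (1\<^sub>m r, lower_jordan_block r 1) (M\<^sup>T, M)) \<or>
        (\<exists>t>0. equivalence_summand (F_mat t, G_mat t) (M\<^sup>T, M))) \<and>
     (invertible_mat M \<longrightarrow>
        (M \<notin> Xi n \<longleftrightarrow>
           (\<exists>r. odd r \<and> similarity_summand (lower_jordan_block r 1) (cosquare M)))) \<and>
     (algebraically_closed TYPE('a) \<longrightarrow>
        (\<forall>r. odd r \<longrightarrow>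
           has_jordan_cosquare r (Gamma_mat r :: 'a mat) \<and>
           (\<forall>Q :: 'a mat. has_jordan_cosquare r Q \<longrightarrow> congruent_mat Q (Gamma_mat r))) \<and>
        (M \<notin> Xi n \<longleftrightarrow>
           (\<exists>r. odd r \<and> congruence_summand (Gamma_mat r) M) \<or>
           (\<exists>s. odd s \<and> congruence_summand (lower_jordan_block s 0) M)))"
proof -
  have two: "(2::'a) \<noteq> 0" by (rule two_neq_zero[OF assms(1)])
  note M = assms(2)
  let ?Q = "\<exists>r Q. odd r \<and> has_jordan_cosquare r Q \<and> congruence_summand Q M"
  let ?J = "\<exists>s. odd s \<and> congruence_summand (lower_jordan_block s 0) M"
  let ?I = "\<exists>r. odd r \<and> equivalence_summand (1\<^sub>m r, lower_jordan_block r 1) (M\<^sup>T, M)"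
  let ?F = "\<exists>t>0. equivalence_summand (F_mat t, G_mat t) (M\<^sup>T, M)"
  have QI: "?Q \<longleftrightarrow> ?I"
  proof
    assume ?Q
    thus ?I using jordan_cosquare_congruence_summand_imp_equivalence_summand[OF M] by blast
  next
    assume ?I
    thus ?Q using jordan_one_equivalence_summand_imp_congruence_summand[OF M _ two] by blast
  qed
  have JF: "?J \<longleftrightarrow> ?F"
  proof
    assume ?J
    then obtain t x where "singular_chain M t x" using odd_nilpotent_summand_imp_chain[OF M] by blast
    thus ?F by (rule chain_imp_summands(2)[OF M])
  next
    assume ?F
    then obtain t x where "singular_chain M t x" using FG_equivalence_summand_imp_chain[OF M] by blast
    thus ?J by (rule chain_imp_summands(1)[OF M])
  qed
  have Xi: "M \<notin> Xi n \<longleftrightarrow> ?Q \<or> ?J"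
  proof
    assume "M \<notin> Xi n"
    then obtain S where S: "S \<in> carrier_mat n n" "invertible_mat S" "S\<^sup>T * M * S = M" "det S \<noteq> 1"
      using M unfolding Xi_def by auto
    have dS: "det S \<noteq> 0" using invertible_mat_iff_det[OF S(1)] S(2) by simp
    show "?Q \<or> ?J"
    proof (cases "det (pencil (M\<^sup>T) M) = 0")
      case True
      obtain t x where "singular_chain M t x" using singular_pencil_has_chain[OF M True] .
      from chain_imp_summands(1)[OF M this] show ?thesis ..
    next
      case False
      from regular_nonunimodular_has_jordan_summand[OF M False two S(1) dS S(3,4)] show ?thesis ..
    qed
  next
    assume "?Q \<or> ?J"
    thus "M \<notin> Xi n"
    proof
      assume ?Q
      then obtain r Q where Q: "odd r" "has_jordan_cosquare r Q" "congruence_summand Q M" by blast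
      show ?thesis by (rule odd_summand_imp_not_Xi[OF M has_jordan_cosquare_carrier(1)[OF Q(2)] Q(1) two Q(3)])
    next
      assume ?J
      thus ?thesis using odd_summand_imp_not_Xi[OF M lower_jordan_block_carrier _ two] by blast
    qed
  qed
  have nonsing: "M \<notin> Xi n \<longleftrightarrow> (\<exists>r. odd r \<and> similarity_summand (lower_jordan_block r 1) (cosquare M))"
    if "invertible_mat M"
  proof -
    have dM: "det M \<noteq> 0" using that invertible_mat_iff_det[OF M] by simp
    have "\<not> ?F" using FG_equivalence_summand_imp_chain[OF M] nonsingular_no_chain[OF M dM] by blast
    thus ?thesis unfolding Xi QI JF using similarity_summand_cosquare_iff[OF M dM lower_jordan_block_carrier] by blast
  qed
  have Gamma: "has_jordan_cosquare r (Gamma_mat r :: 'a mat)" if "odd r" for r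
    by (rule Gamma_mat_has_jordan_cosquare[OF that two])
  have uniq: "congruent_mat Q (Gamma_mat r :: 'a mat)"
    if "algebraically_closed TYPE('a)" "odd r" "has_jordan_cosquare r Q" for r and Q :: "'a mat"
    by (rule jordan_cosquare_congruent[OF that(1) two odd_pos[OF that(2)] that(3) Gamma[OF that(2)]])
  have "?Q \<longleftrightarrow> (\<exists>r. odd r \<and> congruence_summand (Gamma_mat r) M)" if "algebraically_closed TYPE('a)"
    using Gamma uniq[OF that] congruence_summand_congruent by blast
  thus ?thesis using Xi QI JF nonsing Gamma uniq by auto
qed

end
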